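(* Let $d\ge1$, let $\mathbf{X}_1,\ldots,\mathbf{X}_m$ be i.i.d. with law $\mu_{\mathbf{X}}$ and, independently, $\mathbf{Y}_1,\ldots,\mathbf{Y}_n$ i.i.d. with law $\mu_{\mathbf{Y}}$, where $\mu_{\mathbf{X}},\mu_{\mathbf{Y}}\in\mathcal{P}_{ac}(\mathbb{R}^d)$. Let $\mathcal{H}_{m+n}^d\subset[0,1]^d$ be fixed sets of $m+n$ points whose empirical distributions converge weakly to $\mathcal{U}^d$ as $\min(m,n)\to\infty$. Suppose $\mathrm{H}_0:\mu_{\mathbf{X}}=\mu_{\mathbf{Y}}$ holds. Then there are fixed nonnegative constants $\tau_1,\tau_2,\ldots$ such that, as $\min(m,n)\to\infty$, $$\frac{mn}{m+n}\,\mathrm{RE}_{m,n}^2\ \overset{w}{\longrightarrow}\ \sum_{j=1}^\infty\tau_jZ_j^2,$$ where $Z_1,Z_2,\ldots$ are i.i.d. standard normal random variables. Moreover, the $\tau_j$'s do not depend on the specific choice of $\mathcal{H}_{m+n}^d$ as long as the weak convergence assumption on it is satisfied.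
   Context: $\mathcal{P}_{ac}(\mathbb{R}^d)$: Lebesgue absolutely continuous probability measures on $\mathbb{R}^d$. $\mathcal{U}^d$: uniform distribution on $[0,1]^d$. $\overset{w}{\longrightarrow}$: weak convergence. $S_N$: permutations of $\{1,\ldots,N\}$. Joint empirical rank map: write the pooled sample as $\mathbf{W}_1,\ldots,\mathbf{W}_{m+n}$ (the $\mathbf{X}_i$'s followed by the $\mathbf{Y}_j$'s) and $\mathcal{H}_{m+n}^d=\{\mathbf{h}_1,\ldots,\mathbf{h}_{m+n}\}$. Let $\hat\sigma\in\arg\min_{\sigma\in S_{m+n}}\sum_i\|\mathbf{W}_i-\mathbf{h}_{\sigma(i)}\|^2$ (almost surely unique), and $\hat R_{m,n}(\mathbf{W}_i):=\mathbf{h}_{\hat\sigma(i)}$. Rank energy statistic: $$\mathrm{RE}_{m,n}^2=\frac2{mn}\sum_{i=1}^m\sum_{j=1}^n\|\hat R_{m,n}(\mathbf{X}_i)-\hat R_{m,n}(\mathbf{Y}_j)\|-\frac1{m^2}\sum_{i,j=1}^m\|\hat R_{m,n}(\mathbf{X}_i)-\hat R_{m,n}(\mathbf{X}_j)\|-\frac1{n^2}\sum_{i,j=1}^n\|\hat R_{m,n}(\mathbf{Y}_i)-\hat R_{m,n}(\mathbf{Y}_j)\|.$$ *)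

theory Defs
  imports "HOL-Probability.Probability"
begin

text \<open>The library's \<open>weak_conv_m\<close> covers only sequences of measures on the real line; here laws on
  \<open>\<real>\<^sup>d\<close> and limits along a filter on pairs \<open>(m, n)\<close> are needed.\<close>

definition weakly_converges ::
  "('i \<Rightarrow> 'b::topological_space measure) \<Rightarrow> 'b measure \<Rightarrow> 'i filter \<Rightarrow> bool" where
  "weakly_converges \<mu> \<nu> F \<longleftrightarrow>
    (\<forall>f::'b \<Rightarrow> real. continuous_on UNIV f \<longrightarrow> bounded (range f) \<longrightarrow>
      ((\<lambda>i. \<integral>x. f x \<partial>\<mu> i) \<longlongrightarrow> (\<integral>x. f x \<partial>\<nu>)) F)"

definition min_at_top :: "(nat \<times> nat) filter" where
  "min_at_top = filtercomap (\<lambda>(m, n). min m n) at_top"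

definition P_ac :: "(real ^ 'd) measure set" where
  "P_ac = {\<mu>. sets \<mu> = sets borel \<and> prob_space \<mu> \<and> absolutely_continuous lborel \<mu>}"

definition unif_cube :: "(real ^ 'd) measure" where
  "unif_cube = uniform_measure lborel (cbox 0 1)"

text \<open>Samples and point sets are indexed from 0; the point set of size \<open>N\<close> is
  \<open>{h N 0, \<dots>, h N (N - 1)}\<close>.\<close>

definition empirical :: "nat \<Rightarrow> (nat \<Rightarrow> real ^ 'd) \<Rightarrow> (real ^ 'd) measure" where
  "empirical N p = distr (uniform_count_measure {..<N}) borel p"

definition reference_points :: "(nat \<Rightarrow> nat \<Rightarrow> real ^ 'd) \<Rightarrow> bool" where
  "reference_points h \<longleftrightarrow>
    (\<forall>N. inj_on (h N) {..<N} \<and> h N ` {..<N} \<subseteq> cbox 0 1) \<and>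
    weakly_converges (\<lambda>(m, n). empirical (m + n) (h (m + n))) unif_cube min_at_top"

definition two_samples ::
  "'a measure \<Rightarrow> (nat \<Rightarrow> 'a \<Rightarrow> real ^ 'd) \<Rightarrow> (nat \<Rightarrow> 'a \<Rightarrow> real ^ 'd) \<Rightarrow>
    (real ^ 'd) measure \<Rightarrow> (real ^ 'd) measure \<Rightarrow> bool" where
  "two_samples M X Y \<mu>X \<mu>Y \<longleftrightarrow>
    prob_space M \<and>
    prob_space.indep_vars M (\<lambda>_. borel) (case_sum X Y) UNIV \<and>
    (\<forall>i. distr M borel (X i) = \<mu>X) \<and> (\<forall>j. distr M borel (Y j) = \<mu>Y)"

definition iid_std_normal :: "'b measure \<Rightarrow> (nat \<Rightarrow> 'b \<Rightarrow> real) \<Rightarrow> bool" where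
  "iid_std_normal P Z \<longleftrightarrow>
    prob_space P \<and>
    prob_space.indep_vars P (\<lambda>_. borel) Z UNIV \<and>
    (\<forall>j. distributed P lborel (Z j) std_normal_density)"

definition pooled :: "nat \<Rightarrow> (nat \<Rightarrow> 'c) \<Rightarrow> (nat \<Rightarrow> 'c) \<Rightarrow> nat \<Rightarrow> 'c" where
  "pooled m x y i = (if i < m then x i else y (i - m))"

text \<open>If the minimiser is not unique, \<open>arg_min_on\<close> selects one as a function of the (finite) set of
  minimisers only; so the selection is a measurable function of the sample \<open>w\<close>.\<close>

definition opt_perm :: "nat \<Rightarrow> (nat \<Rightarrow> real ^ 'd) \<Rightarrow> (nat \<Rightarrow> real ^ 'd) \<Rightarrow> nat \<Rightarrow> nat" where
  "opt_perm N p w =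
    arg_min_on (\<lambda>\<sigma>. \<Sum>i<N. (norm (w i - p (\<sigma> i)))\<^sup>2) {\<sigma>. \<sigma> permutes {..<N}}"

text \<open>\<open>emp_rank N p w i\<close> is the rank of the \<open>i\<close>-th pooled observation \<open>w i\<close>.\<close>

definition emp_rank ::
  "nat \<Rightarrow> (nat \<Rightarrow> real ^ 'd) \<Rightarrow> (nat \<Rightarrow> real ^ 'd) \<Rightarrow> nat \<Rightarrow> real ^ 'd" where
  "emp_rank N p w i = p (opt_perm N p w i)"

definition RE_sq ::
  "(nat \<Rightarrow> real ^ 'd) \<Rightarrow> nat \<Rightarrow> nat \<Rightarrow> (nat \<Rightarrow> real ^ 'd) \<Rightarrow> (nat \<Rightarrow> real ^ 'd) \<Rightarrow> real" where
  "RE_sq p m n x y =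
    (let R = emp_rank (m + n) p (pooled m x y);
         RX = (\<lambda>i. R i);
         RY = (\<lambda>j. R (m + j))
     in 2 / (real m * real n) * (\<Sum>i<m. \<Sum>j<n. norm (RX i - RY j))
        - 1 / (real m)\<^sup>2 * (\<Sum>i<m. \<Sum>j<m. norm (RX i - RX j))
        - 1 / (real n)\<^sup>2 * (\<Sum>i<n. \<Sum>j<n. norm (RY i - RY j)))"

end

theory Submission
  imports Defs
begin

text \<open>Under the null hypothesis the pooled sample is exchangeable and ties of the assignment cost are
  Lebesgue null, so the optimal permutation is uniformly distributed and the statistic becomes a
  quadratic two-sample permutation statistic of the reference points. Its kernel
  \<open>norm x + norm y - norm (x - y)\<close> is positive definite; a Cholesky decomposition along a dense sequence
  writes it as a uniformly convergent sum of products \<open>f l x * f l y\<close> of continuous features, and the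
  statistic as the sum of the squared two-sample contrasts of the features. Stein's method with the
  exchangeable pair that swaps two observations bounds the characteristic function of a single contrast
  for every ratio of the sample sizes. An auxiliary Gaussian integral linearises the quadratic form, so
  the Laplace transform of the first \<open>L\<close> terms converges to that of \<open>\<Sum>j<L. T L j * (Z j)\<^sup>2\<close>, where
  \<open>T L\<close> lists the eigenvalues of the covariance matrix of the first \<open>L\<close> features under the uniform
  law. Ky Fan's inequality makes the tails of these eigenvalue lists uniformly small; hence a
  subsequence converges in \<open>l\<^sup>1\<close> to the weights \<open>\<tau>\<close>, which depend on the dimension only. Finally, Laplace
  transforms at the natural numbers determine weak convergence on the half line.\<close>

section \<open>Positive definiteness of the distance kernel\<close>

text \<open>Uniform approximation of the kernel does not by itself control the statistic: its error
  enters multiplied by \<open>m * n / (m + n)\<close>, which tends to infinity. It only identifies,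
  for fixed sample sizes, the limit of the partial sums. What is uniform in \<open>m\<close> and
  \<open>n\<close> is the mean over permutations of the discarded squared contrasts, because the
  normalisation of the contrast absorbs that factor; it is at most twice a uniform bound of the sum
  of the discarded squared features on the cube. So one truncation level can be chosen before the
  sample sizes, and it is enough that suitable levels exist along a subsequence, although the limit
  along \<open>min_at_top\<close> is a full one. The weights thereby come from finite matrices
  alone, without spectral theory of a covariance operator. Features, eigenvalue lists, subsequence
  and weights are fixed before the reference points enter, so they cannot depend on them.\<close>

definition psd_kernel :: "('a \<Rightarrow> 'a \<Rightarrow> real) \<Rightarrow> bool" where
  "psd_kernel K \<longleftrightarrow> (\<forall>x y. K x y = K y x) \<and>
    (\<forall>(n::nat) x u. 0 \<le> (\<Sum>i<n. \<Sum>j<n. u i * u j * K (x i) (x j)))"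

lemma psd_kernelI:
  assumes "\<And>x y. K x y = K y x"
    and "\<And>(n::nat) x u. 0 \<le> (\<Sum>i<n. \<Sum>j<n. u i * u j * K (x i) (x j))"
  shows "psd_kernel K"
  using assms unfolding psd_kernel_def by blast

lemma psd_kernel_sym: "psd_kernel K \<Longrightarrow> K x y = K y x"
  unfolding psd_kernel_def by blast

lemma psd_kernel_nonneg:
  "psd_kernel K \<Longrightarrow> 0 \<le> (\<Sum>i<n. \<Sum>j<n. u i * u j * K (x i) (x j))" for n :: nat
  unfolding psd_kernel_def by blast

lemma psd_kernel_one: "psd_kernel (\<lambda>x y. 1)"
proof (rule psd_kernelI)
  fix n :: nat and u :: "nat \<Rightarrow> real"
  have "(\<Sum>i<n. \<Sum>j<n. u i * u j * 1) = (\<Sum>i<n. u i)\<^sup>2"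
    by (simp add: power2_eq_square sum_product)
  then show "0 \<le> (\<Sum>i<n. \<Sum>j<n. u i * u j * 1)" by simp
qed simp

text \<open>Expanding \<open>x \<bullet> y\<close> over \<open>Basis\<close> turns the form into a
  sum of forms of \<open>K\<close>, one per coordinate \<open>b\<close>, with the weights
  \<open>u i * (x i \<bullet> b)\<close>. This is the only case of the Schur product theorem that
  the exponential series requires.\<close>

lemma psd_kernel_times_inner:
  fixes K :: "'a::euclidean_space \<Rightarrow> 'a \<Rightarrow> real"
  assumes K: "psd_kernel K"
  shows "psd_kernel (\<lambda>x y. (x \<bullet> y) * K x y)"
proof (rule psd_kernelI)
  fix x y :: 'a
  show "(x \<bullet> y) * K x y = (y \<bullet> x) * K y x"
    by (simp add: psd_kernel_sym[OF K] inner_commute)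
next
  fix n :: nat and x :: "nat \<Rightarrow> 'a" and u :: "nat \<Rightarrow> real"
  have "(\<Sum>i<n. \<Sum>j<n. u i * u j * ((x i \<bullet> x j) * K (x i) (x j))) =
    (\<Sum>i<n. \<Sum>j<n. \<Sum>b\<in>Basis. (u i * (x i \<bullet> b)) * (u j * (x j \<bullet> b)) * K (x i) (x j))"
    by (subst euclidean_inner) (simp add: sum_distrib_left sum_distrib_right mult_ac)
  also have "\<dots> = (\<Sum>i<n. \<Sum>b\<in>Basis. \<Sum>j<n. (u i * (x i \<bullet> b)) * (u j * (x j \<bullet> b)) * K (x i) (x j))"
    by (intro sum.cong refl sum.swap)
  also have "\<dots> = (\<Sum>b\<in>Basis. \<Sum>i<n. \<Sum>j<n. (u i * (x i \<bullet> b)) * (u j * (x j \<bullet> b)) * K (x i) (x j))"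
    by (rule sum.swap)
  also have "\<dots> \<ge> 0"
    by (intro sum_nonneg psd_kernel_nonneg[OF K])
  finally show "0 \<le> (\<Sum>i<n. \<Sum>j<n. u i * u j * ((x i \<bullet> x j) * K (x i) (x j)))" .
qed

lemma psd_kernel_inner_power:
  "psd_kernel (\<lambda>x y :: 'a::euclidean_space. (x \<bullet> y) ^ k)"
proof (induction k)
  case (Suc k)
  show ?case using psd_kernel_times_inner[OF Suc] by simp
qed (simp add: psd_kernel_one)

text \<open>The squared norms in the exponent are absorbed into the weights. What remains is
  \<open>exp (2 * s * (x \<bullet> y))\<close>, a power series in the inner product with nonnegative
  coefficients.\<close>

lemma psd_kernel_gaussian:
  assumes "0 \<le> s"
  shows "psd_kernel (\<lambda>x y :: 'a::euclidean_space. exp (- s * (norm (x - y))\<^sup>2))"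
proof (rule psd_kernelI)
  fix x y :: 'a
  show "exp (- s * (norm (x - y))\<^sup>2) = exp (- s * (norm (y - x))\<^sup>2)"
    by (simp add: norm_minus_commute)
next
  fix n :: nat and x :: "nat \<Rightarrow> 'a" and u :: "nat \<Rightarrow> real"
  define v where "v i = u i * exp (- s * (norm (x i))\<^sup>2)" for i
  have eq: "u i * u j * exp (- s * (norm (x i - x j))\<^sup>2) = v i * v j * exp (2 * s * (x i \<bullet> x j))" for i j
  proof -
    have "(norm (x i - x j))\<^sup>2 = (norm (x i))\<^sup>2 + (norm (x j))\<^sup>2 - 2 * (x i \<bullet> x j)"
      by (simp add: power2_norm_eq_inner inner_diff_left inner_diff_right inner_commute)
    then have "exp (- s * (norm (x i - x j))\<^sup>2) =
      exp (- s * (norm (x i))\<^sup>2 + - s * (norm (x j))\<^sup>2 + 2 * s * (x i \<bullet> x j))"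
      by (simp only:) (simp add: algebra_simps)
    then show ?thesis by (simp only: exp_add v_def) simp
  qed
  have "(\<lambda>k. \<Sum>i<n. \<Sum>j<n. v i * v j * ((2 * s * (x i \<bullet> x j)) ^ k /\<^sub>R fact k)) sums
      (\<Sum>i<n. \<Sum>j<n. v i * v j * exp (2 * s * (x i \<bullet> x j)))"
    by (intro sums_sum sums_mult exp_converges)
  moreover have "0 \<le> (\<Sum>i<n. \<Sum>j<n. v i * v j * ((2 * s * (x i \<bullet> x j)) ^ k /\<^sub>R fact k))" for k
  proof -
    have "(\<Sum>i<n. \<Sum>j<n. v i * v j * ((2 * s * (x i \<bullet> x j)) ^ k /\<^sub>R fact k)) =
      (2 * s) ^ k / fact k * (\<Sum>i<n. \<Sum>j<n. v i * v j * (x i \<bullet> x j) ^ k)"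
      by (simp add: sum_distrib_left power_mult_distrib divide_inverse mult_ac)
    also have "\<dots> \<ge> 0"
      using assms by (intro mult_nonneg_nonneg psd_kernel_nonneg psd_kernel_inner_power) simp
    finally show ?thesis .
  qed
  ultimately show "0 \<le> (\<Sum>i<n. \<Sum>j<n. u i * u j * exp (- s * (norm (x i - x j))\<^sup>2))"
    unfolding eq by (metis (no_types, lifting) sums_le sums_zero)
qed

text \<open>The first term is \<open>- 1 / 2\<close>, and the quotient of the terms with indices
  \<open>k + 1\<close> and \<open>k\<close> is \<open>(k - 1/2) / (k + 1)\<close>, which is positive
  from \<open>k = 1\<close> on.\<close>

lemma gchoose_half_alternating:
  assumes "k \<ge> 1"
  shows "((1/2::real) gchoose k) * (- 1) ^ k \<le> 0"
proof -
  have "((1/2::real) gchoose Suc k) * (- 1) ^ Suc k \<le> 0" for k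
  proof (induction k)
    case (Suc k)
    have "((1/2::real) gchoose Suc (Suc k)) =
        ((1/2::real) gchoose Suc k) * ((1/2 - real (Suc k)) / real (Suc (Suc k)))"
      using gbinomial_mult_1[of "1/2::real" "Suc k"] by (simp add: field_simps)
    then have "((1/2::real) gchoose Suc (Suc k)) * (- 1) ^ Suc (Suc k) =
      (((1/2::real) gchoose Suc k) * (- 1) ^ Suc k) * ((real (Suc k) - 1/2) / real (Suc (Suc k)))"
      by (simp only:) (simp add: field_simps)
    also have "\<dots> \<le> 0"
      by (rule mult_nonpos_nonneg[OF Suc]) simp
    finally show ?case .
  qed simp
  then show ?thesis using assms by (cases k) auto
qed

text \<open>The binomial series of \<open>sqrt (1 - t)\<close>
  has nonpositive coefficients beyond the constant one, so it transports the positive definiteness of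
  the Gaussian kernels to \<open>- sqrt (1 - r * exp (- s * norm (x - y)\<^sup>2))\<close>; then let \<open>r\<close> tend to 1
  and, after division by \<open>sqrt s\<close>, let \<open>s\<close> tend to 0.\<close>

lemma norm_cond_neg_def:
  fixes x :: "nat \<Rightarrow> 'a::euclidean_space" and u :: "nat \<Rightarrow> real"
  assumes u: "(\<Sum>i<n. u i) = 0"
  shows "(\<Sum>i<n. \<Sum>j<n. u i * u j * norm (x i - x j)) \<le> 0"
proof -
  define e where "e s i j = exp (- s * (norm (x i - x j))\<^sup>2)" for s i j
  have 1: "(\<Sum>i<n. \<Sum>j<n. u i * u j * sqrt (1 - r * e s i j)) \<le> 0"
    if r: "0 \<le> r" "r < 1" and s: "0 \<le> s" for r s
  proof -
    have le1: "0 \<le> r * e s i j" "r * e s i j < 1" for i j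
    proof -
      have e1: "e s i j \<le> 1" using s by (simp add: e_def)
      show "0 \<le> r * e s i j" using r by (simp add: e_def)
      have "r * e s i j \<le> r * 1" using r e1 by (intro mult_left_mono) auto
      then show "r * e s i j < 1" using r by linarith
    qed
    have "(\<lambda>k. ((1/2) gchoose k) * (- (r * e s i j)) ^ k) sums (1 + - (r * e s i j)) powr (1/2)" for i j
      using le1[of i j] by (intro gen_binomial_real) auto
    moreover have "(1 + - (r * e s i j)) powr (1/2) = sqrt (1 - r * e s i j)" for i j
      using le1[of i j] powr_half_sqrt[of "1 - r * e s i j"] by simp
    ultimately have "(\<lambda>k. ((1/2) gchoose k) * (- (r * e s i j)) ^ k) sums sqrt (1 - r * e s i j)" for i j
      by metis
    then have "(\<lambda>k. \<Sum>i<n. \<Sum>j<n. u i * u j * (((1/2) gchoose k) * (- (r * e s i j)) ^ k)) sums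
        (\<Sum>i<n. \<Sum>j<n. u i * u j * sqrt (1 - r * e s i j))"
      by (intro sums_sum sums_mult)
    moreover have "(\<Sum>i<n. \<Sum>j<n. u i * u j * (((1/2) gchoose k) * (- (r * e s i j)) ^ k)) \<le> 0" for k
    proof -
      have pw: "(- (r * e s i j)) ^ k = (- 1) ^ k * r ^ k * exp (- (real k * s) * (norm (x i - x j))\<^sup>2)" for i j
        by (simp add: e_def power_mult_distrib power_minus[of "r * _"] flip: exp_of_nat_mult)
      have "(\<Sum>i<n. \<Sum>j<n. u i * u j * (((1/2) gchoose k) * (- (r * e s i j)) ^ k)) =
        (((1/2) gchoose k) * (- 1) ^ k) * (r ^ k *
          (\<Sum>i<n. \<Sum>j<n. u i * u j * exp (- (real k * s) * (norm (x i - x j))\<^sup>2)))"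
        unfolding pw by (simp add: sum_distrib_left mult_ac)
      also have "\<dots> \<le> 0"
      \<comment> \<open>The constant coefficient is 1 and has the wrong sign; its term vanishes
        because the weights sum to zero.\<close>
      proof (cases "k = 0")
        case True
        then show ?thesis
          using u by (simp flip: sum_distrib_left)
      next
        case False
        then show ?thesis
          using r s by (intro mult_nonpos_nonneg gchoose_half_alternating mult_nonneg_nonneg
            psd_kernel_nonneg[OF psd_kernel_gaussian]) auto
      qed
      finally show ?thesis .
    qed
    ultimately show ?thesis
      by (metis (no_types, lifting) sums_le sums_zero)
  qed
  \<comment> \<open>The factor \<open>r < 1\<close> kept the argument of the binomial series
    strictly inside the disc of convergence also on the diagonal, where \<open>e s i i = 1\<close>.
    It is now removed by continuity of the square root.\<close>
  have 2: "(\<Sum>i<n. \<Sum>j<n. u i * u j * sqrt (1 - e s i j)) \<le> 0" if s: "0 \<le> s" for s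
  proof -
    have "((\<lambda>r. \<Sum>i<n. \<Sum>j<n. u i * u j * sqrt (1 - r * e s i j)) \<longlongrightarrow>
        (\<Sum>i<n. \<Sum>j<n. u i * u j * sqrt (1 - 1 * e s i j))) (at_left 1)"
      by (intro tendsto_intros)
    moreover have "eventually (\<lambda>r::real. r \<in> {0<..<1}) (at_left 1)"
      by (rule eventually_at_leftI[of 0]) auto
    then have "eventually (\<lambda>r. (\<Sum>i<n. \<Sum>j<n. u i * u j * sqrt (1 - r * e s i j)) \<le> 0) (at_left 1)"
      by eventually_elim (use 1 s in auto)
    ultimately have "(\<Sum>i<n. \<Sum>j<n. u i * u j * sqrt (1 - 1 * e s i j)) \<le> 0"
      by (rule tendsto_upperbound) auto
    then show ?thesis by simp
  qed
  show ?thesis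
  proof (rule tendsto_upperbound)
    \<comment> \<open>The quotient under the root is minus the difference quotient at 0 of
      \<open>exp (- s * c)\<close> with \<open>c\<close> the squared distance.\<close>
    have lim: "((\<lambda>s. sqrt ((1 - e s i j) / s)) \<longlongrightarrow> norm (x i - x j)) (at_right 0)" for i j
    proof -
      define c where "c = (norm (x i - x j))\<^sup>2"
      have "((\<lambda>s. exp (- s * c)) has_real_derivative - c) (at 0)"
        by (auto intro!: derivative_eq_intros)
      then have "((\<lambda>s. (exp (- s * c) - 1) / s) \<longlongrightarrow> - c) (at 0)"
        by (simp add: has_field_derivative_iff)
      then have "((\<lambda>s. - ((exp (- s * c) - 1) / s)) \<longlongrightarrow> - (- c)) (at_right 0)"
        by (intro tendsto_minus) (rule tendsto_mono[OF at_le], auto)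
      then have "((\<lambda>s. sqrt (- ((exp (- s * c) - 1) / s))) \<longlongrightarrow> sqrt c) (at_right 0)"
        by (intro tendsto_real_sqrt) simp
      then show ?thesis
        by (simp add: e_def c_def minus_divide_left)
    qed
    show "((\<lambda>s. \<Sum>i<n. \<Sum>j<n. u i * u j * sqrt ((1 - e s i j) / s)) \<longlongrightarrow>
        (\<Sum>i<n. \<Sum>j<n. u i * u j * norm (x i - x j))) (at_right 0)"
      by (intro tendsto_intros lim)
    have "eventually (\<lambda>s::real. s > 0) (at_right 0)"
      by (simp add: eventually_at_right_less)
    then show "eventually (\<lambda>s. (\<Sum>i<n. \<Sum>j<n. u i * u j * sqrt ((1 - e s i j) / s)) \<le> 0) (at_right 0)"
    proof eventually_elim
      case (elim s)
      have "(\<Sum>i<n. \<Sum>j<n. u i * u j * sqrt ((1 - e s i j) / s)) =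
        (\<Sum>i<n. \<Sum>j<n. u i * u j * sqrt (1 - e s i j)) / sqrt s"
        by (simp add: real_sqrt_divide sum_divide_distrib)
      then show ?case using 2[of s] elim by (simp add: divide_nonpos_pos)
    qed
  qed auto
qed

text \<open>The origin is adjoined with the weight \<open>- (\<Sum>i<n. u i)\<close>, so that the
  weights sum to zero and conditional negative definiteness applies. The distances to the origin
  produce the two norms.\<close>

lemma psd_kernel_dist:
  "psd_kernel (\<lambda>x y :: 'a::euclidean_space. norm x + norm y - norm (x - y))"
proof (rule psd_kernelI)
  fix n :: nat and x :: "nat \<Rightarrow> 'a" and u :: "nat \<Rightarrow> real"
  define y where "y i = (if i < n then x i else 0)" for i
  define v where "v i = (if i < n then u i else - (\<Sum>i<n. u i))" for i
  have "(\<Sum>i<Suc n. v i) = 0" by (simp add: v_def)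
  then have "(\<Sum>i<Suc n. \<Sum>j<Suc n. v i * v j * norm (y i - y j)) \<le> 0"
    by (rule norm_cond_neg_def)
  also have "(\<Sum>i<Suc n. \<Sum>j<Suc n. v i * v j * norm (y i - y j)) =
    (\<Sum>i<n. \<Sum>j<n. u i * u j * norm (x i - x j)) - 2 * ((\<Sum>i<n. u i) * (\<Sum>i<n. u i * norm (x i)))"
  proof -
    define S where "S = (\<Sum>i<n. u i)"
    have "(\<Sum>i<n. u i * (- S) * norm (x i)) = - (S * (\<Sum>i<n. u i * norm (x i)))"
      "(\<Sum>i<n. (- S) * u i * norm (x i)) = - (S * (\<Sum>i<n. u i * norm (x i)))"
      by (simp_all add: sum_distrib_left sum_negf mult_ac)
    then show ?thesis
      unfolding S_def[symmetric]
      by (simp add: v_def y_def sum.distrib sum_subtractf sum_negf S_def[symmetric])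
  qed
  also have "(\<Sum>i<n. u i) * (\<Sum>i<n. u i * norm (x i)) = (\<Sum>i<n. \<Sum>j<n. u i * u j * norm (x j))"
    by (simp add: sum_product mult_ac)
  finally have *: "(\<Sum>i<n. \<Sum>j<n. u i * u j * norm (x i - x j)) \<le> 2 * (\<Sum>i<n. \<Sum>j<n. u i * u j * norm (x j))"
    by linarith
  have "(\<Sum>i<n. \<Sum>j<n. u i * u j * norm (x i)) = (\<Sum>i<n. \<Sum>j<n. u i * u j * norm (x j))"
    by (subst sum.swap) (simp add: mult_ac)
  with * show "0 \<le> (\<Sum>i<n. \<Sum>j<n. u i * u j * (norm (x i) + norm (x j) - norm (x i - x j)))"
    by (simp add: algebra_simps sum.distrib sum_subtractf)
qed (simp add: norm_minus_commute)

section \<open>Cholesky features\<close>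

lemma psd_kernel_diag_nonneg:
  assumes "psd_kernel K" shows "0 \<le> K x x"
  using psd_kernel_nonneg[OF assms, of "\<lambda>_. 1" "\<lambda>_. x" 1] by simp

lemma psd_kernel_Cauchy_Schwarz:
  assumes K: "psd_kernel K" shows "(K x y)\<^sup>2 \<le> K x x * K y y"
proof -
  have q: "0 \<le> K x x * a\<^sup>2 + 2 * a * b * K x y + K y y * b\<^sup>2" for a b
    using psd_kernel_nonneg[OF K, of "\<lambda>i. if i = 0 then a else b" "\<lambda>i. if i = 0 then x else y" 2]
    by (simp add: numeral_2_eq_2 psd_kernel_sym[OF K, of y x] power2_eq_square algebra_simps)
  have nn: "0 \<le> K x x" "0 \<le> K y y" by (rule psd_kernel_diag_nonneg[OF K])+
  show ?thesis
  proof (cases "K y y = 0")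
    case True
    have "K x y = 0"
    proof (rule ccontr)
      assume ne: "K x y \<noteq> 0"
      \<comment> \<open>With \<open>K y y = 0\<close> the form is affine in the second coefficient,
        which is chosen to make its value \<open>-1\<close>.\<close>
      have "0 \<le> K x x + 2 * (- ((K x x + 1) / (2 * K x y))) * K x y"
        using q[of 1 "- ((K x x + 1) / (2 * K x y))"] True by simp
      also have "\<dots> = -1" using ne by (simp add: field_simps)
      finally show False by simp
    qed
    with True show ?thesis by simp
  next
    case False
    then have pos: "K y y > 0" using nn by simp
    \<comment> \<open>The coefficients \<open>K y y\<close> and \<open>- K x y\<close> turn the form
      into \<open>K y y\<close> times the determinant.\<close>
    have "0 \<le> K y y * (K x x * K y y - (K x y)\<^sup>2)"
      using q[of "K y y" "- K x y"] by (simp add: power2_eq_square algebra_simps)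
    with pos show ?thesis by (simp add: zero_le_mult_iff)
  qed
qed

text \<open>One step of the Cholesky decomposition with pivot \<open>p\<close>. If the pivot is degenerate, then
  \<open>K p p = 0\<close> and division by zero leaves \<open>K\<close> unchanged, as it should.\<close>

definition schur_complement :: "'a \<Rightarrow> ('a \<Rightarrow> 'a \<Rightarrow> real) \<Rightarrow> 'a \<Rightarrow> 'a \<Rightarrow> real" where
  "schur_complement p K x y = K x y - K x p * K p y / K p p"

text \<open>The pivot is adjoined as an extra point with weight \<open>- (b / K p p)\<close>, the
  minimiser of the form in that coefficient; the minimum is the form of the Schur complement. For
  \<open>K p p = 0\<close> the weight is 0 and nothing is subtracted.\<close>

lemma psd_kernel_schur_complement:
  assumes K: "psd_kernel K"
  shows "psd_kernel (schur_complement p K)"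
proof (rule psd_kernelI)
  fix x y
  show "schur_complement p K x y = schur_complement p K y x"
    unfolding schur_complement_def
    using psd_kernel_sym[OF K, of x y] psd_kernel_sym[OF K, of x p] psd_kernel_sym[OF K, of p y] by simp
next
  fix n :: nat and x and u :: "nat \<Rightarrow> real"
  define b where "b = (\<Sum>i<n. u i * K (x i) p)"
  define y where "y i = (if i < n then x i else p)" for i
  define v where "v i = (if i < n then u i else - (b / K p p))" for i
  have b': "(\<Sum>i<n. u i * K p (x i)) = b"
    unfolding b_def by (simp add: psd_kernel_sym[OF K, of p])
  have "0 \<le> (\<Sum>i<Suc n. \<Sum>j<Suc n. v i * v j * K (y i) (y j))"
    by (rule psd_kernel_nonneg[OF K])
  also have "\<dots> = (\<Sum>i<n. \<Sum>j<n. u i * u j * K (x i) (x j)) + (\<Sum>i<n. u i * (- (b / K p p)) * K (x i) p)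
     + ((\<Sum>j<n. - (b / K p p) * u j * K p (x j)) + (- (b / K p p)) * (- (b / K p p)) * K p p)"
    by (simp add: v_def y_def sum.distrib sum_subtractf sum_negf)
  also have "(\<Sum>i<n. u i * (- (b / K p p)) * K (x i) p) = - (b / K p p) * b"
    unfolding sum_distrib_left b_def[symmetric] by (subst (3) b_def) (simp add: sum_distrib_left mult_ac sum_negf)
  also have "(\<Sum>j<n. - (b / K p p) * u j * K p (x j)) = - (b / K p p) * b"
    by (subst (3) b'[symmetric]) (simp add: sum_distrib_left mult_ac sum_negf)
  also have "- (b / K p p) * - (b / K p p) * K p p = b * b / K p p"
    by (cases "K p p = 0") auto
  finally have "0 \<le> (\<Sum>i<n. \<Sum>j<n. u i * u j * K (x i) (x j)) - b * b / K p p"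
    by simp
  also have "b * b = (\<Sum>i<n. \<Sum>j<n. u i * u j * (K (x i) p * K p (x j)))"
    by (subst (2) b'[symmetric], subst b_def, subst sum_product) (simp add: mult_ac)
  finally show "0 \<le> (\<Sum>i<n. \<Sum>j<n. u i * u j * schur_complement p K (x i) (x j))"
    by (simp add: schur_complement_def right_diff_distrib sum_subtractf sum_divide_distrib)
qed

primrec residual_kernel :: "(nat \<Rightarrow> 'a) \<Rightarrow> ('a \<Rightarrow> 'a \<Rightarrow> real) \<Rightarrow> nat \<Rightarrow> 'a \<Rightarrow> 'a \<Rightarrow> real" where
  "residual_kernel p K 0 = K"
| "residual_kernel p K (Suc l) = schur_complement (p l) (residual_kernel p K l)"

text \<open>This is the \<open>l\<close>-th column of the Cholesky factor. A degenerate pivot yields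
  the zero feature, through division by zero.\<close>

definition cholesky_feature :: "(nat \<Rightarrow> 'a) \<Rightarrow> ('a \<Rightarrow> 'a \<Rightarrow> real) \<Rightarrow> nat \<Rightarrow> 'a \<Rightarrow> real" where
  "cholesky_feature p K l x =
    residual_kernel p K l x (p l) / sqrt (residual_kernel p K l (p l) (p l))"

context
  fixes p :: "nat \<Rightarrow> 'a" and K :: "'a \<Rightarrow> 'a \<Rightarrow> real"
  assumes K: "psd_kernel K"
begin

lemma psd_residual_kernel: "psd_kernel (residual_kernel p K l)"
  by (induction l) (auto intro: K psd_kernel_schur_complement)

lemma residual_kernel_Suc:
  "residual_kernel p K (Suc l) x y =
    residual_kernel p K l x y - cholesky_feature p K l x * cholesky_feature p K l y"
  using psd_kernel_diag_nonneg[OF psd_residual_kernel[of l], of "p l"]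
    psd_kernel_sym[OF psd_residual_kernel[of l], of "p l" y]
  by (simp add: schur_complement_def cholesky_feature_def)

lemma residual_kernel_eq:
  "residual_kernel p K L x y = K x y - (\<Sum>l<L. cholesky_feature p K l x * cholesky_feature p K l y)"
  by (induction L) (simp_all del: residual_kernel.simps(2) add: residual_kernel_Suc)

text \<open>Elimination clears the row of its own pivot; if the pivot is degenerate, Cauchy-Schwarz
  shows that the row was zero already. Later steps only subtract multiples of entries of a zero
  row.\<close>

lemma residual_kernel_vanishes:
  assumes "a < L" shows "residual_kernel p K L (p a) x = 0"
  using assms
proof (induction L arbitrary: x)
  case (Suc L)
  show ?case
  proof (cases "a = L")
    case True
    let ?R = "residual_kernel p K L"
    have "(?R (p L) x)\<^sup>2 \<le> ?R (p L) (p L) * ?R x x"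
      by (rule psd_kernel_Cauchy_Schwarz[OF psd_residual_kernel])
    then show ?thesis using True
      by (cases "?R (p L) (p L) = 0") (simp_all add: schur_complement_def)
  next
    case False
    with Suc have "residual_kernel p K L (p a) y = 0" for y
      by simp
    then show ?thesis by (simp add: schur_complement_def)
  qed
qed simp

text \<open>The squared kernel distance between \<open>x\<close> and \<open>p a\<close> can only
  decrease, since squared feature differences are subtracted from it; once \<open>p a\<close> has
  been a pivot, its residual terms vanish. For the distance kernel the bound is
  \<open>2 * norm (x - p a)\<close>, so a dense sequence of pivots makes the residual uniformly
  small.\<close>

lemma residual_kernel_diag_le:
  assumes "a < L" shows "residual_kernel p K L x x \<le> K x x - 2 * K x (p a) + K (p a) (p a)"
proof -
  let ?R = "residual_kernel p K" and ?f = "cholesky_feature p K"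
  have dist: "?R L x x - 2 * ?R L x (p a) + ?R L (p a) (p a) =
      K x x - 2 * K x (p a) + K (p a) (p a) - (\<Sum>l<L. (?f l x - ?f l (p a))\<^sup>2)"
  proof -
    have "(\<Sum>l<L. (?f l x - ?f l (p a))\<^sup>2) = (\<Sum>l<L. ?f l x * ?f l x) - 2 * (\<Sum>l<L. ?f l x * ?f l (p a))
      + (\<Sum>l<L. ?f l (p a) * ?f l (p a))"
      by (simp add: power2_diff sum.distrib sum_subtractf sum_distrib_left mult_ac flip: power2_eq_square)
    then show ?thesis unfolding residual_kernel_eq by simp
  qed
  have "?R L x (p a) = 0" "?R L (p a) (p a) = 0"
    using residual_kernel_vanishes[OF assms] psd_kernel_sym[OF psd_residual_kernel, of L x "p a"] by simp_all
  with dist show ?thesis by (simp add: sum_nonneg)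
qed

end

lemma continuous_on_residual_kernel:
  fixes K :: "'a::topological_space \<Rightarrow> 'a \<Rightarrow> real"
  assumes "\<And>y. continuous_on UNIV (\<lambda>x. K x y)"
  shows "continuous_on UNIV (\<lambda>x. residual_kernel p K l x y)"
proof (induction l arbitrary: y)
  case (Suc l)
  show ?case
    unfolding residual_kernel.simps schur_complement_def divide_inverse
    by (intro continuous_intros Suc)
qed (simp add: assms)

section \<open>Uniform approximation of the distance kernel on the cube\<close>

lemma compact_finite_net:
  fixes C :: "'a::euclidean_space set"
  assumes "compact C"
  obtains p :: "nat \<Rightarrow> 'a" where "\<And>\<epsilon>. \<epsilon> > 0 \<Longrightarrow> \<exists>L. \<forall>x\<in>C. \<exists>a<L. norm (x - p a) < \<epsilon>"
proof -
  obtain D :: "'a set" where D: "countable D" "\<And>X. open X \<Longrightarrow> X \<noteq> {} \<Longrightarrow> \<exists>d\<in>D. d \<in> X"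
    using countable_dense_setE by metis
  have ne: "D \<noteq> {}" using D(2)[of UNIV] by auto
  define p where "p = from_nat_into D"
  have "\<exists>L. \<forall>x\<in>C. \<exists>a<L. norm (x - p a) < \<epsilon>" if "\<epsilon> > 0" for \<epsilon>
  proof -
    have "x \<in> (\<Union>a. ball (p a) \<epsilon>)" for x
    proof -
      obtain d where "d \<in> D" "d \<in> ball x \<epsilon>" using D(2)[of "ball x \<epsilon>"] \<open>\<epsilon> > 0\<close>
        by (metis centre_in_ball empty_iff open_ball)
      moreover then obtain a where "p a = d" using from_nat_into_surj[OF D(1)] p_def by metis
      ultimately show ?thesis by (auto simp: dist_commute)
    qed
    then obtain J where J: "finite J" "C \<subseteq> (\<Union>a\<in>J. ball (p a) \<epsilon>)"
      using compactE_image[OF assms, of UNIV "\<lambda>a. ball (p a) \<epsilon>"] by (metis open_ball subsetI)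
    have "\<forall>x\<in>C. \<exists>a < Suc (Max J). norm (x - p a) < \<epsilon>"
    proof
      fix x assume "x \<in> C"
      then obtain a where "a \<in> J" "x \<in> ball (p a) \<epsilon>" using J by auto
      then show "\<exists>a < Suc (Max J). norm (x - p a) < \<epsilon>"
        using J(1) by (auto simp: dist_norm norm_minus_commute less_Suc_eq_le intro!: exI[of _ a])
    qed
    then show ?thesis by blast
  qed
  then show ?thesis using that by blast
qed

text \<open>The limit theorem uses the features only through these properties. Continuity and
  boundedness hold on the whole space, so that features and their combinations are test functions
  for weak convergence; the approximation is confined to the cube, where the reference points
  lie.\<close>

locale distance_features =
  fixes f :: "nat \<Rightarrow> real ^ 'd \<Rightarrow> real" and \<eta> :: "nat \<Rightarrow> real"
  assumes cont: "\<And>l. continuous_on UNIV (f l)" and bdd: "\<And>l. bounded (range (f l))"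
    and error_tendsto: "\<eta> \<longlonglongrightarrow> 0"
    and kernel: "\<And>L x y. x \<in> cbox 0 1 \<Longrightarrow> y \<in> cbox 0 1 \<Longrightarrow>
      \<bar>norm x + norm y - norm (x - y) - (\<Sum>l<L. f l x * f l y)\<bar> \<le> \<eta> L"
    and tail: "\<And>L M x. L \<le> M \<Longrightarrow> x \<in> cbox 0 1 \<Longrightarrow> (\<Sum>l=L..<M. (f l x)\<^sup>2) \<le> \<eta> L"

lemma distance_features_exist:
  "\<exists>(f :: nat \<Rightarrow> real ^ 'd \<Rightarrow> real) \<eta>. distance_features f \<eta>"
proof -
  let ?C = "cbox 0 1 :: (real ^ 'd) set"
  define K where "K x y = norm x + norm y - norm (x - y)" for x y :: "real ^ 'd"
  have K: "psd_kernel K" unfolding K_def by (rule psd_kernel_dist)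
  obtain p :: "nat \<Rightarrow> real ^ 'd" where p: "\<And>\<epsilon>. \<epsilon> > 0 \<Longrightarrow> \<exists>L. \<forall>x\<in>?C. \<exists>a<L. norm (x - p a) < \<epsilon>"
    using compact_finite_net[OF compact_cbox[of "0::real^'d" 1]] by metis
  let ?R = "residual_kernel p K" and ?g = "cholesky_feature p K"
  note [simp del] = residual_kernel.simps(2)
  \<comment> \<open>Clamping to the cube makes the features bounded on the whole space and leaves
    their values on the cube unchanged.\<close>
  define f where "f l x = ?g l (clamp 0 1 x)" for l and x :: "real ^ 'd"
  define \<eta> where "\<eta> L = (SUP x\<in>?C. ?R L x x)" for L
  have contR: "continuous_on UNIV (\<lambda>x. ?R l x y)" for l y
    by (rule continuous_on_residual_kernel) (unfold K_def, intro continuous_intros)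
  have contg: "continuous_on UNIV (?g l)" for l
    unfolding cholesky_feature_def[abs_def] divide_inverse by (intro continuous_intros contR)
  have contf: "continuous_on UNIV (f l)" for l
  proof -
    have "continuous_on (cbox 0 1) (?g l)"
      using contg continuous_on_subset by blast
    then have "continuous_on UNIV (\<lambda>x. ?g l (clamp 0 1 x))"
      by (intro clamp_continuous_on)
    then show ?thesis by (simp add: f_def[abs_def])
  qed
  have clampC: "clamp 0 1 x \<in> ?C" for x :: "real^'d"
    by (rule clamp_in_interval) (auto simp: Basis_vec_def inner_axis)
  have fC: "f l x = ?g l x" if "x \<in> ?C" for l x
    using that by (simp add: f_def clamp_cancel_cbox)
  have bddg: "bounded (?g l ` ?C)" for l
    by (intro compact_imp_bounded compact_continuous_image compact_cbox continuous_on_subset[OF contg]) simp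
  have bddf: "bounded (range (f l))" for l
  proof (rule bounded_subset[OF bddg[of l]])
    show "range (f l) \<subseteq> ?g l ` ?C" using clampC by (auto simp: f_def)
  qed
  have diag: "?R L x x = K x x - (\<Sum>l<L. (?g l x)\<^sup>2)" for L x
    by (simp add: residual_kernel_eq[OF K] power2_eq_square)
  have bddR: "bdd_above ((\<lambda>x. ?R L x x) ` ?C)" for L
  proof -
    have "continuous_on UNIV (\<lambda>x. ?R L x x)"
    proof -
      have "continuous_on UNIV (\<lambda>x. K x x)" unfolding K_def by (intro continuous_intros)
      then show ?thesis unfolding diag by (intro continuous_intros contg)
    qed
    then have "compact ((\<lambda>x. ?R L x x) ` ?C)"
      by (intro compact_continuous_image compact_cbox) (auto intro: continuous_on_subset)
    then show ?thesis by (intro bounded_imp_bdd_above compact_imp_bounded)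
  qed
  have le: "?R L x x \<le> \<eta> L" if "x \<in> ?C" for L x
    unfolding \<eta>_def using that bddR by (intro cSUP_upper)
  have ne: "?C \<noteq> {}" using clampC by blast
  have nn: "0 \<le> \<eta> L" for L
    using order_trans[OF psd_kernel_diag_nonneg[OF psd_residual_kernel[OF K]] le[OF clampC]] .
  have \<eta>0: "\<eta> \<longlonglongrightarrow> 0"
  proof (rule LIMSEQ_I)
    fix r :: real assume "r > 0"
    then obtain L0 where L0: "\<And>x. x \<in> ?C \<Longrightarrow> \<exists>a<L0. norm (x - p a) < r / 4" using p[of "r/4"] by auto
    have "norm (\<eta> L - 0) < r" if "L \<ge> L0" for L
    proof -
      have "?R L x x \<le> r / 2" if x: "x \<in> ?C" for x
      proof -
        obtain a where a: "a < L0" "norm (x - p a) < r / 4" using L0[OF x] by blast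
        have "?R L x x \<le> K x x - 2 * K x (p a) + K (p a) (p a)"
          using a \<open>L \<ge> L0\<close> by (intro residual_kernel_diag_le[OF K]) auto
        also have "\<dots> = 2 * norm (x - p a)" by (simp add: K_def)
        finally show ?thesis using a by simp
      qed
      then have "\<eta> L \<le> r / 2" unfolding \<eta>_def by (intro cSUP_least ne)
      then show ?thesis using nn[of L] \<open>r > 0\<close> by simp
    qed
    then show "\<exists>no. \<forall>n\<ge>no. norm (\<eta> n - 0) < r" by blast
  qed
  have K_eq: "\<bar>norm x + norm y - norm (x - y) - (\<Sum>l<L. f l x * f l y)\<bar> \<le> \<eta> L"
    if "x \<in> ?C" "y \<in> ?C" for L x y
  proof -
    have "norm x + norm y - norm (x - y) - (\<Sum>l<L. f l x * f l y) = ?R L x y"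
      using that by (simp add: residual_kernel_eq[OF K] fC K_def)
    moreover have "(?R L x y)\<^sup>2 \<le> (\<eta> L)\<^sup>2"
    proof -
      have "(?R L x y)\<^sup>2 \<le> ?R L x x * ?R L y y"
        by (rule psd_kernel_Cauchy_Schwarz[OF psd_residual_kernel[OF K]])
      also have "\<dots> \<le> \<eta> L * \<eta> L"
        using that le nn psd_kernel_diag_nonneg[OF psd_residual_kernel[OF K]] by (intro mult_mono) auto
      finally show ?thesis by (simp add: power2_eq_square)
    qed
    ultimately show ?thesis using nn[of L] by (simp add: abs_le_square_iff[symmetric])
  qed
  have tail: "(\<Sum>l=L..<M. (f l x)\<^sup>2) \<le> \<eta> L" if "L \<le> M" "x \<in> ?C" for L M x
  proof -
    have "(\<Sum>l<M. (?g l x)\<^sup>2) = (\<Sum>l<L. (?g l x)\<^sup>2) + (\<Sum>l=L..<M. (?g l x)\<^sup>2)"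
      using that(1) sum.atLeastLessThan_concat[of 0 L M "\<lambda>l. (?g l x)\<^sup>2"] by (simp add: lessThan_atLeast0)
    then have "(\<Sum>l=L..<M. (?g l x)\<^sup>2) = ?R L x x - ?R M x x" by (simp add: diag)
    also have "\<dots> \<le> \<eta> L"
      using le[OF that(2), of L] psd_kernel_diag_nonneg[OF psd_residual_kernel[OF K], of p M x] by simp
    finally show ?thesis using that by (simp add: fC)
  qed
  show ?thesis
    by (intro exI[of _ f] exI[of _ \<eta>] distance_features.intro contf bddf \<eta>0 K_eq tail)
qed

section \<open>Contrasts of random permutations\<close>

definition perm_avg :: "nat \<Rightarrow> ((nat \<Rightarrow> nat) \<Rightarrow> real) \<Rightarrow> real" where
  "perm_avg N F = (\<Sum>\<sigma> | \<sigma> permutes {..<N}. F \<sigma>) / fact N"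

lemma finite_perms: "finite {\<sigma>. \<sigma> permutes {..<N::nat}}"
  by (simp add: finite_permutations)

lemma perm_avg_const [simp]: "perm_avg N (\<lambda>_. c) = c"
  by (simp add: perm_avg_def card_permutations)

lemma perm_avg_add: "perm_avg N (\<lambda>\<sigma>. F \<sigma> + H \<sigma>) = perm_avg N F + perm_avg N H"
  by (simp add: perm_avg_def sum.distrib add_divide_distrib)

lemma perm_avg_diff: "perm_avg N (\<lambda>\<sigma>. F \<sigma> - H \<sigma>) = perm_avg N F - perm_avg N H"
  by (simp add: perm_avg_def sum_subtractf diff_divide_distrib)

lemma perm_avg_cmult: "perm_avg N (\<lambda>\<sigma>. c * F \<sigma>) = c * perm_avg N F"
  by (simp add: perm_avg_def sum_distrib_left)

lemma perm_avg_sum: "perm_avg N (\<lambda>\<sigma>. \<Sum>i\<in>I. F i \<sigma>) = (\<Sum>i\<in>I. perm_avg N (F i))"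
  unfolding perm_avg_def by (subst sum.swap) (simp add: sum_divide_distrib)

lemma perm_avg_cong:
  "(\<And>\<sigma>. \<sigma> permutes {..<N} \<Longrightarrow> F \<sigma> = H \<sigma>) \<Longrightarrow> perm_avg N F = perm_avg N H"
  unfolding perm_avg_def by (intro arg_cong2[where f = "(/)"] sum.cong) auto

lemma perm_avg_mono:
  "(\<And>\<sigma>. \<sigma> permutes {..<N} \<Longrightarrow> F \<sigma> \<le> H \<sigma>) \<Longrightarrow> perm_avg N F \<le> perm_avg N H"
  unfolding perm_avg_def by (intro divide_right_mono sum_mono) auto

lemma perm_avg_abs: "\<bar>perm_avg N F\<bar> \<le> perm_avg N (\<lambda>\<sigma>. \<bar>F \<sigma>\<bar>)"
  unfolding perm_avg_def by (simp add: divide_right_mono sum_abs)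

lemma perm_avg_compose:
  assumes p: "p permutes {..<N}"
  shows "perm_avg N (\<lambda>\<sigma>. F (\<sigma> \<circ> p)) = perm_avg N F"
proof -
  have "(\<Sum>\<sigma> | \<sigma> permutes {..<N}. F (\<sigma> \<circ> p)) = (\<Sum>\<sigma> | \<sigma> permutes {..<N}. F \<sigma>)"
    by (rule sum.reindex_bij_witness[where i = "\<lambda>\<sigma>. \<sigma> \<circ> inv p" and j = "\<lambda>\<sigma>. \<sigma> \<circ> p"])
      (auto simp: comp_assoc permutes_inv_o[OF p] intro: permutes_compose permutes_inv p)
  then show ?thesis by (simp add: perm_avg_def)
qed

text \<open>The factor \<open>m * n / (m + n)\<close> of the statistic is the reciprocal of
  \<open>1 / m + 1 / n\<close>, so a squared contrast already carries it. With this normalisation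
  the limiting variance is the plain variance of \<open>g\<close>, whatever the ratio of the sample
  sizes.\<close>

definition contrast :: "nat \<Rightarrow> nat \<Rightarrow> (nat \<Rightarrow> real) \<Rightarrow> (nat \<Rightarrow> nat) \<Rightarrow> real" where
  "contrast m n g \<sigma> = ((\<Sum>i<m. g (\<sigma> i)) / real m - (\<Sum>j<n. g (\<sigma> (m + j))) / real n) /
    sqrt (1 / real m + 1 / real n)"

lemma contrast_sum:
  "contrast m n (\<lambda>a. \<Sum>l\<in>I. c l * g l a) \<sigma> = (\<Sum>l\<in>I. c l * contrast m n (g l) \<sigma>)"
proof -
  have "(\<Sum>i<m. \<Sum>l\<in>I. c l * g l (\<sigma> i)) = (\<Sum>l\<in>I. c l * (\<Sum>i<m. g l (\<sigma> i)))"
    "(\<Sum>j<n. \<Sum>l\<in>I. c l * g l (\<sigma> (m + j))) = (\<Sum>l\<in>I. c l * (\<Sum>j<n. g l (\<sigma> (m + j))))"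
    by (subst sum.swap, simp add: sum_distrib_left)+
  moreover define A where "A l = (\<Sum>i<m. g l (\<sigma> i))" for l
  moreover define B where "B l = (\<Sum>j<n. g l (\<sigma> (m + j)))" for l
  ultimately show ?thesis
    unfolding contrast_def A_def[symmetric] B_def[symmetric]
    by (simp add: sum_divide_distrib sum_subtractf right_diff_distrib diff_divide_distrib)
qed

lemma contrast_transpose:
  assumes "i < m" "j < n"
  shows "contrast m n g (\<sigma> \<circ> Transposition.transpose i (m + j)) - contrast m n g \<sigma> =
    sqrt (1 / real m + 1 / real n) * (g (\<sigma> (m + j)) - g (\<sigma> i))"
proof -
  let ?t = "Transposition.transpose i (m + j)" and ?s = "sqrt (1 / real m + 1 / real n)"
  define d where "d = g (\<sigma> (m + j)) - g (\<sigma> i)"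
  have X: "(\<Sum>k<m. g ((\<sigma> \<circ> ?t) k)) = (\<Sum>k<m. g (\<sigma> k)) + d"
  proof -
    have "(\<Sum>k\<in>{..<m} - {i}. g ((\<sigma> \<circ> ?t) k)) = (\<Sum>k\<in>{..<m} - {i}. g (\<sigma> k))"
      by (intro sum.cong refl) (auto simp: Transposition.transpose_def)
    then show ?thesis
      using assms by (simp add: sum.remove[of "{..<m}" i] d_def)
  qed
  have Y: "(\<Sum>k<n. g ((\<sigma> \<circ> ?t) (m + k))) = (\<Sum>k<n. g (\<sigma> (m + k))) - d"
  proof -
    have "(\<Sum>k\<in>{..<n} - {j}. g ((\<sigma> \<circ> ?t) (m + k))) = (\<Sum>k\<in>{..<n} - {j}. g (\<sigma> (m + k)))"
      using assms by (intro sum.cong refl) (auto simp: Transposition.transpose_def)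
    then show ?thesis
      using assms by (simp add: sum.remove[of "{..<n}" j] d_def)
  qed
  have pos: "1 / real m + 1 / real n > 0" using assms by (intro add_pos_pos) auto
  have "contrast m n g (\<sigma> \<circ> ?t) - contrast m n g \<sigma> =
    (1 / real m + 1 / real n) * d / ?s"
    unfolding contrast_def X Y by (simp add: diff_divide_distrib add_divide_distrib algebra_simps)
  also have "\<dots> = ?s * d"
    using pos real_div_sqrt[of "1 / real m + 1 / real n"]
    by (metis less_imp_le times_divide_eq_left)
  finally show ?thesis by (simp add: d_def)
qed

text \<open>The exchangeable pair swaps two observations between the samples.\<close>

lemma contrast_stein_identity:
  fixes f :: "real \<Rightarrow> real" and g :: "nat \<Rightarrow> real"
  assumes "0 < m" "0 < n"
  defines "W \<equiv> contrast m n g" and "s \<equiv> sqrt (1 / real m + 1 / real n)"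
  shows "perm_avg (m + n) (\<lambda>\<sigma>. W \<sigma> * f (W \<sigma>)) =
    (\<Sum>i<m. \<Sum>j<n. perm_avg (m + n) (\<lambda>\<sigma>. s * (g (\<sigma> (m + j)) - g (\<sigma> i)) *
      (f (W \<sigma> + s * (g (\<sigma> (m + j)) - g (\<sigma> i))) - f (W \<sigma>)))) / (2 * s\<^sup>2 * real m * real n)"
proof -
  let ?E = "perm_avg (m + n)"
  define D where "D i j \<sigma> = s * (g (\<sigma> (m + j)) - g (\<sigma> i))" for i j \<sigma>
  have pos: "1 / real m + 1 / real n > 0" using assms by (intro add_pos_pos) auto
  then have s: "s > 0" "s\<^sup>2 = 1 / real m + 1 / real n" by (auto simp: s_def)
  \<comment> \<open>The swap maps \<open>W\<close> to \<open>W + D\<close> and \<open>D\<close> to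
    \<open>- D\<close>, and it preserves the uniform law. Hence the mean of
    \<open>D * f (W + D)\<close> is minus the mean of \<open>D * f W\<close>.\<close>
  have pair: "?E (\<lambda>\<sigma>. D i j \<sigma> * (f (W \<sigma> + D i j \<sigma>) - f (W \<sigma>))) = - 2 * ?E (\<lambda>\<sigma>. D i j \<sigma> * f (W \<sigma>))"
    if ij: "i < m" "j < n" for i j
  proof -
    let ?t = "Transposition.transpose i (m + j)"
    have W': "W (\<sigma> \<circ> ?t) = W \<sigma> + D i j \<sigma>" for \<sigma>
      using contrast_transpose[OF ij, of g \<sigma>] by (simp add: W_def D_def s_def)
    have "?E (\<lambda>\<sigma>. D i j \<sigma> * f (W \<sigma> + D i j \<sigma>)) = ?E (\<lambda>\<sigma>. (\<lambda>\<rho>. - D i j \<rho> * f (W \<rho>)) (\<sigma> \<circ> ?t))"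
      by (intro perm_avg_cong) (simp add: W', simp add: D_def algebra_simps)
    also have "\<dots> = ?E (\<lambda>\<rho>. - D i j \<rho> * f (W \<rho>))"
      using ij by (intro perm_avg_compose permutes_swap_id) auto
    also have "\<dots> = - ?E (\<lambda>\<sigma>. D i j \<sigma> * f (W \<sigma>))"
      using perm_avg_cmult[of "m + n" "-1" "\<lambda>\<sigma>. D i j \<sigma> * f (W \<sigma>)"] by simp
    finally show ?thesis
      by (simp add: right_diff_distrib perm_avg_diff)
  qed
  \<comment> \<open>Stein's linear regression property; it holds exactly, with no remainder.\<close>
  have drift: "(\<Sum>i<m. \<Sum>j<n. D i j \<sigma>) = - (s\<^sup>2 * real m * real n) * W \<sigma>" for \<sigma>
  proof -
    have "(\<Sum>i<m. \<Sum>j<n. D i j \<sigma>) =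
        s * (real m * (\<Sum>j<n. g (\<sigma> (m + j))) - real n * (\<Sum>i<m. g (\<sigma> i)))"
      by (simp add: D_def sum_subtractf right_diff_distrib sum_distrib_left mult_ac)
    also have "\<dots> = s * (- (real m * real n) * (s * W \<sigma>))"
    proof -
      have "s * W \<sigma> = (\<Sum>i<m. g (\<sigma> i)) / real m - (\<Sum>j<n. g (\<sigma> (m + j))) / real n"
        using s(1) by (simp add: W_def contrast_def s_def[symmetric])
      then have "real m * (\<Sum>j<n. g (\<sigma> (m + j))) - real n * (\<Sum>i<m. g (\<sigma> i)) =
          - (real m * real n) * (s * W \<sigma>)"
        using assms(1,2) by (simp only:) (simp add: field_simps)
      then show ?thesis by (simp only:)
    qed
    finally show ?thesis by (simp add: power2_eq_square mult_ac)
  qed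
  have "(\<Sum>i<m. \<Sum>j<n. ?E (\<lambda>\<sigma>. D i j \<sigma> * (f (W \<sigma> + D i j \<sigma>) - f (W \<sigma>)))) =
    - 2 * (\<Sum>i<m. \<Sum>j<n. ?E (\<lambda>\<sigma>. D i j \<sigma> * f (W \<sigma>)))"
    by (simp add: pair sum_distrib_left sum_negf)
  also have "(\<Sum>i<m. \<Sum>j<n. ?E (\<lambda>\<sigma>. D i j \<sigma> * f (W \<sigma>))) = ?E (\<lambda>\<sigma>. (\<Sum>i<m. \<Sum>j<n. D i j \<sigma>) * f (W \<sigma>))"
    by (simp add: perm_avg_sum[symmetric] sum_distrib_right)
  also have "\<dots> = - (s\<^sup>2 * real m * real n) * ?E (\<lambda>\<sigma>. W \<sigma> * f (W \<sigma>))"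
    unfolding drift by (subst perm_avg_cmult[symmetric]) (simp add: mult_ac)
  finally show ?thesis
    using s(1) assms(1,2) unfolding D_def by (simp add: field_simps)
qed

text \<open>Stein's identity with the identity function for \<open>f\<close>. The factor
  \<open>s\<^sup>2\<close> cancels, so no growth in the sample sizes remains.\<close>

lemma contrast_second_moment:
  assumes "0 < m" "0 < n"
  shows "perm_avg (m + n) (\<lambda>\<sigma>. (contrast m n g \<sigma>)\<^sup>2) =
    (\<Sum>i<m. \<Sum>j<n. perm_avg (m + n) (\<lambda>\<sigma>. (g (\<sigma> (m + j)) - g (\<sigma> i))\<^sup>2)) / (2 * real m * real n)"
proof -
  let ?s = "sqrt (1 / real m + 1 / real n)"
  have pos: "1 / real m + 1 / real n > 0" using assms by (intro add_pos_pos) auto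
  have "perm_avg (m + n) (\<lambda>\<sigma>. ?s * (g (\<sigma> (m + j)) - g (\<sigma> i)) *
      (contrast m n g \<sigma> + ?s * (g (\<sigma> (m + j)) - g (\<sigma> i)) - contrast m n g \<sigma>)) =
     ?s\<^sup>2 * perm_avg (m + n) (\<lambda>\<sigma>. (g (\<sigma> (m + j)) - g (\<sigma> i))\<^sup>2)" for i j
    by (subst perm_avg_cmult[symmetric]) (simp add: power2_eq_square mult_ac)
  then have "perm_avg (m + n) (\<lambda>\<sigma>. contrast m n g \<sigma> * contrast m n g \<sigma>) =
    (?s\<^sup>2 * (\<Sum>i<m. \<Sum>j<n. perm_avg (m + n) (\<lambda>\<sigma>. (g (\<sigma> (m + j)) - g (\<sigma> i))\<^sup>2))) /
      (2 * ?s\<^sup>2 * real m * real n)"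
    by (subst contrast_stein_identity[OF assms, of g "\<lambda>w. w"])
      (simp only: sum_distrib_left[symmetric])
  moreover have "?s\<^sup>2 * S / (2 * ?s\<^sup>2 * real m * real n) = S / (2 * real m * real n)" for S
    using pos assms by (simp del: real_sqrt_pow2_iff real_sqrt_pow2)
  ultimately show ?thesis by (simp only: power2_eq_square[of "contrast _ _ _ _"])
qed

text \<open>From \<open>(a - b)\<^sup>2 \<le> 2 * a\<^sup>2 + 2 * b\<^sup>2\<close> each summand is
  at most \<open>4 * B\<close>, and the denominator \<open>2 * m * n\<close> leaves
  \<open>2 * B\<close>. Uniformity in the sample sizes and in the index set \<open>I\<close> is what
  later makes the discarded features negligible.\<close>

lemma contrast_sum_second_moment_le:
  assumes "0 < m" "0 < n" and bnd: "\<And>a. a < m + n \<Longrightarrow> (\<Sum>l\<in>I. (g l a)\<^sup>2) \<le> B"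
  shows "perm_avg (m + n) (\<lambda>\<sigma>. \<Sum>l\<in>I. (contrast m n (g l) \<sigma>)\<^sup>2) \<le> 2 * B"
proof -
  have "perm_avg (m + n) (\<lambda>\<sigma>. \<Sum>l\<in>I. (contrast m n (g l) \<sigma>)\<^sup>2) =
    (\<Sum>l\<in>I. (\<Sum>i<m. \<Sum>j<n. perm_avg (m + n) (\<lambda>\<sigma>. (g l (\<sigma> (m + j)) - g l (\<sigma> i))\<^sup>2)) / (2 * real m * real n))"
    by (simp add: perm_avg_sum contrast_second_moment[OF assms(1,2)])
  also have "\<dots> = (\<Sum>i<m. \<Sum>j<n. perm_avg (m + n) (\<lambda>\<sigma>. \<Sum>l\<in>I. (g l (\<sigma> (m + j)) - g l (\<sigma> i))\<^sup>2)) / (2 * real m * real n)"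
    unfolding perm_avg_sum sum_divide_distrib[symmetric]
    by (subst sum.swap, subst (2) sum.swap) simp
  also have "\<dots> \<le> (\<Sum>i<m. \<Sum>j<n. 4 * B) / (2 * real m * real n)"
  proof (intro divide_right_mono sum_mono)
    fix i j assume ij: "i \<in> {..<m}" "j \<in> {..<n}"
    have "perm_avg (m + n) (\<lambda>\<sigma>. \<Sum>l\<in>I. (g l (\<sigma> (m + j)) - g l (\<sigma> i))\<^sup>2) \<le> perm_avg (m + n) (\<lambda>_. 4 * B)"
    proof (rule perm_avg_mono)
      fix \<sigma> assume \<sigma>: "\<sigma> permutes {..<m + n}"
      have lt: "\<sigma> (m + j) < m + n" "\<sigma> i < m + n"
        using permutes_in_image[OF \<sigma>, of "m + j"] permutes_in_image[OF \<sigma>, of i] ij by auto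
      have "(\<Sum>l\<in>I. (g l (\<sigma> (m + j)) - g l (\<sigma> i))\<^sup>2) \<le>
          (\<Sum>l\<in>I. 2 * (g l (\<sigma> (m + j)))\<^sup>2 + 2 * (g l (\<sigma> i))\<^sup>2)"
      proof (rule sum_mono)
        fix l
        have "0 \<le> (g l (\<sigma> (m + j)) + g l (\<sigma> i))\<^sup>2" by simp
        then show "(g l (\<sigma> (m + j)) - g l (\<sigma> i))\<^sup>2 \<le> 2 * (g l (\<sigma> (m + j)))\<^sup>2 + 2 * (g l (\<sigma> i))\<^sup>2"
          by (simp add: power2_sum power2_diff)
      qed
      also have "\<dots> \<le> 4 * B"
        using bnd[OF lt(1)] bnd[OF lt(2)] by (simp add: sum.distrib flip: sum_distrib_left)
      finally show "(\<Sum>l\<in>I. (g l (\<sigma> (m + j)) - g l (\<sigma> i))\<^sup>2) \<le> 4 * B" .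
    qed
    then show "perm_avg (m + n) (\<lambda>\<sigma>. \<Sum>l\<in>I. (g l (\<sigma> (m + j)) - g l (\<sigma> i))\<^sup>2) \<le> 4 * B" by simp
  qed auto
  also have "\<dots> = 2 * B" using assms by (simp add: field_simps)
  finally show ?thesis .
qed

lemma contrast_second_moment_le:
  assumes "0 < m" "0 < n" and bnd: "\<And>a. a < m + n \<Longrightarrow> \<bar>g a\<bar> \<le> G"
  shows "perm_avg (m + n) (\<lambda>\<sigma>. (contrast m n g \<sigma>)\<^sup>2) \<le> 2 * G\<^sup>2"
proof -
  have "(g a)\<^sup>2 \<le> G\<^sup>2" if "a < m + n" for a
    using bnd[OF that] by (simp flip: abs_le_square_iff)
  then show ?thesis
    using contrast_sum_second_moment_le[OF assms(1,2), where I = "{0::nat}" and g = "\<lambda>_. g" and B = "G\<^sup>2"]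
    by simp
qed

text \<open>The pooled mean is the same for all permutations, so either deviation is a fraction of
  \<open>s * W\<close> in absolute value. The constant comes from
  \<open>\<bar>W\<bar> \<le> 1 / 2 + W\<^sup>2 / 2\<close> and the second moment bound
  \<open>2 * G\<^sup>2\<close>.\<close>

lemma sample_mean_deviation:
  fixes g :: "nat \<Rightarrow> real"
  assumes mn: "0 < m" "0 < n" and bnd: "\<And>a. a < m + n \<Longrightarrow> \<bar>g a\<bar> \<le> G"
  defines "\<gamma> \<equiv> (\<Sum>a<m + n. g a) / real (m + n)" and "s \<equiv> sqrt (1 / real m + 1 / real n)"
  shows "perm_avg (m + n) (\<lambda>\<sigma>. \<bar>(\<Sum>i<m. g (\<sigma> i)) / real m - \<gamma>\<bar>) \<le> s * (1 / 2 + G\<^sup>2)"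
    and "perm_avg (m + n) (\<lambda>\<sigma>. \<bar>(\<Sum>j<n. g (\<sigma> (m + j))) / real n - \<gamma>\<bar>) \<le> s * (1 / 2 + G\<^sup>2)"
proof -
  let ?X = "\<lambda>\<sigma>. (\<Sum>i<m. g (\<sigma> i)) / real m" and ?Y = "\<lambda>\<sigma>. (\<Sum>j<n. g (\<sigma> (m + j))) / real n"
  let ?W = "contrast m n g"
  have pos: "1 / real m + 1 / real n > 0" using mn by (intro add_pos_pos) auto
  then have s: "s > 0" by (simp add: s_def)
  have diff: "?X \<sigma> - ?Y \<sigma> = s * ?W \<sigma>" for \<sigma>
    using s by (simp add: contrast_def s_def[symmetric])
  have total: "real m * ?X \<sigma> + real n * ?Y \<sigma> = real (m + n) * \<gamma>" if "\<sigma> permutes {..<m + n}" for \<sigma>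
  proof -
    have "(\<Sum>i<m. g (\<sigma> i)) + (\<Sum>j<n. g (\<sigma> (m + j))) = (\<Sum>a<m + n. g (\<sigma> a))"
      by (induction n) simp_all
    also have "\<dots> = (\<Sum>a<m + n. g a)"
      using sum.permute[OF that, of g] by (simp add: o_def)
    finally show ?thesis using mn by (simp add: \<gamma>_def)
  qed
  have bounds: "\<bar>?X \<sigma> - \<gamma>\<bar> \<le> s * (1 / 2 + 1 / 2 * (?W \<sigma>)\<^sup>2) \<and> \<bar>?Y \<sigma> - \<gamma>\<bar> \<le> s * (1 / 2 + 1 / 2 * (?W \<sigma>)\<^sup>2)"
    if \<sigma>: "\<sigma> permutes {..<m + n}" for \<sigma>
  proof -
    have alg: "x - \<gamma> = real n / real (m + n) * (x - y)" "y - \<gamma> = - (real m / real (m + n)) * (x - y)"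
      if "real m * x + real n * y = real (m + n) * \<gamma>" for x y
    proof -
      have "\<gamma> = (real m * x + real n * y) / real (m + n)" using that mn by (simp add: field_simps)
      then show "x - \<gamma> = real n / real (m + n) * (x - y)" "y - \<gamma> = - (real m / real (m + n)) * (x - y)"
        using mn by (simp_all add: field_simps)
    qed
    have X: "?X \<sigma> - \<gamma> = real n / real (m + n) * (s * ?W \<sigma>)"
      unfolding diff[symmetric] by (rule alg[OF total[OF \<sigma>]])
    have Y: "?Y \<sigma> - \<gamma> = - (real m / real (m + n)) * (s * ?W \<sigma>)"
      unfolding diff[symmetric] by (rule alg[OF total[OF \<sigma>]])
    have "0 \<le> (\<bar>?W \<sigma>\<bar> - 1)\<^sup>2" by simp
    then have "\<bar>?W \<sigma>\<bar> \<le> 1 / 2 + 1 / 2 * (?W \<sigma>)\<^sup>2"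
      by (simp add: power2_diff)
    then have le: "\<bar>s * ?W \<sigma>\<bar> \<le> s * (1 / 2 + 1 / 2 * (?W \<sigma>)\<^sup>2)"
      using s by (simp add: abs_mult)
    have "\<bar>?X \<sigma> - \<gamma>\<bar> \<le> 1 * \<bar>s * ?W \<sigma>\<bar>" "\<bar>?Y \<sigma> - \<gamma>\<bar> \<le> 1 * \<bar>s * ?W \<sigma>\<bar>"
      unfolding X Y abs_mult abs_minus_cancel using mn by (intro mult_right_mono; simp)+
    with le show ?thesis by linarith
  qed
  have fin: "perm_avg (m + n) (\<lambda>\<sigma>. s * (1 / 2 + 1 / 2 * (?W \<sigma>)\<^sup>2)) \<le> s * (1 / 2 + G\<^sup>2)"
  proof -
    have "perm_avg (m + n) (\<lambda>\<sigma>. (?W \<sigma>)\<^sup>2) \<le> 2 * G\<^sup>2"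
      by (rule contrast_second_moment_le[OF mn bnd])
    moreover have "perm_avg (m + n) (\<lambda>\<sigma>. s * (1 / 2 + 1 / 2 * (?W \<sigma>)\<^sup>2)) =
      s * (1 / 2 + 1 / 2 * perm_avg (m + n) (\<lambda>\<sigma>. (?W \<sigma>)\<^sup>2))"
      by (simp only: perm_avg_cmult perm_avg_add perm_avg_const)
    ultimately show ?thesis using s by simp
  qed
  show "perm_avg (m + n) (\<lambda>\<sigma>. \<bar>?X \<sigma> - \<gamma>\<bar>) \<le> s * (1 / 2 + G\<^sup>2)"
    by (rule order_trans[OF perm_avg_mono fin]) (use bounds in blast)
  show "perm_avg (m + n) (\<lambda>\<sigma>. \<bar>?Y \<sigma> - \<gamma>\<bar>) \<le> s * (1 / 2 + G\<^sup>2)"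
    by (rule order_trans[OF perm_avg_mono fin]) (use bounds in blast)
qed

section \<open>Stein's method for the characteristic function of a contrast\<close>

lemma sin_linear_error: "\<bar>sin b - sin a - (b - a) * cos a\<bar> \<le> (b - a)\<^sup>2 / 2" for a b :: real
proof -
  define d :: "nat \<Rightarrow> real \<Rightarrow> real"
    where "d k = (if k = 0 then sin else if k = 1 then cos else (\<lambda>x. - sin x))" for k
  have "\<exists>t. sin b = (\<Sum>k<2. (d k a / fact k) * (b - a) ^ k) + (d 2 t / fact 2) * (b - a) ^ 2"
  proof (cases "a = b")
    case True
    then show ?thesis by (simp add: numeral_2_eq_2 d_def)
  next
    case False
    have "\<exists>t. (if b < a then b < t \<and> t < a else a < t \<and> t < b) \<and>
      sin b = (\<Sum>k<2. (d k a / fact k) * (b - a) ^ k) + (d 2 t / fact 2) * (b - a) ^ 2"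
      using False by (intro Taylor[where a = "min a b" and b = "max a b"])
        (auto simp: d_def less_2_cases_iff intro!: derivative_eq_intros)
    then show ?thesis by blast
  qed
  then obtain t where "sin b = (\<Sum>k<2. (d k a / fact k) * (b - a) ^ k) + (d 2 t / fact 2) * (b - a) ^ 2"
    by blast
  then have "sin b - sin a - (b - a) * cos a = - sin t * ((b - a)\<^sup>2 / 2)"
    by (simp add: numeral_2_eq_2 d_def)
  moreover have "\<bar>- sin t * ((b - a)\<^sup>2 / 2)\<bar> \<le> 1 * ((b - a)\<^sup>2 / 2)"
    unfolding abs_mult by (intro mult_mono) auto
  ultimately show ?thesis by simp
qed

text \<open>Stein's identity with the function \<open>sin (t * w)\<close> shows that
  \<open>\<psi> t\<close>, the mean of \<open>cos (t * W)\<close>, satisfies the Gaussian equation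
  \<open>\<psi>' = - t * v * \<psi>\<close> up to a small error. Of the constant,
  \<open>2 * G ^ 3\<close> is the Taylor remainder of the sine; the rest is the fluctuation of the
  empirical quantity \<open>V\<close> around \<open>v\<close>.\<close>

lemma contrast_char_fun:
  fixes g :: "nat \<Rightarrow> real"
  assumes mn: "0 < m" "0 < n" and bnd: "\<And>a. a < m + n \<Longrightarrow> \<bar>g a\<bar> \<le> G" and G: "0 \<le> G"
  defines "v \<equiv> (\<Sum>a<m + n. (g a)\<^sup>2) / real (m + n) - ((\<Sum>a<m + n. g a) / real (m + n))\<^sup>2"
    and "s \<equiv> sqrt (1 / real m + 1 / real n)"
  shows "\<bar>perm_avg (m + n) (\<lambda>\<sigma>. cos (contrast m n g \<sigma>)) - exp (- v / 2)\<bar> \<le> s * (1 / 2 + G + 4 * G ^ 3 + G ^ 4)"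
proof -
  let ?E = "perm_avg (m + n)" and ?W = "contrast m n g"
  let ?X = "\<lambda>g \<sigma>. (\<Sum>i<m. g (\<sigma> i)) / real m" and ?Y = "\<lambda>g \<sigma>. (\<Sum>j<n. g (\<sigma> (m + j))) / real n"
  define \<gamma> where "\<gamma> = (\<Sum>a<m + n. g a) / real (m + n)"
  define \<gamma>2 where "\<gamma>2 = (\<Sum>a<m + n. (g a)\<^sup>2) / real (m + n)"
  define \<delta> where "\<delta> = s * (1 / 2 + G + 4 * G ^ 3 + G ^ 4)"
  have pos: "1 / real m + 1 / real n > 0" using mn by (intro add_pos_pos) auto
  then have s: "s > 0" by (simp add: s_def)
  have g2: "\<bar>(g a)\<^sup>2\<bar> \<le> G\<^sup>2" if "a < m + n" for a
    using bnd[OF that] G by (simp flip: abs_le_square_iff)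
  have \<sigma>lt: "\<sigma> a < m + n" if "\<sigma> permutes {..<m + n}" "a < m + n" for \<sigma> a
    using permutes_in_image[OF that(1), of a] that(2) by simp
  have avgle: "\<bar>(\<Sum>i<k. h i) / real k\<bar> \<le> B" if "0 < k" "\<And>i. i < k \<Longrightarrow> \<bar>h i\<bar> \<le> B" for k h and B :: real
  proof -
    have "\<bar>\<Sum>i<k. h i\<bar> \<le> (\<Sum>i<k. B)" using that(2) by (intro order_trans[OF sum_abs] sum_mono) auto
    then show ?thesis using that(1) by (simp add: field_simps)
  qed
  \<comment> \<open>The coefficient that linearisation of the sine produces in Stein's identity:
    half the mean squared difference between the two samples.\<close>
  define V where "V \<sigma> = (\<Sum>i<m. \<Sum>j<n. (g (\<sigma> (m + j)) - g (\<sigma> i))\<^sup>2) / (2 * real m * real n)" for \<sigma>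
  have V_eq: "V \<sigma> = (?X (\<lambda>a. (g a)\<^sup>2) \<sigma> + ?Y (\<lambda>a. (g a)\<^sup>2) \<sigma>) / 2 - ?X g \<sigma> * ?Y g \<sigma>" for \<sigma>
  proof -
    have "(\<Sum>i<m. \<Sum>j<n. (g (\<sigma> (m + j)) - g (\<sigma> i))\<^sup>2) =
      real m * (\<Sum>j<n. (g (\<sigma> (m + j)))\<^sup>2) + real n * (\<Sum>i<m. (g (\<sigma> i))\<^sup>2)
       - 2 * ((\<Sum>i<m. g (\<sigma> i)) * (\<Sum>j<n. g (\<sigma> (m + j))))"
    proof -
      have "(\<Sum>i<m. \<Sum>j<n. 2 * g (\<sigma> (m + j)) * g (\<sigma> i)) = 2 * ((\<Sum>i<m. g (\<sigma> i)) * (\<Sum>j<n. g (\<sigma> (m + j))))"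
        unfolding sum_product by (simp add: sum_distrib_left mult_ac)
      then show ?thesis
        by (simp add: power2_diff sum.distrib sum_subtractf sum_distrib_left[symmetric])
    qed
    then show ?thesis unfolding V_def using mn by (simp only:) (simp add: field_simps)
  qed
  have V_dev: "?E (\<lambda>\<sigma>. \<bar>V \<sigma> - v\<bar>) \<le> s * (1 / 2 + G ^ 4) + 2 * G * (s * (1 / 2 + G\<^sup>2))"
  proof -
    let ?g2 = "\<lambda>a. (g a)\<^sup>2"
    let ?a = "\<lambda>\<sigma>. \<bar>?X ?g2 \<sigma> - \<gamma>2\<bar>" and ?b = "\<lambda>\<sigma>. \<bar>?Y ?g2 \<sigma> - \<gamma>2\<bar>"
      and ?c = "\<lambda>\<sigma>. \<bar>?X g \<sigma> - \<gamma>\<bar>" and ?d = "\<lambda>\<sigma>. \<bar>?Y g \<sigma> - \<gamma>\<bar>"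
    let ?r = "\<lambda>B. s * (1 / 2 + B\<^sup>2)"
    \<comment> \<open>Telescoping \<open>x * y - \<gamma>\<^sup>2\<close> leaves deviations of
      single sample means, with factors \<open>y\<close> and \<open>\<gamma>\<close> that are
      bounded by \<open>G\<close>.\<close>
    have alg: "(a + b) / 2 - x * y - (\<gamma>2 - \<gamma>\<^sup>2) =
        1/2 * (a - \<gamma>2) + 1/2 * (b - \<gamma>2) - (y * (x - \<gamma>) + \<gamma> * (y - \<gamma>))" for a b x y :: real
      by (simp add: field_simps power2_eq_square)
    have pt: "\<bar>V \<sigma> - v\<bar> \<le> 1/2 * ?a \<sigma> + 1/2 * ?b \<sigma>
       + (G * ?c \<sigma> + G * ?d \<sigma>)" if \<sigma>: "\<sigma> permutes {..<m + n}" for \<sigma>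
    proof -
      have "V \<sigma> - v = 1/2 * (?X ?g2 \<sigma> - \<gamma>2) + 1/2 * (?Y ?g2 \<sigma> - \<gamma>2)
         - (?Y g \<sigma> * (?X g \<sigma> - \<gamma>) + \<gamma> * (?Y g \<sigma> - \<gamma>))"
        unfolding V_eq v_def \<gamma>_def[symmetric] \<gamma>2_def[symmetric] by (rule alg)
      moreover have "\<bar>?Y g \<sigma> * (?X g \<sigma> - \<gamma>)\<bar> \<le> G * ?c \<sigma>"
        unfolding abs_mult using mn by (intro mult_right_mono avgle bnd \<sigma>lt[OF \<sigma>]) auto
      moreover have "\<bar>\<gamma> * (?Y g \<sigma> - \<gamma>)\<bar> \<le> G * ?d \<sigma>"
        unfolding abs_mult \<gamma>_def using mn by (intro mult_right_mono avgle bnd) auto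
      moreover have "\<bar>D\<bar> \<le> 1/2 * \<bar>a\<bar> + 1/2 * \<bar>b\<bar> + (P + Q)"
        if "D = 1/2 * a + 1/2 * b - (p + q)" "\<bar>p\<bar> \<le> P" "\<bar>q\<bar> \<le> Q" for D a b p q P Q :: real
        using that by linarith
      ultimately show ?thesis by blast
    qed
    have "?E (\<lambda>\<sigma>. \<bar>V \<sigma> - v\<bar>) \<le> ?E (\<lambda>\<sigma>. 1/2 * ?a \<sigma> + 1/2 * ?b \<sigma>
       + (G * ?c \<sigma> + G * ?d \<sigma>))"
      by (rule perm_avg_mono[OF pt])
    also have "\<dots> = 1/2 * ?E ?a + 1/2 * ?E ?b
       + (G * ?E ?c + G * ?E ?d)"
      by (simp only: perm_avg_add perm_avg_cmult)
    also have "\<dots> \<le> 1/2 * ?r (G\<^sup>2) + 1/2 * ?r (G\<^sup>2)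
       + (G * ?r G + G * ?r G)"
      unfolding \<gamma>_def \<gamma>2_def s_def
      by (intro add_mono mult_left_mono sample_mean_deviation[OF mn bnd] sample_mean_deviation[OF mn g2] G) auto
    finally show ?thesis by (simp flip: power_mult)
  qed
  define \<psi> where "\<psi> t = ?E (\<lambda>\<sigma>. cos (t * ?W \<sigma>))" for t
  define \<psi>' where "\<psi>' t = - ?E (\<lambda>\<sigma>. ?W \<sigma> * sin (t * ?W \<sigma>))" for t
  have deriv: "(\<psi> has_real_derivative \<psi>' t) (at t)" for t
    unfolding \<psi>_def \<psi>'_def perm_avg_def
    by (auto intro!: derivative_eq_intros simp: sum_negf mult_ac)
  have ode: "\<bar>\<psi>' t + t * v * \<psi> t\<bar> \<le> \<delta>" if t: "0 \<le> t" "t \<le> 1" for t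
  proof -
    define D where "D i j \<sigma> = g (\<sigma> (m + j)) - g (\<sigma> i)" for i j \<sigma>
    let ?F = "\<lambda>i j \<sigma>. s * D i j \<sigma> * (sin (t * (?W \<sigma> + s * D i j \<sigma>)) - sin (t * ?W \<sigma>))"
    let ?H = "\<lambda>i j \<sigma>. s\<^sup>2 * t * ((D i j \<sigma>)\<^sup>2 * cos (t * ?W \<sigma>))"
    let ?C = "?E (\<lambda>\<sigma>. V \<sigma> * cos (t * ?W \<sigma>))" and ?k = "2 * s\<^sup>2 * real m * real n"
    let ?B = "s\<^sup>2 * (4 * G ^ 3 * s)" and ?r = "s * (1 / 2 + G ^ 4) + 2 * G * (s * (1 / 2 + G\<^sup>2))"
    have stein: "\<psi>' t = - (\<Sum>i<m. \<Sum>j<n. ?E (?F i j)) / (?k)"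
      unfolding \<psi>'_def D_def s_def using contrast_stein_identity[OF mn, of g "\<lambda>w. sin (t * w)"] by simp
    \<comment> \<open>The jump is at most \<open>2 * G * s\<close>; the remainder is the jump times
      half its square, hence \<open>4 * G ^ 3 * s ^ 3\<close>.\<close>
    have pt: "\<bar>?F i j \<sigma> - ?H i j \<sigma>\<bar> \<le> ?B"
      if \<sigma>: "\<sigma> permutes {..<m + n}" and ij: "i < m" "j < n" for i j \<sigma>
    proof -
      have "\<bar>g (\<sigma> (m + j))\<bar> \<le> G" "\<bar>g (\<sigma> i)\<bar> \<le> G"
        by (rule bnd[OF \<sigma>lt[OF \<sigma>]], use ij in simp)+
      then have D: "\<bar>D i j \<sigma>\<bar> \<le> 2 * G" unfolding D_def by linarith
      let ?a = "t * ?W \<sigma>" and ?b = "t * (?W \<sigma> + s * D i j \<sigma>)"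
      have ba: "?b - ?a = t * s * D i j \<sigma>" by (simp add: algebra_simps)
      have "s * D i j \<sigma> * (sin ?b - sin ?a) - s\<^sup>2 * t * ((D i j \<sigma>)\<^sup>2 * cos ?a) =
        s * D i j \<sigma> * (sin ?b - sin ?a - (?b - ?a) * cos ?a)"
        unfolding ba by (simp add: right_diff_distrib power2_eq_square mult_ac)
      then have "\<bar>s * D i j \<sigma> * (sin ?b - sin ?a) - s\<^sup>2 * t * ((D i j \<sigma>)\<^sup>2 * cos ?a)\<bar> =
        \<bar>s * D i j \<sigma>\<bar> * \<bar>sin ?b - sin ?a - (?b - ?a) * cos ?a\<bar>"
        by (simp only: abs_mult)
      also have "\<dots> \<le> (s * (2 * G)) * ((?b - ?a)\<^sup>2 / 2)"
      proof (rule mult_mono[OF _ sin_linear_error])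
        show "\<bar>s * D i j \<sigma>\<bar> \<le> s * (2 * G)" unfolding abs_mult using s D by simp
      qed (use s G in simp_all)
      also have "\<dots> \<le> (s * (2 * G)) * ((s * (2 * G))\<^sup>2 / 2)"
      proof -
        have "\<bar>?b - ?a\<bar> \<le> 1 * s * (2 * G)"
          unfolding ba abs_mult using s D G t by (intro mult_mono) auto
        then have "(?b - ?a)\<^sup>2 \<le> (s * (2 * G))\<^sup>2"
          using s G by (simp flip: abs_le_square_iff)
        then show ?thesis using s G by (intro mult_left_mono) auto
      qed
      also have "\<dots> = ?B" by (simp add: power2_eq_square power3_eq_cube)
      finally show ?thesis .
    qed
    let ?S = "\<Sum>i<m. \<Sum>j<n. ?E (?F i j)"
    let ?T = "\<Sum>i<m. \<Sum>j<n. ?E (?H i j)"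
    have "\<bar>?S - ?T\<bar> \<le> (\<Sum>i<m. \<Sum>j<n. ?B)"
      unfolding sum_subtractf[symmetric] perm_avg_diff[symmetric]
    proof (intro order_trans[OF sum_abs] sum_mono)
      fix i j assume "i \<in> {..<m}" "j \<in> {..<n}"
      then have "?E (\<lambda>\<sigma>. \<bar>?F i j \<sigma> - ?H i j \<sigma>\<bar>) \<le> ?E (\<lambda>_. ?B)"
        using pt by (intro perm_avg_mono) auto
      then show "\<bar>?E (\<lambda>\<sigma>. ?F i j \<sigma> - ?H i j \<sigma>)\<bar> \<le> ?B"
        by (intro order_trans[OF perm_avg_abs]) (simp only: perm_avg_const)
    qed
    then have "\<bar>?S - ?T\<bar> \<le> (?k) * (2 * G ^ 3 * s)" by (simp add: mult_ac)
    then have 1: "\<bar>(?S - ?T) / (?k)\<bar> \<le> 2 * G ^ 3 * s"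
      using s mn by (simp add: abs_mult field_simps)
    have "?T = (?k) * (t * ?C)"
    proof -
      have "?T = s\<^sup>2 * t * ?E (\<lambda>\<sigma>. (\<Sum>i<m. \<Sum>j<n. (D i j \<sigma>)\<^sup>2) * cos (t * ?W \<sigma>))"
        by (simp only: perm_avg_cmult sum_distrib_left[symmetric] sum_distrib_right perm_avg_sum)
      also have "?E (\<lambda>\<sigma>. (\<Sum>i<m. \<Sum>j<n. (D i j \<sigma>)\<^sup>2) * cos (t * ?W \<sigma>)) =
         ?E (\<lambda>\<sigma>. (2 * real m * real n) * (V \<sigma> * cos (t * ?W \<sigma>)))"
        unfolding V_def D_def using mn by simp
      finally show ?thesis by (simp only: perm_avg_cmult) (simp only: mult_ac)
    qed
    then have T: "?T / (?k) = t * ?C"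
      using s mn by simp
    have "\<bar>?C - v * \<psi> t\<bar> = \<bar>?E (\<lambda>\<sigma>. (V \<sigma> - v) * cos (t * ?W \<sigma>))\<bar>"
      by (simp add: \<psi>_def left_diff_distrib perm_avg_diff perm_avg_cmult)
    also have "\<dots> \<le> ?E (\<lambda>\<sigma>. \<bar>(V \<sigma> - v) * cos (t * ?W \<sigma>)\<bar>)" by (rule perm_avg_abs)
    also have "\<dots> \<le> ?E (\<lambda>\<sigma>. \<bar>V \<sigma> - v\<bar>)"
      by (intro perm_avg_mono) (simp add: abs_mult mult_left_le)
    also note V_dev
    finally have 2: "\<bar>?C - v * \<psi> t\<bar> \<le>
      ?r" .
    then have 3: "\<bar>t * (?C - v * \<psi> t)\<bar> \<le>
      1 * (?r)"
      unfolding abs_mult using t by (intro mult_mono) auto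
    have 4: "\<psi>' t + t * v * \<psi> t = - ((?S - ?T) / (?k))
       - t * (?C - v * \<psi> t)"
      unfolding stein diff_divide_distrib T by (simp add: algebra_simps)
    have "\<bar>\<psi>' t + t * v * \<psi> t\<bar> \<le> 2 * G ^ 3 * s + (?r)"
    proof -
      have "\<bar>c\<bar> \<le> P + Q" if "\<bar>b\<bar> \<le> 1 * Q" "c = - a - b" "\<bar>a\<bar> \<le> P" for a b c P Q :: real
        using that by linarith
      from this[OF 3 4 1] show ?thesis .
    qed
    also have "\<dots> = \<delta>" by (simp add: \<delta>_def algebra_simps power2_eq_square power3_eq_cube)
    finally show ?thesis .
  qed
  have v: "0 \<le> v"
  proof -
    have "0 \<le> (\<Sum>a<m + n. (g a - \<gamma>)\<^sup>2) / real (m + n)" by (intro divide_nonneg_nonneg sum_nonneg) auto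
    also have "(\<Sum>a<m + n. (g a - \<gamma>)\<^sup>2) = (\<Sum>a<m + n. (g a)\<^sup>2) - 2 * \<gamma> * (\<Sum>a<m + n. g a) + real (m + n) * \<gamma>\<^sup>2"
      by (simp add: power2_diff sum.distrib sum_subtractf sum_distrib_left mult_ac)
    also have "(\<Sum>a<m + n. g a) = real (m + n) * \<gamma>" using mn by (simp add: \<gamma>_def)
    also have "((\<Sum>a<m + n. (g a)\<^sup>2) - 2 * \<gamma> * (real (m + n) * \<gamma>) + real (m + n) * \<gamma>\<^sup>2) / real (m + n) = v"
      unfolding v_def \<gamma>_def[symmetric] using mn by (simp add: field_simps power2_eq_square)
    finally show ?thesis .
  qed
  \<comment> \<open>The integrating factor of the equation. Since \<open>v\<close> is nonnegative,
    the factor at the intermediate point is at most \<open>exp (v / 2)\<close>, which cancels in the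
    end, so the bound is free of \<open>v\<close>.\<close>
  let ?h = "\<lambda>t. exp (v * t\<^sup>2 / 2) * \<psi> t"
  have "\<exists>\<xi>. 0 < \<xi> \<and> \<xi> < 1 \<and> ?h 1 - ?h 0 = (1 - 0) * (exp (v * \<xi>\<^sup>2 / 2) * (\<psi>' \<xi> + \<xi> * v * \<psi> \<xi>))"
    by (rule MVT2) (auto intro!: derivative_eq_intros deriv simp: algebra_simps)
  then obtain \<xi> where \<xi>: "0 < \<xi>" "\<xi> < 1" "?h 1 - ?h 0 = exp (v * \<xi>\<^sup>2 / 2) * (\<psi>' \<xi> + \<xi> * v * \<psi> \<xi>)"
    by auto
  have "\<bar>?h 1 - ?h 0\<bar> \<le> exp (v / 2) * \<delta>"
    unfolding \<xi>(3) abs_mult using \<xi>(1,2) v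
    by (intro mult_mono ode) (auto simp: mult_left_le power_le_one)
  moreover have "?h 1 - ?h 0 = exp (v / 2) * (\<psi> 1 - exp (- v / 2))"
    by (simp add: \<psi>_def right_diff_distrib flip: exp_add)
  ultimately have "\<bar>\<psi> 1 - exp (- v / 2)\<bar> \<le> \<delta>" by (simp add: abs_mult)
  then show ?thesis by (simp add: \<psi>_def \<delta>_def)
qed

section \<open>Spectral decomposition of positive semidefinite matrices\<close>

text \<open>Vectors are functions of which only the first \<open>L\<close> coordinates count, so
  that all truncation levels share one type.\<close>

definition dotp :: "nat \<Rightarrow> (nat \<Rightarrow> real) \<Rightarrow> (nat \<Rightarrow> real) \<Rightarrow> real" where
  "dotp L u v = (\<Sum>l<L. u l * v l)"

definition mat_app :: "nat \<Rightarrow> (nat \<Rightarrow> nat \<Rightarrow> real) \<Rightarrow> (nat \<Rightarrow> real) \<Rightarrow> nat \<Rightarrow> real" where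
  "mat_app L A v l = (\<Sum>k<L. A l k * v k)"

definition psd_matrix :: "nat \<Rightarrow> (nat \<Rightarrow> nat \<Rightarrow> real) \<Rightarrow> bool" where
  "psd_matrix L A \<longleftrightarrow> (\<forall>l k. A l k = A k l) \<and> (\<forall>u. 0 \<le> dotp L u (mat_app L A u))"

lemma dotp_commute: "dotp L u v = dotp L v u"
  by (simp add: dotp_def mult.commute)

lemma dotp_nonneg: "0 \<le> dotp L u u"
  by (simp add: dotp_def sum_nonneg)

lemma dotp_add_scale_left: "dotp L (\<lambda>l. u l + t * w l) v = dotp L u v + t * dotp L w v"
  by (simp add: dotp_def sum.distrib distrib_right sum_distrib_left mult.assoc)

lemma dotp_add_scale_right: "dotp L v (\<lambda>l. u l + t * w l) = dotp L v u + t * dotp L v w"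
  by (simp add: dotp_def sum.distrib distrib_left sum_distrib_left mult.left_commute)

lemma mat_app_add_scale: "mat_app L A (\<lambda>l. u l + t * w l) = (\<lambda>l. mat_app L A u l + t * mat_app L A w l)"
  by (simp add: mat_app_def fun_eq_iff sum.distrib distrib_left sum_distrib_left mult.left_commute)

lemma mat_app_self_adjoint:
  assumes "psd_matrix L A" shows "dotp L u (mat_app L A v) = dotp L v (mat_app L A u)"
proof -
  have sym: "A l k = A k l" for l k using assms by (simp add: psd_matrix_def)
  have "dotp L u (mat_app L A v) = (\<Sum>l<L. \<Sum>k<L. v k * (A k l * u l))"
    unfolding dotp_def mat_app_def by (simp add: sum_distrib_left mult_ac sym)
  also have "\<dots> = dotp L v (mat_app L A u)"
    unfolding dotp_def mat_app_def by (subst sum.swap) (simp add: sum_distrib_left)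
  finally show ?thesis .
qed

text \<open>A maximiser of the form on the unit ball is an eigenvector, by the first variation in
  each coordinate direction. If the maximum is 0, the zero vector is returned; this convention
  spares completing the eigenvectors to a basis.\<close>

lemma psd_matrix_rayleigh:
  assumes A: "psd_matrix L A"
  obtains \<rho> v where "0 \<le> \<rho>" "\<And>u. dotp L u (mat_app L A u) \<le> \<rho> * dotp L u u"
    "\<And>l. l < L \<Longrightarrow> mat_app L A v l = \<rho> * v l" "dotp L v v = (if \<rho> = 0 then 0 else 1)"
proof -
  let ?q = "\<lambda>u. dotp L u (mat_app L A u)"
  \<comment> \<open>The box also bounds the coordinates from \<open>L\<close> on, which the form
    ignores; so the ball becomes a compact subset of the product space.\<close>
  define B where "B = (PiE UNIV (\<lambda>_. {-1..1::real})) \<inter> {u. dotp L u u \<le> 1}"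
  have "compactin (product_topology (\<lambda>_. euclidean) UNIV) (PiE UNIV (\<lambda>_::nat. {-1..1::real}))"
    by (subst compactin_PiE) auto
  then have "compact (PiE UNIV (\<lambda>_::nat. {-1..1::real}))"
    by (simp add: euclidean_product_topology)
  moreover have cont_dot: "continuous_on UNIV (\<lambda>u. dotp L u u)"
    unfolding dotp_def by (intro continuous_intros continuous_on_product_coordinates)
  then have "closed {u. dotp L u u \<le> 1}"
    by (intro closed_Collect_le continuous_intros)
  ultimately have "compact B" unfolding B_def by (rule compact_Int_closed)
  moreover have zero: "(\<lambda>_. 0) \<in> B" by (auto simp: B_def dotp_def)
  moreover have "continuous_on UNIV ?q"
    unfolding dotp_def mat_app_def by (intro continuous_intros continuous_on_product_coordinates)
  then have "continuous_on B ?q" by (rule continuous_on_subset) simp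
  ultimately obtain v where v: "v \<in> B" "\<And>u. u \<in> B \<Longrightarrow> ?q u \<le> ?q v"
    using continuous_attains_sup[of B ?q] by blast
  define \<rho> where "\<rho> = ?q v"
  have \<rho>0: "0 \<le> \<rho>" using v(2)[OF zero] by (simp add: \<rho>_def dotp_def)
  have max: "?q u \<le> \<rho> * dotp L u u" for u
  proof (cases "dotp L u u = 0")
    case True
    then have "u l * u l = 0" if "l < L" for l
      unfolding dotp_def using that by (subst (asm) sum_nonneg_eq_0_iff) auto
    then have "?q u = 0" by (simp add: dotp_def)
    then show ?thesis using True by simp
  next
    case False
    then have pos: "dotp L u u > 0" using dotp_nonneg[of L u] by simp
    define c where "c = 1 / sqrt (dotp L u u)"
    \<comment> \<open>Besides normalising, the coordinates from \<open>L\<close> on are set to zero,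
      so that \<open>w\<close> lies in the box.\<close>
    define w where "w l = (if l < L then c * u l else 0)" for l
    have c2: "c\<^sup>2 * dotp L u u = 1" using pos by (simp add: c_def power_divide)
    have ww: "dotp L w w = c\<^sup>2 * dotp L u u"
      by (simp add: dotp_def w_def sum_distrib_left power2_eq_square mult_ac)
    have "\<bar>w l\<bar> \<le> 1" for l
    proof (cases "l < L")
      case True
      have "(w l)\<^sup>2 \<le> dotp L w w"
        unfolding dotp_def power2_eq_square using True by (intro member_le_sum) auto
      then have "(w l)\<^sup>2 \<le> 1" using ww c2 by simp
      then show ?thesis by (simp add: abs_square_le_1)
    qed (simp add: w_def)
    then have "w \<in> B" unfolding B_def using ww c2 by (auto simp: abs_le_iff minus_le_iff)
    then have "?q w \<le> \<rho>" using v(2) by (simp add: \<rho>_def)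
    also have "?q w = c\<^sup>2 * ?q u"
      by (simp add: dotp_def mat_app_def w_def sum_distrib_left power2_eq_square mult_ac)
    finally have "c\<^sup>2 * ?q u * dotp L u u \<le> \<rho> * dotp L u u" using pos by simp
    moreover have "c\<^sup>2 * ?q u * dotp L u u = ?q u" 
    proof -
      have "c\<^sup>2 * ?q u * dotp L u u = (c\<^sup>2 * dotp L u u) * ?q u" by (simp only: mult_ac)
      then show ?thesis using c2 by simp
    qed
    ultimately show ?thesis by simp
  qed
  show ?thesis
  proof (cases "\<rho> = 0")
    case True
    show ?thesis
      by (rule that[of 0 "\<lambda>_. 0"]) (use max True in \<open>auto simp: dotp_def mat_app_def\<close>)
  next
    case False
    have "\<rho> * 1 \<le> \<rho> * dotp L v v" using max[of v] by (simp add: \<rho>_def)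
    then have "1 \<le> dotp L v v" using False \<rho>0 by simp
    then have vv: "dotp L v v = 1" using v(1) by (simp add: B_def)
    have eig: "mat_app L A v l = \<rho> * v l" if l: "l < L" for l
    proof -
      define w where "w k = (if k = l then 1 else 0 :: real)" for k
      define b where "b = \<rho> * v l - mat_app L A v l"
      define c where "c = \<rho> * dotp L w w - ?q w"
      have c: "c \<ge> 0" using max[of w] by (simp add: c_def)
      have wx: "dotp L w x = x l" for x unfolding dotp_def w_def using l by (subst sum.remove[of _ l]) auto
      have quad: "0 \<le> 2 * t * b + t * t * c" for t
      proof -
        let ?u = "\<lambda>k. v k + t * w k"
        have "dotp L ?u ?u = 1 + 2 * t * v l + t * t * dotp L w w"
          by (simp add: dotp_add_scale_left dotp_add_scale_right vv wx dotp_commute[of L v w] algebra_simps)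
        moreover have "?q ?u = \<rho> + 2 * t * mat_app L A v l + t * t * ?q w"
          by (simp add: dotp_add_scale_left dotp_add_scale_right mat_app_add_scale \<rho>_def[symmetric]
              mat_app_self_adjoint[OF A, of v w] wx algebra_simps)
        ultimately show ?thesis using max[of ?u] by (simp add: b_def c_def algebra_simps)
      qed
      have "b = 0"
      proof (rule ccontr)
        assume "b \<noteq> 0"
        \<comment> \<open>For this \<open>t\<close> the quadratic
          \<open>2 * t * b + t * t * c\<close> is negative; the shift by 1 covers
          \<open>c = 0\<close>.\<close>
        define t where "t = - b / (c + 1)"
        have "2 * t * b + t * t * c = t * (2 * b + t * c)" by (simp add: algebra_simps)
        also have "2 * b + t * c = b * (c + 2) / (c + 1)" using c by (simp add: t_def field_simps)
        also have "t * (b * (c + 2) / (c + 1)) = - (b * b) * ((c + 2) / (c + 1) / (c + 1))"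
          by (simp add: t_def)
        also have "\<dots> < 0" using \<open>b \<noteq> 0\<close> c
          by (intro mult_neg_pos) (auto simp: zero_less_mult_iff)
        finally show False using quad[of t] by simp
      qed
      then show ?thesis by (simp add: b_def)
    qed
    show ?thesis by (rule that[OF \<rho>0 max eig]) (use vv False in auto)
  qed
qed

text \<open>Bessel's inequality for a coordinate vector: its distance to the combination
  \<open>?p\<close> of the \<open>v j\<close> has nonnegative square. Norms at most one suffice,
  which admits the zero vectors that accompany zero eigenvalues.\<close>

lemma bessel_coordinates:
  fixes r :: nat
  assumes orth: "\<And>i j. i < r \<Longrightarrow> j < r \<Longrightarrow> i \<noteq> j \<Longrightarrow> dotp L (v i) (v j) = 0"
    and unit: "\<And>j. j < r \<Longrightarrow> dotp L (v j) (v j) \<le> 1" and l: "l < L"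
  shows "(\<Sum>j<r. (v j l)\<^sup>2) \<le> 1"
proof -
  let ?e = "\<lambda>k. if k = l then 1 else 0 :: real"
  let ?p = "\<lambda>k. \<Sum>j<r. v j l * v j k"
  have pp: "(\<Sum>k<L. ?p k * ?p k) \<le> (\<Sum>j<r. (v j l)\<^sup>2)"
  proof -
    have "(\<Sum>k<L. ?p k * ?p k) = (\<Sum>k<L. \<Sum>i<r. \<Sum>j<r. (v i l * v j l) * (v i k * v j k))"
      by (simp add: sum_product mult_ac)
    also have "\<dots> = (\<Sum>i<r. \<Sum>j<r. \<Sum>k<L. (v i l * v j l) * (v i k * v j k))"
      by (subst sum.swap, rule sum.cong[OF refl], rule sum.swap)
    also have "\<dots> = (\<Sum>i<r. \<Sum>j<r. (v i l * v j l) * dotp L (v i) (v j))"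
      by (simp add: dotp_def sum_distrib_left)
    also have "\<dots> = (\<Sum>i<r. \<Sum>j<r. if j = i then (v i l)\<^sup>2 * dotp L (v i) (v i) else 0)"
      by (intro sum.cong refl) (auto simp: orth power2_eq_square)
    also have "\<dots> = (\<Sum>i<r. (v i l)\<^sup>2 * dotp L (v i) (v i))" by simp
    also have "\<dots> \<le> (\<Sum>i<r. (v i l)\<^sup>2)"
      using unit by (intro sum_mono mult_left_le) auto
    finally show ?thesis .
  qed
  have "0 \<le> (\<Sum>k<L. (?e k - ?p k)\<^sup>2)" by (intro sum_nonneg) simp
  also have "\<dots> = (\<Sum>k<L. ?e k * ?e k) + (\<Sum>k<L. ?p k * ?p k) - 2 * (\<Sum>k<L. ?e k * ?p k)"
  proof -
    have sq: "(a - b)\<^sup>2 = a * a + b * b - 2 * (a * b)" for a b :: real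
      by (simp add: power2_eq_square algebra_simps)
    show ?thesis
      by (simp only: sq sum.distrib sum_subtractf sum_distrib_left[symmetric])
  qed
  also have "(\<Sum>k<L. ?e k * ?e k) = 1" using l by (simp add: if_distrib cong: if_cong)
  also have "(\<Sum>k<L. ?e k * ?p k) = (\<Sum>j<r. (v j l)\<^sup>2)"
  proof -
    have "(\<Sum>k<L. ?e k * ?p k) = (\<Sum>k<L. if k = l then ?p k else 0)" by (intro sum.cong refl) simp
    then show ?thesis using l by (simp add: power2_eq_square)
  qed
  finally show ?thesis using pp by simp
qed

text \<open>The invariant after splitting off \<open>r\<close> rank-one terms. The bound on the form
  of \<open>A'\<close> keeps later eigenvalues below earlier ones, and the kernel condition makes
  later eigenvectors orthogonal to earlier ones.\<close>

definition deflated ::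
  "nat \<Rightarrow> (nat \<Rightarrow> nat \<Rightarrow> real) \<Rightarrow> nat \<Rightarrow> (nat \<Rightarrow> real) \<Rightarrow> (nat \<Rightarrow> nat \<Rightarrow> real) \<Rightarrow> (nat \<Rightarrow> nat \<Rightarrow> real) \<Rightarrow> bool" where
  "deflated L A r \<tau> v A' \<longleftrightarrow> psd_matrix L A' \<and> (\<forall>l k. A l k = A' l k + (\<Sum>j<r. \<tau> j * v j l * v j k)) \<and>
    (\<forall>j<r. 0 \<le> \<tau> j) \<and> (\<forall>i<r. \<forall>j<r. i \<le> j \<longrightarrow> \<tau> j \<le> \<tau> i) \<and>
    (\<forall>j<r. \<forall>u. dotp L u (mat_app L A' u) \<le> \<tau> j * dotp L u u) \<and>
    (\<forall>j<r. \<forall>l<L. mat_app L A' (v j) l = 0) \<and>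
    (\<forall>i<r. \<forall>j<r. i \<noteq> j \<longrightarrow> dotp L (v i) (v j) = 0) \<and>
    (\<forall>j<r. dotp L (v j) (v j) = (if \<tau> j = 0 then 0 else 1))"

lemma deflatedD:
  assumes "deflated L A r \<tau> v A'"
  shows "psd_matrix L A'" "\<And>l k. A l k = A' l k + (\<Sum>j<r. \<tau> j * v j l * v j k)"
    "\<And>j. j < r \<Longrightarrow> 0 \<le> \<tau> j" "\<And>i j. i < r \<Longrightarrow> j < r \<Longrightarrow> i \<le> j \<Longrightarrow> \<tau> j \<le> \<tau> i"
    "\<And>j u. j < r \<Longrightarrow> dotp L u (mat_app L A' u) \<le> \<tau> j * dotp L u u"
    "\<And>j l. j < r \<Longrightarrow> l < L \<Longrightarrow> mat_app L A' (v j) l = 0"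
    "\<And>i j. i < r \<Longrightarrow> j < r \<Longrightarrow> i \<noteq> j \<Longrightarrow> dotp L (v i) (v j) = 0"
    "\<And>j. j < r \<Longrightarrow> dotp L (v j) (v j) = (if \<tau> j = 0 then 0 else 1)"
  using assms by (simp_all add: deflated_def)

lemma psd_matrix_deflation:
  assumes A: "psd_matrix L A"
  shows "\<exists>\<tau> v A'. deflated L A r \<tau> v A'"
proof (induction r)
  case 0
  then show ?case using A
    by (intro exI[of _ "\<lambda>_. 0"] exI[of _ "\<lambda>_ _. 0"] exI[of _ A]) (simp add: deflated_def)
next
  case (Suc r)
  then obtain \<tau> v A' where "deflated L A r \<tau> v A'" by blast
  note A' = deflatedD(1)[OF this] and dec = deflatedD(2)[OF this] and \<tau>0 = deflatedD(3)[OF this]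
    and mono = deflatedD(4)[OF this] and bound = deflatedD(5)[OF this] and ker = deflatedD(6)[OF this]
    and orth = deflatedD(7)[OF this] and unit = deflatedD(8)[OF this]
  obtain \<rho> w where \<rho>: "0 \<le> \<rho>" and max: "\<And>u. dotp L u (mat_app L A' u) \<le> \<rho> * dotp L u u"
    and eig: "\<And>l. l < L \<Longrightarrow> mat_app L A' w l = \<rho> * w l"
    and ww: "dotp L w w = (if \<rho> = 0 then 0 else 1)"
    using psd_matrix_rayleigh[OF A'] by blast
  define A'' where "A'' l k = A' l k - \<rho> * w l * w k" for l k
  have dot_eig: "dotp L u (mat_app L A' w) = \<rho> * dotp L u w" for u
    by (simp add: dotp_def eig sum_distrib_left mult_ac)
  have app'': "mat_app L A'' u l = mat_app L A' u l - \<rho> * w l * dotp L w u" for u l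
    by (simp add: mat_app_def A''_def dotp_def left_diff_distrib right_diff_distrib sum_subtractf sum_distrib_left mult_ac)
  have q'': "dotp L u (mat_app L A'' u) = dotp L u (mat_app L A' u) - \<rho> * (dotp L u w)\<^sup>2" for u
  proof -
    have "dotp L u (mat_app L A'' u) = dotp L u (\<lambda>l. mat_app L A' u l + (- \<rho> * dotp L w u) * w l)"
      by (simp add: dotp_def app'' algebra_simps)
    then show ?thesis
      by (simp only: dotp_add_scale_right) (simp add: dotp_commute[of L w u] power2_eq_square)
  qed
  have q''_le: "dotp L u (mat_app L A'' u) \<le> dotp L u (mat_app L A' u)" for u
    using \<rho> by (simp add: q'')
  have orth_w: "dotp L (v j) w = 0" if j: "j < r" for j
  proof (cases "\<rho> = 0")
    case True
    then have "dotp L w w = 0" using ww by simp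
    then have "w l * w l = 0" if "l < L" for l
      unfolding dotp_def using that by (subst (asm) sum_nonneg_eq_0_iff) auto
    then show ?thesis by (simp add: dotp_def)
  next
    case False
    have "\<rho> * dotp L (v j) w = dotp L w (mat_app L A' (v j))"
      unfolding dot_eig[symmetric] by (rule mat_app_self_adjoint[OF A'])
    also have "\<dots> = 0" using ker[OF j] by (simp add: dotp_def)
    finally show ?thesis using False by simp
  qed
  have "psd_matrix L A''"
    unfolding psd_matrix_def
  proof (intro conjI allI)
    fix l k show "A'' l k = A'' k l"
      using A' by (simp add: A''_def psd_matrix_def mult_ac)
  next
    fix u
    \<comment> \<open>Subtracting from \<open>u\<close> its component along \<open>w\<close> gives a
      vector at which the old form has the value of the new form at \<open>u\<close>.\<close>
    define c where "c = dotp L u w"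
    define u' where "u' l = u l + (- c) * w l" for l
    have "0 \<le> dotp L u' (mat_app L A' u')" using A' by (simp add: psd_matrix_def)
    also have "dotp L u' (mat_app L A' u') = dotp L u (mat_app L A' u) - 2 * c * (\<rho> * c) + c\<^sup>2 * (\<rho> * dotp L w w)"
      unfolding u'_def mat_app_add_scale dotp_add_scale_left dotp_add_scale_right
      using mat_app_self_adjoint[OF A', of w u]
      by (simp add: dot_eig c_def[symmetric] algebra_simps power2_eq_square)
    also have "\<rho> * dotp L w w = \<rho>" using ww by simp
    finally show "0 \<le> dotp L u (mat_app L A'' u)"
      by (simp add: q'' c_def[symmetric] algebra_simps power2_eq_square)
  qed
  moreover define \<tau>' where "\<tau>' = \<tau>(r := \<rho>)"
  moreover define v' where "v' = v(r := w)"
  moreover have "A l k = A'' l k + (\<Sum>j<Suc r. \<tau>' j * v' j l * v' j k)" for l k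
  proof -
    have "(\<Sum>j<r. \<tau>' j * v' j l * v' j k) = (\<Sum>j<r. \<tau> j * v j l * v j k)"
      by (intro sum.cong refl) (auto simp: \<tau>'_def v'_def)
    then show ?thesis by (simp add: dec A''_def \<tau>'_def v'_def)
  qed
  moreover have "\<rho> \<le> \<tau> j" if "j < r" for j
  proof (cases "\<rho> = 0")
    case True then show ?thesis using \<tau>0[OF that] by simp
  next
    case False
    then show ?thesis using bound[OF that, of w] ww by (simp add: dot_eig)
  qed
  moreover have "mat_app L A'' w l = 0" if "l < L" for l
    using eig[OF that] ww by (cases "\<rho> = 0") (simp_all add: app'')
  moreover have "mat_app L A'' (v j) l = 0" if "l < L" "j < r" for l j
    using ker[OF that(2,1)] orth_w[OF that(2)] by (simp add: app'' dotp_commute[of L w])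
  ultimately have facts: "psd_matrix L A''" "\<And>l k. A l k = A'' l k + (\<Sum>j<Suc r. \<tau>' j * v' j l * v' j k)"
    "\<And>j. j < r \<Longrightarrow> \<rho> \<le> \<tau> j" "\<And>l. l < L \<Longrightarrow> mat_app L A'' w l = 0"
    "\<And>l j. l < L \<Longrightarrow> j < r \<Longrightarrow> mat_app L A'' (v j) l = 0"
    by blast+
  have new: "\<tau>' r = \<rho>" "v' r = w" and old: "\<And>j. j < r \<Longrightarrow> \<tau>' j = \<tau> j" "\<And>j. j < r \<Longrightarrow> v' j = v j"
    by (auto simp: \<tau>'_def v'_def)
  have 1: "0 \<le> \<tau>' j" if "j < Suc r" for j
    using that \<rho> \<tau>0 by (cases "j = r") (auto simp: new old)
  have 2: "\<tau>' j \<le> \<tau>' i" if "i < Suc r" "j < Suc r" "i \<le> j" for i j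
  proof (cases "j = r")
    case True
    show ?thesis using that(1) facts(3)[of i] unfolding True by (cases "i = r") (simp_all add: new old less_Suc_eq)
  next
    case False
    then have "i < r" "j < r" using that by auto
    then show ?thesis using mono that(3) by (simp add: old)
  qed
  have 3: "dotp L u (mat_app L A'' u) \<le> \<tau>' j * dotp L u u" if "j < Suc r" for j u
    using that order_trans[OF q''_le bound, of j u] order_trans[OF q''_le max, of u]
    by (cases "j = r") (auto simp: new old)
  have 4: "mat_app L A'' (v' j) l = 0" if "j < Suc r" "l < L" for j l
    using that facts(4)[of l] facts(5)[of l j] by (cases "j = r") (auto simp: new old)
  have 5: "dotp L (v' i) (v' j) = 0" if "i < Suc r" "j < Suc r" "i \<noteq> j" for i j
    using that orth[of i j] orth_w[of i] orth_w[of j] dotp_commute[of L w "v j"]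
    by (cases "i = r"; cases "j = r") (auto simp: new old)
  have 6: "dotp L (v' j) (v' j) = (if \<tau>' j = 0 then 0 else 1)" if "j < Suc r" for j
    using that unit[of j] ww by (cases "j = r") (auto simp: new old)
  show ?case
    unfolding deflated_def
    by (intro exI[of _ \<tau>'] exI[of _ v'] exI[of _ A''] conjI allI impI; rule facts 1 2 3 4 5 6; assumption)
qed

text \<open>Deflation runs for \<open>L + 1\<close> steps. If the last eigenvalue were positive, all
  would be, and \<open>L + 1\<close> orthonormal vectors would contradict Bessel's inequality summed
  over \<open>L\<close> coordinates. Hence the remaining form is bounded by zero and the remainder
  vanishes.\<close>

lemma psd_matrix_spectral:
  assumes A: "psd_matrix L A"
  obtains \<tau> v where "\<And>j. 0 \<le> \<tau> j" "\<And>i j. i \<le> j \<Longrightarrow> \<tau> j \<le> \<tau> i" "\<And>j. L \<le> j \<Longrightarrow> \<tau> j = 0"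
    "\<And>l k. l < L \<Longrightarrow> k < L \<Longrightarrow> A l k = (\<Sum>j<L. \<tau> j * v j l * v j k)"
    "\<And>i j. i < L \<Longrightarrow> j < L \<Longrightarrow> i \<noteq> j \<Longrightarrow> dotp L (v i) (v j) = 0"
    "\<And>j. j < L \<Longrightarrow> dotp L (v j) (v j) = (if \<tau> j = 0 then 0 else 1)"
proof -
  obtain \<tau> v A' where "deflated L A (Suc L) \<tau> v A'" using psd_matrix_deflation[OF A] by blast
  note A' = deflatedD(1)[OF this] and dec = deflatedD(2)[OF this] and \<tau>0 = deflatedD(3)[OF this]
    and mono = deflatedD(4)[OF this] and bound = deflatedD(5)[OF this]
    and orth = deflatedD(7)[OF this] and unit = deflatedD(8)[OF this]
  have \<tau>L: "\<tau> L = 0"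
  proof (rule ccontr)
    assume "\<tau> L \<noteq> 0"
    then have "\<tau> j \<noteq> 0" if "j < Suc L" for j using mono[of j L] \<tau>0[of L] that by force
    then have "(\<Sum>j<Suc L. dotp L (v j) (v j)) = real (Suc L)" using unit by simp
    moreover have "(\<Sum>j<Suc L. dotp L (v j) (v j)) = (\<Sum>l<L. \<Sum>j<Suc L. (v j l)\<^sup>2)"
      unfolding dotp_def power2_eq_square by (rule sum.swap)
    moreover have "\<dots> \<le> (\<Sum>l<L. 1)"
      using bessel_coordinates[of "Suc L" L v] orth unit by (intro sum_mono) auto
    ultimately show False by simp
  qed
  have A'0: "A' l k = 0" if "l < L" "k < L" for l k
  proof -
    have q0: "dotp L u (mat_app L A' u) = 0" for u
      using bound[of L u] A' \<tau>L by (simp add: psd_matrix_def order_antisym)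
    let ?e = "\<lambda>i k. if k = i then 1 else 0 :: real"
    have e: "dotp L (?e i) (mat_app L A' (?e j)) = A' i j" if "i < L" "j < L" for i j
    proof -
      have "mat_app L A' (?e j) l = A' l j" for l
        unfolding mat_app_def using that by (subst sum.remove[of _ j]) auto
      then show ?thesis
        unfolding dotp_def using that by (subst sum.remove[of _ i]) auto
    qed
    \<comment> \<open>Polarisation: the form vanishes at the sum of two coordinate vectors.\<close>
    have "0 = dotp L (\<lambda>x. ?e l x + 1 * ?e k x) (mat_app L A' (\<lambda>x. ?e l x + 1 * ?e k x))"
      using q0 by simp
    also have "\<dots> = 2 * A' l k"
      unfolding mat_app_add_scale dotp_add_scale_left dotp_add_scale_right q0
      using mat_app_self_adjoint[OF A', of "?e l" "?e k"] by (simp add: e that)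
    finally show ?thesis by simp
  qed
  define \<tau>' where "\<tau>' j = (if j < L then \<tau> j else 0)" for j
  show ?thesis
  proof (rule that[of \<tau>' v])
    show "A l k = (\<Sum>j<L. \<tau>' j * v j l * v j k)" if "l < L" "k < L" for l k
      using dec[of l k] A'0[OF that] \<tau>L by (simp add: \<tau>'_def)
  qed (use \<tau>0 mono orth unit in \<open>auto simp: \<tau>'_def\<close>)
qed

text \<open>This is Ky Fan's inequality, subtracted from the trace identity.\<close>

lemma psd_matrix_eigenvalue_tail:
  assumes \<tau>0: "\<And>j. 0 \<le> \<tau> j" and mono: "\<And>i j. i \<le> j \<Longrightarrow> \<tau> j \<le> \<tau> i"
    and dec: "\<And>l k. l < L \<Longrightarrow> k < L \<Longrightarrow> A l k = (\<Sum>j<L. \<tau> j * v j l * v j k)"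
    and orth: "\<And>i j. i < L \<Longrightarrow> j < L \<Longrightarrow> i \<noteq> j \<Longrightarrow> dotp L (v i) (v j) = 0"
    and unit: "\<And>j. j < L \<Longrightarrow> dotp L (v j) (v j) = (if \<tau> j = 0 then 0 else 1)"
    and L': "L' \<le> L"
  shows "(\<Sum>j=L'..<L. \<tau> j) \<le> (\<Sum>l=L'..<L. A l l)"
proof -
  define w where "w j = (\<Sum>l<L'. (v j l)\<^sup>2)" for j
  have unit': "dotp L (v j) (v j) \<le> 1" if "j < L" for j using unit[OF that] by simp
  have split: "(\<Sum>j<L. f j) = (\<Sum>j<L'. f j) + (\<Sum>j=L'..<L. f j)" for f :: "nat \<Rightarrow> real"
    using sum.atLeastLessThan_concat[of 0 L' L f] L' by (simp add: lessThan_atLeast0)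
  have w1: "w j \<le> 1" if "j < L" for j
  proof -
    have "w j \<le> dotp L (v j) (v j)"
      unfolding w_def dotp_def power2_eq_square using L' by (intro sum_mono2) auto
    then show ?thesis using unit'[OF that] by simp
  qed
  have w0: "0 \<le> w j" for j by (simp add: w_def sum_nonneg)
  have wsum: "(\<Sum>j<L. w j) \<le> real L'"
  proof -
    have "(\<Sum>j<L. w j) = (\<Sum>l<L'. \<Sum>j<L. (v j l)\<^sup>2)" unfolding w_def by (rule sum.swap)
    also have "\<dots> \<le> (\<Sum>l<L'. 1)"
      using L' by (intro sum_mono bessel_coordinates[OF orth unit']) auto
    finally show ?thesis by simp
  qed
  have diag: "(\<Sum>l<k. A l l) = (\<Sum>j<L. \<tau> j * (\<Sum>l<k. (v j l)\<^sup>2))" if "k \<le> L" for k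
  proof -
    have "(\<Sum>l<k. A l l) = (\<Sum>l<k. \<Sum>j<L. \<tau> j * (v j l)\<^sup>2)"
      using that by (intro sum.cong refl) (simp add: dec power2_eq_square mult_ac)
    also have "\<dots> = (\<Sum>j<L. \<tau> j * (\<Sum>l<k. (v j l)\<^sup>2))"
      by (subst sum.swap) (simp add: sum_distrib_left)
    finally show ?thesis .
  qed
  have trace: "(\<Sum>l<L. A l l) = (\<Sum>j<L. \<tau> j)"
    unfolding diag[OF order_refl]
  proof (intro sum.cong refl)
    fix j assume "j \<in> {..<L}"
    then show "\<tau> j * (\<Sum>l<L. (v j l)\<^sup>2) = \<tau> j"
      using unit[of j] by (auto simp: dotp_def power2_eq_square split: if_splits)
  qed
  have "(\<Sum>l<L'. A l l) = (\<Sum>j<L'. \<tau> j * w j) + (\<Sum>j=L'..<L. \<tau> j * w j)"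
    unfolding diag[OF L'] w_def[symmetric] by (rule split)
  \<comment> \<open>The weights \<open>w j\<close> lie between 0 and 1 and have total at most
    \<open>L'\<close>, so the weighted sum does not exceed the sum of the \<open>L'\<close> largest
    eigenvalues. Comparing every term with \<open>\<tau> L'\<close> makes this explicit.\<close>
  also have "\<dots> \<le> (\<Sum>j<L'. \<tau> j + \<tau> L' * (w j - 1)) + (\<Sum>j=L'..<L. \<tau> L' * w j)"
  proof (intro add_mono sum_mono)
    fix j assume j: "j \<in> {..<L'}"
    have "0 \<le> (\<tau> j - \<tau> L') * (1 - w j)" using mono[of j L'] w1[of j] j L' by simp
    then show "\<tau> j * w j \<le> \<tau> j + \<tau> L' * (w j - 1)" by (simp add: algebra_simps)
  qed (use mono w0 in \<open>auto intro: mult_right_mono\<close>)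
  also have "\<dots> = (\<Sum>j<L'. \<tau> j) + \<tau> L' * ((\<Sum>j<L. w j) - real L')"
    unfolding split[of w] by (simp add: sum.distrib sum_subtractf algebra_simps sum_distrib_left)
  also have "\<dots> \<le> (\<Sum>j<L'. \<tau> j)"
    using wsum \<tau>0[of L'] by (simp add: mult_nonneg_nonpos)
  finally show ?thesis using trace unfolding split by simp
qed

section \<open>Gaussian integrals and Laplace transforms\<close>

lemma iid_std_normal_char:
  assumes Z: "iid_std_normal P Z"
  shows "(\<integral>\<omega>. cos (\<Sum>l<L. c l * Z l \<omega>) \<partial>P) = exp (- (\<Sum>l<L. (c l)\<^sup>2) / 2)"
proof -
  interpret P: prob_space P using Z by (simp add: iid_std_normal_def)
  have indep: "P.indep_vars (\<lambda>_. borel) Z UNIV" and dist: "distributed P lborel (Z j) std_normal_density" for j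
    using Z by (auto simp: iid_std_normal_def)
  have meas [measurable]: "Z j \<in> borel_measurable P" for j
    using distributed_measurable[OF dist[of j]] by simp
  have law: "distr P borel (Z j) = std_normal_distribution" for j
  proof -
    have "distr P borel (Z j) = distr P lborel (Z j)" by (rule distr_cong) auto
    then show ?thesis using distributed_distr_eq_density[OF dist[of j]] by simp
  qed
  have "P.indep_vars (\<lambda>_. borel) (\<lambda>l \<omega>. c l * Z l \<omega>) {..<L}"
    using P.indep_vars_compose2[OF P.indep_vars_subset[OF indep, of "{..<L}"], of "\<lambda>l x. c l * x" "\<lambda>_. borel"]
    by auto
  then have "char (distr P borel (\<lambda>\<omega>. \<Sum>l<L. c l * Z l \<omega>)) 1 = (\<Prod>l<L. char (distr P borel (\<lambda>\<omega>. c l * Z l \<omega>)) 1)"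
    by (rule P.char_distr_sum)
  also have "\<dots> = (\<Prod>l<L. char (distr P borel (Z l)) (c l))"
    by (simp add: char_def integral_distr)
  also have "\<dots> = of_real (exp (- (\<Sum>l<L. (c l)\<^sup>2) / 2))"
    by (simp add: law char_std_normal_distribution sum_negf[symmetric] sum_divide_distrib exp_sum)
  finally have "(CLINT \<omega>|P. iexp (\<Sum>l<L. c l * Z l \<omega>)) = of_real (exp (- (\<Sum>l<L. (c l)\<^sup>2) / 2))"
    by (simp add: char_def integral_distr)
  then have "Re (CLINT \<omega>|P. iexp (\<Sum>l<L. c l * Z l \<omega>)) = exp (- (\<Sum>l<L. (c l)\<^sup>2) / 2)"
    by simp
  moreover have "integrable P (\<lambda>\<omega>. iexp (\<Sum>l<L. c l * Z l \<omega>))"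
    by (intro P.integrable_iexp) auto
  then have "Re (CLINT \<omega>|P. iexp (\<Sum>l<L. c l * Z l \<omega>)) = (\<integral>\<omega>. Re (iexp (\<Sum>l<L. c l * Z l \<omega>)) \<partial>P)"
    by (rule integral_Re[symmetric])
  moreover have "Re (iexp y) = cos y" for y :: real by (simp flip: cis_conv_exp)
  ultimately show ?thesis by (simp only:)
qed

lemma iid_std_normal_measurable:
  assumes "iid_std_normal P Z" shows "Z j \<in> borel_measurable P"
  using assms distributed_measurable[of P lborel "Z j" std_normal_density] by (simp add: iid_std_normal_def)

lemma iid_std_normal_square:
  assumes Z: "iid_std_normal P Z"
  shows "integrable P (\<lambda>\<omega>. (Z j \<omega>)\<^sup>2)" "(\<integral>\<omega>. (Z j \<omega>)\<^sup>2 \<partial>P) = 1"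
proof -
  have dist: "distributed P lborel (Z j) std_normal_density"
    using Z by (auto simp: iid_std_normal_def)
  have "integrable lborel (\<lambda>x. std_normal_density x * x ^ 2)" "(\<integral>x. std_normal_density x * x ^ 2 \<partial>lborel) = 1"
    using integrable_std_normal_moment[of 2] integral_std_normal_moment_even[of 1]
    by (simp_all add: fact_numeral)
  then show "integrable P (\<lambda>\<omega>. (Z j \<omega>)\<^sup>2)" "(\<integral>\<omega>. (Z j \<omega>)\<^sup>2 \<partial>P) = 1"
    using distributed_integrable[OF dist, of "\<lambda>x. x ^ 2"] distributed_integral[OF dist, of "\<lambda>x. x ^ 2"] by auto
qed

text \<open>Writing each side as the expectation of \<open>cos (\<Sum>j l. B j l * Z j * Z' l)\<close> with independent
  \<open>Z\<close> and \<open>Z'\<close>, the two sides differ only in the order of integration.\<close>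

lemma iid_std_normal_quadratic_transpose:
  assumes Z: "iid_std_normal P Z"
  shows "(\<integral>\<omega>. exp (- (\<Sum>j<J. (\<Sum>l<L. B j l * Z l \<omega>)\<^sup>2) / 2) \<partial>P) =
    (\<integral>\<omega>. exp (- (\<Sum>l<L. (\<Sum>j<J. B j l * Z j \<omega>)\<^sup>2) / 2) \<partial>P)"
proof -
  interpret P: prob_space P using Z by (simp add: iid_std_normal_def)
  interpret PP: pair_prob_space P P ..
  note [measurable] = iid_std_normal_measurable[OF Z]
  let ?F = "\<lambda>\<omega>' \<omega>. cos (\<Sum>j<J. \<Sum>l<L. B j l * Z j \<omega>' * Z l \<omega>)"
  have int: "integrable (P \<Otimes>\<^sub>M P) (case_prod ?F)"
    by (rule PP.integrable_const_bound[of _ 1]) (auto simp: case_prod_beta)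
  have 1: "exp (- (\<Sum>j<J. (\<Sum>l<L. B j l * Z l \<omega>)\<^sup>2) / 2) = (\<integral>\<omega>'. ?F \<omega>' \<omega> \<partial>P)" for \<omega>
    by (subst iid_std_normal_char[OF Z, symmetric]) (simp add: sum_distrib_left mult_ac)
  have 2: "exp (- (\<Sum>l<L. (\<Sum>j<J. B j l * Z j \<omega>')\<^sup>2) / 2) = (\<integral>\<omega>. ?F \<omega>' \<omega> \<partial>P)" for \<omega>'
  proof -
    have "(\<Sum>j<J. \<Sum>l<L. B j l * Z j \<omega>' * Z l \<omega>) = (\<Sum>l<L. (\<Sum>j<J. B j l * Z j \<omega>') * Z l \<omega>)" for \<omega>
      by (subst sum.swap) (simp add: sum_distrib_right)
    then show ?thesis by (simp only: iid_std_normal_char[OF Z])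
  qed
  show ?thesis unfolding 1 2 by (rule PP.Fubini_integral[OF int])
qed

section \<open>From Laplace transforms to weak convergence\<close>

lemma bounded_continuous_integrable:
  fixes f :: "'b::topological_space \<Rightarrow> real"
  assumes "prob_space \<mu>" "sets \<mu> = sets borel" "continuous_on UNIV f" "\<And>x. \<bar>f x\<bar> \<le> B"
  shows "integrable \<mu> f"
proof -
  interpret prob_space \<mu> by fact
  have "f \<in> borel_measurable \<mu>"
    using borel_measurable_continuous_onI[OF assms(3)] measurable_cong_sets[OF assms(2) refl] by blast
  then show ?thesis using assms(4) by (intro integrable_const_bound[of _ B]) auto
qed

text \<open>The substitution \<open>exp (- x)\<close> turns Laplace transforms at natural numbers
  into moments on the unit interval, so polynomial approximation yields all test functions
  \<open>\<phi> (exp (- x))\<close> with continuous \<open>\<phi>\<close>. A general bounded test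
  function is cut off. The mass lost is controlled because the cutoff itself has that form and the
  limit is a probability measure.\<close>

lemma laplace_weak_convergence:
  fixes \<mu> :: "'i \<Rightarrow> real measure"
  assumes \<mu>: "eventually (\<lambda>i. prob_space (\<mu> i) \<and> sets (\<mu> i) = sets borel \<and> (AE x in \<mu> i. 0 \<le> x)) F"
    and \<nu>: "prob_space \<nu>" "sets \<nu> = sets borel" "AE x in \<nu>. 0 \<le> x"
    and lap: "\<And>k::nat. ((\<lambda>i. \<integral>x. exp (- real k * x) \<partial>\<mu> i) \<longlongrightarrow> (\<integral>x. exp (- real k * x) \<partial>\<nu>)) F"
  shows "weakly_converges \<mu> \<nu> F"
proof -
  define good where "good \<kappa> \<longleftrightarrow> prob_space \<kappa> \<and> sets \<kappa> = sets borel \<and> (AE x in \<kappa>. 0 \<le> x)" for \<kappa> :: "real measure"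
  have good\<mu>: "eventually (\<lambda>i. good (\<mu> i)) F" and good\<nu>: "good \<nu>"
    using \<mu> \<nu> by (auto simp: good_def)
  have borel: "f \<in> borel_measurable \<kappa>" if "good \<kappa>" "continuous_on UNIV f" for \<kappa> and f :: "real \<Rightarrow> real"
    using borel_measurable_continuous_onI[OF that(2)] measurable_cong_sets[of \<kappa> borel borel borel] that(1)
    unfolding good_def by blast
  have int: "integrable \<kappa> f" if "good \<kappa>" "continuous_on UNIV f" "\<And>x. 0 \<le> x \<Longrightarrow> \<bar>f x\<bar> \<le> B"
    for \<kappa> and f :: "real \<Rightarrow> real" and B
  proof -
    interpret prob_space \<kappa> using that by (simp add: good_def)
    have "AE x in \<kappa>. 0 \<le> x" using that by (simp add: good_def)
    then have "AE x in \<kappa>. norm (f x) \<le> B" by eventually_elim (use that in simp)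
    then show ?thesis using borel[OF that(1,2)] by (intro integrable_const_bound)
  qed
  have exp1: "\<bar>exp (- real k * x)\<bar> \<le> 1" if "0 \<le> x" for x k using that by simp
  have poly: "((\<lambda>i. \<integral>x. (\<Sum>k\<le>n. a k * exp (- x) ^ k) \<partial>\<mu> i) \<longlongrightarrow> (\<integral>x. (\<Sum>k\<le>n. a k * exp (- x) ^ k) \<partial>\<nu>)) F"
    for a :: "nat \<Rightarrow> real" and n
  proof -
    have eq: "(\<integral>x. (\<Sum>k\<le>n. a k * exp (- x) ^ k) \<partial>\<kappa>) = (\<Sum>k\<le>n. a k * (\<integral>x. exp (- real k * x) \<partial>\<kappa>))"
      if "good \<kappa>" for \<kappa>
    proof -
      have "integrable \<kappa> (\<lambda>x. exp (- real k * x))" for k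
        by (rule int[OF that _ exp1]) (intro continuous_intros)
      then show ?thesis by (simp add: exp_of_nat_mult[symmetric])
    qed
    have "((\<lambda>i. \<Sum>k\<le>n. a k * (\<integral>x. exp (- real k * x) \<partial>\<mu> i)) \<longlongrightarrow> (\<Sum>k\<le>n. a k * (\<integral>x. exp (- real k * x) \<partial>\<nu>))) F"
      by (intro tendsto_intros lap)
    moreover have "eventually (\<lambda>i. (\<Sum>k\<le>n. a k * (\<integral>x. exp (- real k * x) \<partial>\<mu> i)) =
        (\<integral>x. (\<Sum>k\<le>n. a k * exp (- x) ^ k) \<partial>\<mu> i)) F"
      using good\<mu> by eventually_elim (simp add: eq)
    ultimately show ?thesis unfolding eq[OF good\<nu>] by (rule Lim_transform_eventually)
  qed
  have cont: "((\<lambda>i. \<integral>x. \<phi> (exp (- x)) \<partial>\<mu> i) \<longlongrightarrow> (\<integral>x. \<phi> (exp (- x)) \<partial>\<nu>)) F"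
    if \<phi>: "continuous_on UNIV \<phi>" for \<phi> :: "real \<Rightarrow> real"
  proof (rule tendstoI)
    fix e :: real assume e: "e > 0"
    obtain g where g: "real_polynomial_function g" "\<And>x. x \<in> {0..1} \<Longrightarrow> \<bar>\<phi> x - g x\<bar> < e / 3"
      using Stone_Weierstrass_real_polynomial_function[of "{0..1::real}" \<phi> "e / 3"] \<phi> e
      by (metis compact_Icc continuous_on_subset subset_UNIV divide_pos_pos zero_less_numeral)
    then obtain a n where ga: "g = (\<lambda>x. \<Sum>i\<le>n. a i * x ^ i)"
      using real_polynomial_function_iff_sum by blast
    have contg: "continuous_on UNIV g" unfolding ga by (intro continuous_intros)
    have approx: "\<bar>(\<integral>x. \<phi> (exp (- x)) \<partial>\<kappa>) - (\<integral>x. g (exp (- x)) \<partial>\<kappa>)\<bar> \<le> e / 3" if \<kappa>: "good \<kappa>" for \<kappa>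
    proof -
      interpret prob_space \<kappa> using \<kappa> by (simp add: good_def)
      have bd: "\<exists>B. \<forall>x\<ge>0. \<bar>\<psi> (exp (- x))\<bar> \<le> B" if "continuous_on UNIV \<psi>" for \<psi> :: "real \<Rightarrow> real"
      proof -
        have "bounded (\<psi> ` {0..1})"
          by (intro compact_imp_bounded compact_continuous_image continuous_on_subset[OF that]) auto
        then obtain B where "\<forall>y\<in>\<psi> ` {0..1}. norm y \<le> B" unfolding bounded_iff by blast
        then show ?thesis by (intro exI[of _ B]) auto
      qed
      have i1: "integrable \<kappa> (\<lambda>x. \<psi> (exp (- x)))" if c: "continuous_on UNIV \<psi>" for \<psi> :: "real \<Rightarrow> real"
      proof -
        obtain B where "\<And>x. 0 \<le> x \<Longrightarrow> \<bar>\<psi> (exp (- x))\<bar> \<le> B" using bd[OF c] by blast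
        moreover have "continuous_on UNIV (\<lambda>x. \<psi> (exp (- x)))"
          by (rule continuous_on_compose2[OF c]) (auto intro!: continuous_intros)
        ultimately show ?thesis by (intro int[OF \<kappa>])
      qed
      have "\<bar>(\<integral>x. \<phi> (exp (- x)) \<partial>\<kappa>) - (\<integral>x. g (exp (- x)) \<partial>\<kappa>)\<bar> = \<bar>\<integral>x. \<phi> (exp (- x)) - g (exp (- x)) \<partial>\<kappa>\<bar>"
        by (simp add: Bochner_Integration.integral_diff i1 \<phi> contg)
      also have "\<dots> \<le> (\<integral>x. \<bar>\<phi> (exp (- x)) - g (exp (- x))\<bar> \<partial>\<kappa>)" by (rule integral_abs_bound)
      also have "\<dots> \<le> (\<integral>x. e / 3 \<partial>\<kappa>)"
      proof (rule integral_mono_AE)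
        have "AE x in \<kappa>. 0 \<le> x" using \<kappa> by (simp add: good_def)
        then show "AE x in \<kappa>. \<bar>\<phi> (exp (- x)) - g (exp (- x))\<bar> \<le> e / 3"
          by eventually_elim (use g(2) in \<open>simp add: less_imp_le\<close>)
      qed (use i1 \<phi> contg in auto)
      finally show ?thesis by (simp add: prob_space)
    qed
    have "eventually (\<lambda>i. dist (\<integral>x. g (exp (- x)) \<partial>\<mu> i) (\<integral>x. g (exp (- x)) \<partial>\<nu>) < e / 3) F"
      using poly[of a n] e unfolding ga by (intro tendstoD) auto
    with good\<mu> show "eventually (\<lambda>i. dist (\<integral>x. \<phi> (exp (- x)) \<partial>\<mu> i) (\<integral>x. \<phi> (exp (- x)) \<partial>\<nu>) < e) F"
    proof eventually_elim
      case (elim i)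
      then show ?case using approx[OF elim(1)] approx[OF good\<nu>] unfolding dist_real_def by linarith
    qed
  qed
  show ?thesis unfolding weakly_converges_def
  proof (intro allI impI)
    fix f :: "real \<Rightarrow> real"
    assume f: "continuous_on UNIV f" and "bounded (range f)"
    then obtain B0 where "\<forall>x. \<bar>f x\<bar> \<le> B0" by (auto simp: bounded_iff)
    then have B1: "\<bar>f x\<bar> \<le> B0" for x by blast
    define B where "B = \<bar>B0\<bar> + 1"
    have Bf: "\<bar>f x\<bar> \<le> B" for x using B1[of x] by (simp add: B_def)
    have B0: "B > 0" by (simp add: B_def)
    define \<theta> where "\<theta> R x = min 1 (max 0 (R + 1 - x))" for R x :: real
    have \<theta>: "0 \<le> \<theta> R x" "\<theta> R x \<le> 1" for R x by (auto simp: \<theta>_def)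
    have cont\<theta>: "continuous_on UNIV (\<theta> R)" for R unfolding \<theta>_def by (intro continuous_intros)
    have clip: "((\<lambda>i. \<integral>x. g x * \<theta> R x \<partial>\<mu> i) \<longlongrightarrow> (\<integral>x. g x * \<theta> R x \<partial>\<nu>)) F"
      if g: "continuous_on UNIV g" for g R
    proof -
      \<comment> \<open>Inverts the substitution. The maximum keeps the logarithm away from 0 and
        changes nothing, because the cutoff vanishes from \<open>R + 1\<close> on.\<close>
      define \<phi> where "\<phi> u = (\<lambda>x. g x * \<theta> R x) (- ln (max u (exp (- (R + 1)))))" for u
      have "continuous_on UNIV \<phi>"
      proof -
        have "max u (exp (- (R + 1))) \<noteq> 0" for u
          using less_le_trans[OF exp_gt_zero[of "- (R + 1)"] max.cobounded2[of "exp (- (R + 1))" u]] by simp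
        then have 1: "continuous_on UNIV (\<lambda>u. - ln (max u (exp (- (R + 1)))))"
          by (intro continuous_intros) auto
        have 2: "continuous_on UNIV (\<lambda>x. g x * \<theta> R x)" by (intro continuous_intros g cont\<theta>)
        show ?thesis unfolding \<phi>_def by (rule continuous_on_compose2[OF 2 1]) simp
      qed
      then have "((\<lambda>i. \<integral>x. \<phi> (exp (- x)) \<partial>\<mu> i) \<longlongrightarrow> (\<integral>x. \<phi> (exp (- x)) \<partial>\<nu>)) F" by (rule cont)
      moreover have "\<phi> (exp (- x)) = g x * \<theta> R x" for x
      proof (cases "x \<le> R + 1")
        case True
        then have "max (exp (- x)) (exp (- (R + 1))) = exp (- x)" by simp
        then show ?thesis by (simp add: \<phi>_def)
      next
        case False
        then have "max (exp (- x)) (exp (- (R + 1))) = exp (- (R + 1))" by simp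
        then show ?thesis using False by (simp add: \<phi>_def \<theta>_def)
      qed
      ultimately show ?thesis by simp
    qed
    have i\<theta>: "integrable \<kappa> (\<lambda>x. g x * \<theta> R x)" if "good \<kappa>" "continuous_on UNIV g" "\<And>x. \<bar>g x\<bar> \<le> C" for \<kappa> g C R
    proof (rule int[OF that(1)])
      show "continuous_on UNIV (\<lambda>x. g x * \<theta> R x)" by (intro continuous_intros that cont\<theta>)
      show "\<bar>g x * \<theta> R x\<bar> \<le> C" for x
        using \<theta>[of R x] that(3)[of x] by (simp add: abs_mult mult_le_one) (meson abs_ge_zero mult_left_le order_trans)
    qed
    have cut: "\<bar>(\<integral>x. f x \<partial>\<kappa>) - (\<integral>x. f x * \<theta> R x \<partial>\<kappa>)\<bar> \<le> B * (1 - (\<integral>x. 1 * \<theta> R x \<partial>\<kappa>))" if \<kappa>: "good \<kappa>" for \<kappa> R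
    proof -
      interpret prob_space \<kappa> using \<kappa> by (simp add: good_def)
      have if': "integrable \<kappa> f" using int[OF \<kappa> f Bf] .
      have ifc: "integrable \<kappa> (\<lambda>x. f x * \<theta> R x)" using i\<theta>[OF \<kappa> f Bf] .
      have ic: "integrable \<kappa> (\<lambda>x. 1 * \<theta> R x)" using i\<theta>[OF \<kappa>, of "\<lambda>_. 1" 1] by simp
      have "\<bar>(\<integral>x. f x \<partial>\<kappa>) - (\<integral>x. f x * \<theta> R x \<partial>\<kappa>)\<bar> = \<bar>\<integral>x. f x - f x * \<theta> R x \<partial>\<kappa>\<bar>"
        by (simp add: Bochner_Integration.integral_diff if' ifc)
      also have "\<dots> \<le> (\<integral>x. \<bar>f x - f x * \<theta> R x\<bar> \<partial>\<kappa>)" by (rule integral_abs_bound)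
      also have "\<dots> \<le> (\<integral>x. B * (1 - 1 * \<theta> R x) \<partial>\<kappa>)"
      proof (rule integral_mono)
        fix x
        have "\<bar>f x - f x * \<theta> R x\<bar> = \<bar>f x\<bar> * (1 - \<theta> R x)"
        proof -
          have "f x - f x * \<theta> R x = f x * (1 - \<theta> R x)" by (simp add: right_diff_distrib)
          then show ?thesis using \<theta>[of R x] by (simp add: abs_mult)
        qed
        also have "\<dots> \<le> B * (1 - \<theta> R x)" using \<theta>[of R x] Bf by (intro mult_right_mono) auto
        finally show "\<bar>f x - f x * \<theta> R x\<bar> \<le> B * (1 - 1 * \<theta> R x)" by simp
      qed (use if' ifc ic in auto)
      also have "\<dots> = B * (1 - (\<integral>x. 1 * \<theta> R x \<partial>\<kappa>))" using ic by (simp add: prob_space)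
      finally show ?thesis .
    qed
    have tight: "(\<lambda>R. \<integral>x. 1 * \<theta> (real R) x \<partial>\<nu>) \<longlonglongrightarrow> (\<integral>x. 1 \<partial>\<nu>)"
    proof (rule integral_dominated_convergence[where w = "\<lambda>_. 1"])
      interpret prob_space \<nu> by fact
      show "integrable \<nu> (\<lambda>_. 1::real)" by simp
      show "(\<lambda>x. 1 * \<theta> (real R) x) \<in> borel_measurable \<nu>" for R
        using borel[OF good\<nu> cont\<theta>] by simp
      show "AE x in \<nu>. (\<lambda>R. 1 * \<theta> (real R) x) \<longlonglongrightarrow> 1"
      proof (rule AE_I2)
        fix x :: real
        obtain N where N: "x \<le> real N" using real_arch_simple by blast
        have "\<forall>\<^sub>F R in sequentially. 1 * \<theta> (real R) x = 1"
          using eventually_ge_at_top[of N] by eventually_elim (use N in \<open>simp add: \<theta>_def\<close>)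
        then show "(\<lambda>R. 1 * \<theta> (real R) x) \<longlonglongrightarrow> 1" by (rule tendsto_eventually)
      qed
      show "AE x in \<nu>. norm (1 * \<theta> (real R) x) \<le> 1" for R using \<theta> by (intro AE_I2) auto
    qed auto
    show "((\<lambda>i. \<integral>x. f x \<partial>\<mu> i) \<longlongrightarrow> (\<integral>x. f x \<partial>\<nu>)) F"
    proof (rule tendstoI)
      fix e :: real assume e: "e > 0"
      have "(\<integral>x. 1 \<partial>\<nu>) = (1::real)" using prob_space.prob_space[OF \<nu>(1)] by simp
      then have "\<forall>\<^sub>F R in sequentially. dist (\<integral>x. 1 * \<theta> (real R) x \<partial>\<nu>) 1 < e / (8 * B)"
        using tendstoD[OF tight, of "e / (8 * B)"] e B0 by simp
      then obtain R where R: "dist (\<integral>x. 1 * \<theta> (real R) x \<partial>\<nu>) 1 < e / (8 * B)"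
        using eventually_happens by fastforce
      \<comment> \<open>Convergence of \<open>?b\<close> carries tightness from the limit over to
        \<open>\<mu> i\<close>. The three errors are then at most \<open>e / 4\<close>,
        \<open>e / 4\<close> and \<open>e / 8\<close>.\<close>
      let ?a = "\<lambda>\<kappa>. \<integral>x. f x * \<theta> (real R) x \<partial>\<kappa>" and ?b = "\<lambda>\<kappa>. \<integral>x. 1 * \<theta> (real R) x \<partial>\<kappa>"
      have "eventually (\<lambda>i. dist (?a (\<mu> i)) (?a \<nu>) < e / 4) F"
        using tendstoD[OF clip[OF f, of "real R"], of "e / 4"] e by simp
      moreover have "eventually (\<lambda>i. dist (?b (\<mu> i)) (?b \<nu>) < e / (8 * B)) F"
        using tendstoD[OF clip[of "\<lambda>_. 1" "real R"], of "e / (8 * B)"] e B0 by simp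
      ultimately show "eventually (\<lambda>i. dist (\<integral>x. f x \<partial>\<mu> i) (\<integral>x. f x \<partial>\<nu>) < e) F"
        using good\<mu>
      proof eventually_elim
        case (elim i)
        have bnd: "1 - ?b \<nu> \<le> e / (8 * B)" "1 - ?b (\<mu> i) \<le> e / (8 * B) + e / (8 * B)"
          using R elim(2) unfolding dist_real_def by linarith+
        have "B * (1 - ?b \<nu>) \<le> B * (e / (8 * B))" "B * (1 - ?b (\<mu> i)) \<le> B * (e / (8 * B) + e / (8 * B))"
          by (intro mult_left_mono bnd less_imp_le[OF B0])+
        moreover have "B * (e / (8 * B)) = e / 8" "B * (e / (8 * B) + e / (8 * B)) = e / 4"
          using B0 by (simp_all add: distrib_left)
        ultimately have "B * (1 - ?b \<nu>) \<le> e / 8" "B * (1 - ?b (\<mu> i)) \<le> e / 4"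
          by (simp_all only:)
        then show ?case
          using elim(1) cut[OF elim(3), of "real R"] cut[OF good\<nu>, of "real R"] e
          unfolding dist_real_def by linarith
      qed
    qed
  qed
qed

text \<open>A reduction to sequences, because dominated convergence is applied along
  sequences.\<close>

lemma tendsto_min_at_topI:
  fixes f :: "nat \<times> nat \<Rightarrow> 'b::metric_space"
  assumes "\<And>a. filterlim a min_at_top sequentially \<Longrightarrow> (\<lambda>k. f (a k)) \<longlonglongrightarrow> l"
  shows "(f \<longlongrightarrow> l) min_at_top"
proof (rule tendstoI, rule ccontr)
  fix e :: real
  assume "e > 0" and no: "\<not> (\<forall>\<^sub>F x in min_at_top. dist (f x) l < e)"
  have "\<exists>x. k \<le> (case x of (m, n) \<Rightarrow> min m n) \<and> \<not> dist (f x) l < e" for k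
  proof (rule ccontr)
    assume "\<not> ?thesis"
    then have "\<forall>\<^sub>F x in min_at_top. dist (f x) l < e"
      unfolding min_at_top_def eventually_filtercomap
      by (intro exI[of _ "\<lambda>N. k \<le> N"]) (auto simp: eventually_ge_at_top)
    with no show False by simp
  qed
  then obtain a where a: "\<And>k. k \<le> (case a k of (m, n) \<Rightarrow> min m n)" "\<And>k. \<not> dist (f (a k)) l < e"
    by metis
  have "filterlim a min_at_top sequentially"
    unfolding min_at_top_def filterlim_filtercomap_iff
    by (rule filterlim_at_top_mono[OF filterlim_ident]) (use a(1) in \<open>auto simp: o_def\<close>)
  then have "(\<lambda>k. f (a k)) \<longlonglongrightarrow> l" by (rule assms)
  then have "\<forall>\<^sub>F k in sequentially. dist (f (a k)) l < e" using \<open>e > 0\<close> by (rule tendstoD)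
  then show False using a(2) eventually_happens by fastforce
qed

lemma eventually_min_at_top: "\<forall>\<^sub>F (m, n) in min_at_top. k \<le> m \<and> k \<le> n"
  unfolding min_at_top_def eventually_filtercomap
  by (intro exI[of _ "\<lambda>N. k \<le> N"]) (auto simp: eventually_ge_at_top)

section \<open>Uniformity of the optimal assignment\<close>

definition assignment_cost :: "nat \<Rightarrow> (nat \<Rightarrow> real ^ 'd) \<Rightarrow> (nat \<Rightarrow> real ^ 'd) \<Rightarrow> (nat \<Rightarrow> nat) \<Rightarrow> real" where
  "assignment_cost N p w \<sigma> = (\<Sum>i<N. (norm (w i - p (\<sigma> i)))\<^sup>2)"

lemma assignment_cost_compose:
  assumes "\<pi> permutes {..<N}"
  shows "assignment_cost N p (w \<circ> \<pi>) (\<sigma> \<circ> \<pi>) = assignment_cost N p w \<sigma>"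
  unfolding assignment_cost_def
  using sum.permute[OF assms, of "\<lambda>i. (norm (w i - p (\<sigma> i)))\<^sup>2"] by (simp add: o_def)

text \<open>Strict optimality is preserved when observations and assignment are relabelled together,
  whereas the choice that \<open>arg_min_on\<close> makes among several minimisers need not be.
  Almost surely the two notions agree.\<close>

definition unique_optimum :: "nat \<Rightarrow> (nat \<Rightarrow> real ^ 'd) \<Rightarrow> (nat \<Rightarrow> nat) \<Rightarrow> (nat \<Rightarrow> real ^ 'd) \<Rightarrow> bool" where
  "unique_optimum N p \<sigma> w \<longleftrightarrow>
    (\<forall>\<rho>. \<rho> permutes {..<N} \<longrightarrow> \<rho> \<noteq> \<sigma> \<longrightarrow> assignment_cost N p w \<sigma> < assignment_cost N p w \<rho>)"

lemma unique_optimum_compose: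
  assumes \<pi>: "\<pi> permutes {..<N}" and u: "unique_optimum N p \<sigma> w"
  shows "unique_optimum N p (\<sigma> \<circ> \<pi>) (w \<circ> \<pi>)"
  unfolding unique_optimum_def
proof (intro allI impI)
  fix \<rho> assume \<rho>: "\<rho> permutes {..<N}" "\<rho> \<noteq> \<sigma> \<circ> \<pi>"
  let ?\<rho> = "\<rho> \<circ> inv \<pi>"
  have eq: "?\<rho> \<circ> \<pi> = \<rho>" by (simp add: comp_assoc permutes_inv_o[OF \<pi>])
  have "?\<rho> permutes {..<N}" by (intro permutes_compose permutes_inv \<pi> \<rho>)
  moreover have "?\<rho> \<noteq> \<sigma>" using eq \<rho>(2) by auto
  ultimately have "assignment_cost N p w \<sigma> < assignment_cost N p w ?\<rho>"
    using u by (simp add: unique_optimum_def)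
  then show "assignment_cost N p (w \<circ> \<pi>) (\<sigma> \<circ> \<pi>) < assignment_cost N p (w \<circ> \<pi>) \<rho>"
    using assignment_cost_compose[OF \<pi>, of p w ?\<rho>] assignment_cost_compose[OF \<pi>, of p w \<sigma>] by (simp add: eq)
qed

lemma opt_perm_permutes: "opt_perm N p w permutes {..<N}"
proof -
  have "opt_perm N p w \<in> {\<sigma>. \<sigma> permutes {..<N}}"
    unfolding opt_perm_def by (rule arg_min_if_finite(1)) (auto simp: finite_perms intro: permutes_id)
  then show ?thesis by simp
qed

lemma opt_perm_minimal:
  assumes "\<rho> permutes {..<N}"
  shows "assignment_cost N p w (opt_perm N p w) \<le> assignment_cost N p w \<rho>"
proof -
  have "\<not> (\<exists>\<rho>\<in>{\<sigma>. \<sigma> permutes {..<N}}. assignment_cost N p w \<rho> < assignment_cost N p w (opt_perm N p w))"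
    unfolding opt_perm_def assignment_cost_def[symmetric]
    by (rule arg_min_if_finite(2)) (auto simp: finite_perms intro: permutes_id)
  then show ?thesis using assms by (auto simp: not_less)
qed

lemma opt_perm_unique_optimum:
  assumes "unique_optimum N p \<sigma> w" "\<sigma> permutes {..<N}"
  shows "opt_perm N p w = \<sigma>"
  using assms opt_perm_minimal[OF assms(2), of p w] opt_perm_permutes[of N p w]
  unfolding unique_optimum_def by force

text \<open>\<open>arg_min_on\<close> depends on the sample only through the finite table of comparisons of costs.\<close>

lemma opt_perm_measurable:
  fixes W :: "nat \<Rightarrow> 'a \<Rightarrow> real ^ 'd" and f :: "(nat \<Rightarrow> nat) \<Rightarrow> real"
  assumes W: "\<And>i. i < N \<Longrightarrow> W i \<in> borel_measurable M"
  shows "(\<lambda>\<omega>. f (opt_perm N p (\<lambda>i. W i \<omega>))) \<in> borel_measurable M"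
proof -
  let ?S = "{\<sigma>. \<sigma> permutes {..<N}}"
  let ?c = "\<lambda>\<omega>. assignment_cost N p (\<lambda>i. W i \<omega>)"
  define T where "T \<omega> = {\<sigma> \<in> ?S. \<forall>\<rho>\<in>?S. \<not> ?c \<omega> \<rho> < ?c \<omega> \<sigma>}" for \<omega>
  define G where "G A = f (SOME \<sigma>. \<sigma> \<in> A)" for A :: "(nat \<Rightarrow> nat) set"
  have eq: "f (opt_perm N p (\<lambda>i. W i \<omega>)) = G (T \<omega>)" for \<omega>
    unfolding opt_perm_def arg_min_on_def arg_min_def is_arg_min_def G_def T_def assignment_cost_def
    by (intro arg_cong[where f = f] arg_cong[where f = Eps] ext) auto
  have meas_c [measurable]: "(\<lambda>\<omega>. ?c \<omega> \<sigma>) \<in> borel_measurable M" for \<sigma>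
    unfolding assignment_cost_def using W by measurable
  have T_meas: "T \<in> measurable M (count_space (Pow ?S))"
  proof (rule measurable_count_space_eq2[THEN iffD2])
    show "finite (Pow ?S)" by (simp add: finite_perms)
    have "T -` {A} \<inter> space M \<in> sets M" if A: "A \<in> Pow ?S" for A
    proof -
      have "T -` {A} \<inter> space M = {\<omega> \<in> space M. \<forall>\<sigma>\<in>?S. \<sigma> \<in> A \<longleftrightarrow> (\<forall>\<rho>\<in>?S. \<not> ?c \<omega> \<rho> < ?c \<omega> \<sigma>)}"
      proof -
        have "{\<sigma> \<in> S. Q \<sigma>} = A \<longleftrightarrow> (\<forall>\<sigma>\<in>S. \<sigma> \<in> A \<longleftrightarrow> Q \<sigma>)" if "A \<subseteq> S" for Q and S :: "(nat \<Rightarrow> nat) set"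
          using that by auto
        from this[of ?S] A have "T \<omega> = A \<longleftrightarrow> (\<forall>\<sigma>\<in>?S. \<sigma> \<in> A \<longleftrightarrow> (\<forall>\<rho>\<in>?S. \<not> ?c \<omega> \<rho> < ?c \<omega> \<sigma>))" for \<omega>
          unfolding T_def by (simp only: Pow_iff)
        then show ?thesis by (simp only: vimage_def Int_def) auto
      qed
      also have "\<dots> \<in> sets M"
      proof (rule sets.sets_Collect_finite_All[OF _ finite_perms])
        fix \<sigma>
        have *: "{\<omega> \<in> space M. \<forall>\<rho>\<in>?S. \<not> ?c \<omega> \<rho> < ?c \<omega> \<sigma>} \<in> sets M"
          by (rule sets.sets_Collect_finite_All[OF _ finite_perms]) measurable
        show "{\<omega> \<in> space M. \<sigma> \<in> A \<longleftrightarrow> (\<forall>\<rho>\<in>?S. \<not> ?c \<omega> \<rho> < ?c \<omega> \<sigma>)} \<in> sets M"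
          using * sets.sets_Collect_neg[OF *] by (cases "\<sigma> \<in> A") simp_all
      qed
      finally show ?thesis .
    qed
    then show "T \<in> space M \<rightarrow> Pow ?S \<and> (\<forall>A\<in>Pow ?S. T -` {A} \<inter> space M \<in> sets M)"
      by (simp add: T_def Pi_iff) blast
  qed
  have "G \<in> measurable (count_space (Pow ?S)) borel" by simp
  then have "(\<lambda>\<omega>. G (T \<omega>)) \<in> borel_measurable M" using T_meas by (rule measurable_compose_rev)
  then show ?thesis by (simp add: eq)
qed

section \<open>Absence of ties and exchangeability\<close>

lemma absolutely_continuous_hyperplane:
  fixes \<mu> :: "(real ^ 'd) measure"
  assumes \<mu>: "\<mu> \<in> P_ac" and v: "v \<noteq> 0"
  shows "emeasure \<mu> {x. x \<bullet> v = c} = 0"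
proof -
  have "negligible {x. v \<bullet> x = c}" using v by (intro negligible_hyperplane) simp
  then have "{x. x \<bullet> v = c} \<in> null_sets lebesgue"
    by (simp add: negligible_iff_null_sets inner_commute)
  moreover have "{x. x \<bullet> v = c} \<in> sets lborel" by simp
  ultimately have "{x. x \<bullet> v = c} \<in> null_sets lborel"
    by (auto simp: null_sets_def)
  then show ?thesis using \<mu> unfolding P_ac_def absolutely_continuous_def by (auto simp: null_sets_def)
qed

text \<open>By independence and Fubini, \<open>B\<close> may be held fixed at a value
  \<open>b\<close>; then \<open>A\<close> would have to hit the single point
  \<open>- b\<close>.\<close>

lemma (in prob_space) prob_sum_eq_zero_if_no_atoms:
  fixes A B :: "'a \<Rightarrow> real"
  assumes indep: "indep_var borel A borel B"
    and atom: "\<And>c. emeasure (distr M borel A) {c} = 0"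
  shows "AE \<omega> in M. A \<omega> + B \<omega> \<noteq> 0"
proof -
  have [measurable]: "random_variable borel A" "random_variable borel B"
    using indep_var_rv1[OF indep] indep_var_rv2[OF indep] by auto
  have joint: "distr M borel A \<Otimes>\<^sub>M distr M borel B = distr M (borel \<Otimes>\<^sub>M borel) (\<lambda>x. (A x, B x))"
    using indep by (simp add: indep_var_distribution_eq)
  interpret DA: prob_space "distr M borel A" by (rule prob_space_distr) simp
  interpret DB: prob_space "distr M borel B" by (rule prob_space_distr) simp
  interpret D: pair_prob_space "distr M borel A" "distr M borel B" ..
  have S: "{x \<in> space (distr M borel A \<Otimes>\<^sub>M distr M borel B). fst x + snd x \<noteq> 0} \<in>
      sets (distr M borel A \<Otimes>\<^sub>M distr M borel B)" by measurable
  have "AE b in distr M borel B. AE a in distr M borel A. a + b \<noteq> 0"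
  proof (rule AE_I2)
    fix b :: real
    have "{- b} \<in> null_sets (distr M borel A)" using atom by (simp add: null_sets_def)
    then show "AE a in distr M borel A. a + b \<noteq> 0"
      by (rule AE_I') (auto simp: eq_neg_iff_add_eq_0)
  qed
  then have "AE a in distr M borel A. AE b in distr M borel B. a + b \<noteq> 0"
    by (subst D.AE_commute[OF S])
  then have "AE x in distr M borel A \<Otimes>\<^sub>M distr M borel B. fst x + snd x \<noteq> 0"
    by (intro D.AE_pair_measure[OF S]) simp
  then have "AE x in distr M (borel \<Otimes>\<^sub>M borel) (\<lambda>x. (A x, B x)). fst x + snd x \<noteq> 0"
    unfolding joint .
  then show ?thesis by (subst (asm) AE_distr_iff) auto
qed

lemma permutes_neq_witness:
  assumes "\<sigma> permutes {..<N::nat}" "\<rho> permutes {..<N}" "\<sigma> \<noteq> \<rho>"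
  obtains i where "i < N" "\<sigma> i \<noteq> \<rho> i"
proof -
  obtain i where i: "\<sigma> i \<noteq> \<rho> i" using assms(3) by blast
  moreover have "i < N"
    using i permutes_not_in[OF assms(1), of i] permutes_not_in[OF assms(2), of i] by (cases "i < N") auto
  ultimately show ?thesis using that by blast
qed

text \<open>The squared norms of observations and points contribute equally to both costs. A tie is
  therefore a linear equation in the observations.\<close>

lemma assignment_cost_diff:
  assumes \<sigma>: "\<sigma> permutes {..<N}" and \<rho>: "\<rho> permutes {..<N}"
  shows "assignment_cost N p w \<rho> - assignment_cost N p w \<sigma> = 2 * (\<Sum>i<N. w i \<bullet> (p (\<sigma> i) - p (\<rho> i)))"
proof -
  have sq: "(\<Sum>i<N. (norm (p (\<pi> i)))\<^sup>2) = (\<Sum>i<N. (norm (p i))\<^sup>2)" if "\<pi> permutes {..<N}" for \<pi>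
    using sum.permute[OF that, of "\<lambda>i. (norm (p i))\<^sup>2"] by (simp add: o_def)
  have cost: "assignment_cost N p w \<pi> =
      (\<Sum>i<N. (norm (w i))\<^sup>2) + (\<Sum>i<N. (norm (p i))\<^sup>2) - 2 * (\<Sum>i<N. w i \<bullet> p (\<pi> i))"
    if "\<pi> permutes {..<N}" for \<pi>
  proof -
    have "(norm (w i - p (\<pi> i)))\<^sup>2 = (norm (w i))\<^sup>2 + (norm (p (\<pi> i)))\<^sup>2 - 2 * (w i \<bullet> p (\<pi> i))" for i
      by (simp add: power2_norm_eq_inner inner_diff_left inner_diff_right inner_commute)
    then show ?thesis
      unfolding assignment_cost_def sq[OF that, symmetric]
      by (simp add: sum.distrib sum_subtractf sum_distrib_left)
  qed
  show ?thesis unfolding cost[OF \<sigma>] cost[OF \<rho>] by (simp add: inner_diff_right sum_subtractf)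
qed

lemma unique_optimum_sets:
  fixes V :: "nat \<Rightarrow> 'a \<Rightarrow> real ^ 'd"
  assumes V: "\<And>i. i < N \<Longrightarrow> V i \<in> borel_measurable M"
  shows "{\<omega> \<in> space M. unique_optimum N p \<sigma> (\<lambda>i. V i \<omega>)} \<in> sets M"
proof -
  have [measurable]: "(\<lambda>\<omega>. assignment_cost N p (\<lambda>i. V i \<omega>) \<rho>) \<in> borel_measurable M" for \<rho>
    unfolding assignment_cost_def using V by measurable
  have "{\<omega> \<in> space M. unique_optimum N p \<sigma> (\<lambda>i. V i \<omega>)} =
    {\<omega> \<in> space M. \<forall>\<rho>\<in>{\<rho>. \<rho> permutes {..<N}}. \<rho> \<noteq> \<sigma> \<longrightarrow>
      assignment_cost N p (\<lambda>i. V i \<omega>) \<sigma> < assignment_cost N p (\<lambda>i. V i \<omega>) \<rho>}"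
    by (auto simp: unique_optimum_def)
  also have "\<dots> \<in> sets M"
    by (rule sets.sets_Collect_finite_All[OF _ finite_perms]) measurable
  finally show ?thesis .
qed

context prob_space
begin

lemma indep_vars_reindex:
  assumes e: "inj_on e I" and indep: "indep_vars M' X (e ` I)"
  shows "indep_vars (\<lambda>i. M' (e i)) (\<lambda>i. X (e i)) I"
proof -
  define F where "F k = {X k -` A \<inter> space M | A. A \<in> sets (M' k)}" for k
  have rv: "\<And>k. k \<in> e ` I \<Longrightarrow> random_variable (M' k) (X k)" and ind: "indep_sets F (e ` I)"
    using indep by (auto simp: indep_vars_def2 F_def[abs_def])
  have "indep_sets (\<lambda>i. F (e i)) I"
  proof (rule indep_setsI)
    show "F (e i) \<subseteq> events" if "i \<in> I" for i
      using ind that by (auto simp: indep_sets_def)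
    fix A J assume J: "J \<noteq> {}" "J \<subseteq> I" "finite J" "\<forall>j\<in>J. A j \<in> F (e j)"
    have eJ: "inj_on e J" using e J(2) by (rule inj_on_subset)
    define B where "B k = A (inv_into J e k)" for k
    have B: "B (e j) = A j" if "j \<in> J" for j using that eJ by (simp add: B_def)
    have "prob (\<Inter>k\<in>e ` J. B k) = (\<Prod>k\<in>e ` J. prob (B k))"
      using J B by (intro indep_setsD[OF ind]) auto
    then show "prob (\<Inter>j\<in>J. A j) = (\<Prod>j\<in>J. prob (A j))"
      using B eJ by (simp add: prod.reindex)
  qed
  then show ?thesis using rv by (auto simp: indep_vars_def2 F_def)
qed

text \<open>Where the permutations differ, injectivity of \<open>p\<close> gives the linear tie
  equation a nonzero coefficient. Its projection of that observation has no atoms, by absolute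
  continuity, and is independent of the remaining sum.\<close>

lemma assignment_no_ties:
  fixes W :: "nat \<Rightarrow> 'a \<Rightarrow> real ^ 'd"
  assumes indep: "indep_vars (\<lambda>_. borel) W UNIV" and law: "\<And>i. distr M borel (W i) = \<mu>"
    and \<mu>: "\<mu> \<in> P_ac" and inj: "inj_on p {..<N}"
    and \<sigma>: "\<sigma> permutes {..<N}" and \<rho>: "\<rho> permutes {..<N}" and ne: "\<sigma> \<noteq> \<rho>"
  shows "AE \<omega> in M. assignment_cost N p (\<lambda>i. W i \<omega>) \<sigma> \<noteq> assignment_cost N p (\<lambda>i. W i \<omega>) \<rho>"
proof -
  obtain i0 where i0: "i0 < N" "\<sigma> i0 \<noteq> \<rho> i0" using permutes_neq_witness[OF \<sigma> \<rho> ne] by blast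
  define v where "v i = p (\<sigma> i) - p (\<rho> i)" for i
  have "\<sigma> i0 < N" "\<rho> i0 < N"
    using permutes_in_image[OF \<sigma>, of i0] permutes_in_image[OF \<rho>, of i0] i0 by auto
  then have v0: "v i0 \<noteq> 0" using inj i0 by (auto simp: v_def inj_on_def)
  have W [measurable]: "random_variable borel (W i)" for i
    using indep by (auto simp: indep_vars_def)
  let ?X = "\<lambda>i \<omega>. W i \<omega> \<bullet> v i"
  have ins: "insert i0 ({..<N} - {i0}) = {..<N}" using i0 by auto
  have "indep_vars (\<lambda>_. borel) ?X (insert i0 ({..<N} - {i0}))"
    by (rule indep_vars_compose2[OF indep_vars_subset[OF indep], of _ "\<lambda>i x. x \<bullet> v i" "\<lambda>_. borel"]) auto
  then have "indep_var borel (?X i0) borel (\<lambda>\<omega>. \<Sum>i\<in>{..<N} - {i0}. ?X i \<omega>)"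
    by (intro indep_vars_sum) auto
  moreover have "emeasure (distr M borel (?X i0)) {c} = 0" for c
  proof -
    have "emeasure (distr M borel (?X i0)) {c} = emeasure M ((\<lambda>\<omega>. W i0 \<omega>) -` {x. x \<bullet> v i0 = c} \<inter> space M)"
      by (subst emeasure_distr) (auto intro!: arg_cong2[where f = emeasure])
    also have "\<dots> = emeasure \<mu> {x. x \<bullet> v i0 = c}"
      unfolding law[of i0, symmetric] by (subst emeasure_distr) auto
    also have "\<dots> = 0" by (rule absolutely_continuous_hyperplane[OF \<mu> v0])
    finally show ?thesis .
  qed
  ultimately have "AE \<omega> in M. ?X i0 \<omega> + (\<Sum>i\<in>{..<N} - {i0}. ?X i \<omega>) \<noteq> 0"
    by (rule prob_sum_eq_zero_if_no_atoms)
  then show ?thesis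
  proof eventually_elim
    case (elim \<omega>)
    have "(\<Sum>i<N. ?X i \<omega>) \<noteq> 0"
      using elim i0 by (simp add: sum.remove[of "{..<N}" i0])
    then show ?case
      using assignment_cost_diff[OF \<sigma> \<rho>, of p "\<lambda>i. W i \<omega>"] by (auto simp: v_def)
  qed
qed

text \<open>Relabelling by \<open>\<pi>\<close> moves one event into the other for the relabelled
  sample, which has the same product law. Permutations are invertible, so the inequality suffices
  for equality.\<close>

lemma unique_optimum_prob_le:
  fixes W :: "nat \<Rightarrow> 'a \<Rightarrow> real ^ 'd"
  assumes indep: "indep_vars (\<lambda>_. borel) W UNIV" and law: "\<And>i. distr M borel (W i) = \<mu>"
    and \<pi>: "\<pi> permutes {..<N}"
  shows "prob {\<omega>\<in>space M. unique_optimum N p \<sigma> (\<lambda>i. W i \<omega>)} \<le>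
    prob {\<omega>\<in>space M. unique_optimum N p (\<sigma> \<circ> \<pi>) (\<lambda>i. W i \<omega>)}"
proof (cases "N = 0")
  case True
  then show ?thesis using \<pi> by simp
next
  case False
  let ?I = "{..<N}"
  let ?Pr = "PiM ?I (\<lambda>_. borel :: (real ^ 'd) measure)"
  have ne: "?I \<noteq> {}" using False by auto
  have W [measurable]: "random_variable borel (W i)" for i
    using indep by (auto simp: indep_vars_def)
  define S where "S = {w \<in> space ?Pr. unique_optimum N p (\<sigma> \<circ> \<pi>) w}"
  have S: "S \<in> sets ?Pr"
    unfolding S_def using unique_optimum_sets[of N "\<lambda>i w. w i" ?Pr] by simp
  have restrict: "unique_optimum N p \<tau> (restrict w ?I) \<longleftrightarrow> unique_optimum N p \<tau> w" for \<tau> w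
    by (simp add: unique_optimum_def assignment_cost_def)
  have prS: "prob {\<omega>\<in>space M. unique_optimum N p (\<sigma> \<circ> \<pi>) (\<lambda>i. V i \<omega>)} = measure (PiM ?I (\<lambda>_. \<mu>)) S"
    if V: "indep_vars (\<lambda>_. borel) V ?I" "\<And>i. i \<in> ?I \<Longrightarrow> distr M borel (V i) = \<mu>" for V :: "nat \<Rightarrow> 'a \<Rightarrow> real ^ 'd"
  proof -
    have rv: "random_variable borel (V i)" if "i \<in> ?I" for i
      using V that by (auto simp: indep_vars_def)
    have "PiM ?I (\<lambda>_. \<mu>) = PiM ?I (\<lambda>i. distr M borel (V i))"
      by (intro PiM_cong) (auto simp: V(2))
    also have "\<dots> = distr M ?Pr (\<lambda>\<omega>. \<lambda>i\<in>?I. V i \<omega>)"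
      using indep_vars_iff_distr_eq_PiM'[OF ne, of V "\<lambda>_. borel"] rv V(1) by auto
    finally have "measure (PiM ?I (\<lambda>_. \<mu>)) S = measure (distr M ?Pr (\<lambda>\<omega>. \<lambda>i\<in>?I. V i \<omega>)) S" by simp
    also have "\<dots> = prob ((\<lambda>\<omega>. \<lambda>i\<in>?I. V i \<omega>) -` S \<inter> space M)"
      by (rule measure_distr[OF _ S]) (intro measurable_restrict rv)
    also have "(\<lambda>\<omega>. \<lambda>i\<in>?I. V i \<omega>) -` S \<inter> space M = {\<omega>\<in>space M. unique_optimum N p (\<sigma> \<circ> \<pi>) (\<lambda>i. V i \<omega>)}"
      by (auto simp: S_def restrict space_PiM)
    finally show ?thesis by simp
  qed
  have "prob {\<omega>\<in>space M. unique_optimum N p \<sigma> (\<lambda>i. W i \<omega>)} \<le>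
      prob {\<omega>\<in>space M. unique_optimum N p (\<sigma> \<circ> \<pi>) (\<lambda>i. W (\<pi> i) \<omega>)}"
  proof (rule finite_measure_mono)
    show "{\<omega>\<in>space M. unique_optimum N p \<sigma> (\<lambda>i. W i \<omega>)} \<subseteq> {\<omega>\<in>space M. unique_optimum N p (\<sigma> \<circ> \<pi>) (\<lambda>i. W (\<pi> i) \<omega>)}"
      using unique_optimum_compose[OF \<pi>] by (auto simp: o_def)
    show "{\<omega>\<in>space M. unique_optimum N p (\<sigma> \<circ> \<pi>) (\<lambda>i. W (\<pi> i) \<omega>)} \<in> events"
      by (rule unique_optimum_sets) simp
  qed
  also have "\<dots> = measure (PiM ?I (\<lambda>_. \<mu>)) S"
  proof (rule prS)
    show "indep_vars (\<lambda>_. borel) (\<lambda>i. W (\<pi> i)) ?I"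
      using indep_vars_reindex[OF permutes_inj_on[OF \<pi>] indep_vars_subset[OF indep], of ?I] by simp
  qed (simp add: law)
  also have "\<dots> = prob {\<omega>\<in>space M. unique_optimum N p (\<sigma> \<circ> \<pi>) (\<lambda>i. W i \<omega>)}"
    by (rule prS[symmetric]) (auto simp: law intro: indep_vars_subset[OF indep])
  finally show ?thesis .
qed

text \<open>Almost surely exactly one permutation is the strict optimum. These events have a common
  probability \<open>q\<close>, and the constant function 1 shows that \<open>q\<close> is
  \<open>1 / fact N\<close>.\<close>

lemma expectation_opt_perm:
  fixes W :: "nat \<Rightarrow> 'a \<Rightarrow> real ^ 'd"
  assumes indep: "indep_vars (\<lambda>_. borel) W UNIV" and law: "\<And>i. distr M borel (W i) = \<mu>"
    and \<mu>: "\<mu> \<in> P_ac" and inj: "inj_on p {..<N}"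
  shows "expectation (\<lambda>\<omega>. f (opt_perm N p (\<lambda>i. W i \<omega>))) = perm_avg N f"
proof -
  let ?S = "{\<sigma>. \<sigma> permutes {..<N}}"
  define E where "E \<sigma> = {\<omega>\<in>space M. unique_optimum N p \<sigma> (\<lambda>i. W i \<omega>)}" for \<sigma>
  define q where "q = prob (E id)"
  have W [measurable]: "random_variable borel (W i)" for i
    using indep by (auto simp: indep_vars_def)
  have E_sets [measurable]: "E \<sigma> \<in> events" for \<sigma>
    unfolding E_def by (rule unique_optimum_sets) simp
  have q: "prob (E \<sigma>) = q" if \<sigma>: "\<sigma> permutes {..<N}" for \<sigma>
  proof (rule antisym)
    show "prob (E \<sigma>) \<le> q"
      using unique_optimum_prob_le[OF indep law permutes_inv[OF \<sigma>], of p \<sigma>]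
      by (simp add: E_def q_def permutes_inv_o[OF \<sigma>])
    show "q \<le> prob (E \<sigma>)"
      using unique_optimum_prob_le[OF indep law \<sigma>, of p id] by (simp add: E_def q_def)
  qed
  have "AE \<omega> in M. \<forall>\<sigma>\<in>?S. \<forall>\<rho>\<in>?S. \<sigma> \<noteq> \<rho> \<longrightarrow>
      assignment_cost N p (\<lambda>i. W i \<omega>) \<sigma> \<noteq> assignment_cost N p (\<lambda>i. W i \<omega>) \<rho>"
    using assignment_no_ties[OF indep law \<mu> inj]
    by (intro AE_finite_allI finite_perms AE_impI) auto
  then have split: "AE \<omega> in M. g (opt_perm N p (\<lambda>i. W i \<omega>)) = (\<Sum>\<sigma>\<in>?S. g \<sigma> * indicator (E \<sigma>) \<omega>)" for g :: "_ \<Rightarrow> real"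
    using AE_space
  proof eventually_elim
    case (elim \<omega>)
    let ?w = "\<lambda>i. W i \<omega>"
    let ?o = "opt_perm N p ?w"
    have o: "?o permutes {..<N}" by (rule opt_perm_permutes)
    have "unique_optimum N p ?o ?w"
      unfolding unique_optimum_def
    proof (intro allI impI)
      fix \<rho> assume "\<rho> permutes {..<N}" "\<rho> \<noteq> ?o"
      then show "assignment_cost N p ?w ?o < assignment_cost N p ?w \<rho>"
        using elim(1) o opt_perm_minimal[of \<rho> N p ?w] by (auto simp: less_le)
    qed
    then have "\<omega> \<in> E \<sigma> \<longleftrightarrow> \<sigma> = ?o" if "\<sigma> \<in> ?S" for \<sigma>
      using elim(2) that opt_perm_unique_optimum[of N p \<sigma> ?w] by (auto simp: E_def)
    then have "(\<Sum>\<sigma>\<in>?S. g \<sigma> * indicator (E \<sigma>) \<omega>) = (\<Sum>\<sigma>\<in>?S. if \<sigma> = ?o then g \<sigma> else 0)"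
      by (intro sum.cong refl) (auto simp: indicator_def)
    also have "\<dots> = g ?o" using o by (simp add: finite_perms)
    finally show ?case by simp
  qed
  have mean: "expectation (\<lambda>\<omega>. g (opt_perm N p (\<lambda>i. W i \<omega>))) = (\<Sum>\<sigma>\<in>?S. g \<sigma>) * q" for g
  proof -
    have "expectation (\<lambda>\<omega>. g (opt_perm N p (\<lambda>i. W i \<omega>))) = expectation (\<lambda>\<omega>. \<Sum>\<sigma>\<in>?S. g \<sigma> * indicator (E \<sigma>) \<omega>)"
      by (intro integral_cong_AE opt_perm_measurable split) auto
    also have "\<dots> = (\<Sum>\<sigma>\<in>?S. g \<sigma> * prob (E \<sigma>))"
      by (subst Bochner_Integration.integral_sum) (auto simp: less_top[symmetric])
    also have "\<dots> = (\<Sum>\<sigma>\<in>?S. g \<sigma>) * q" by (simp add: q sum_distrib_right)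
    finally show ?thesis .
  qed
  have "1 = real (card ?S) * q" using mean[of "\<lambda>_. 1"] by (simp add: prob_space)
  then have "q = 1 / fact N" by (simp add: card_permutations field_simps)
  then show ?thesis using mean[of f] by (simp add: perm_avg_def)
qed

end

section \<open>Limits of the truncated statistic\<close>

lemma integral_empirical:
  fixes g :: "real ^ 'd \<Rightarrow> real"
  assumes "g \<in> borel_measurable borel"
  shows "(\<integral>x. g x \<partial>empirical N p) = (\<Sum>a<N. g (p a)) / real N"
proof -
  have "(\<integral>x. g x \<partial>empirical N p) = (\<integral>a. g (p a) \<partial>uniform_count_measure {..<N})"
    unfolding empirical_def using assms by (intro integral_distr) (auto simp: uniform_count_measure_def)
  also have "\<dots> = (\<Sum>a<N. g (p a)) / real N" by (simp add: integral_uniform_count_measure)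
  finally show ?thesis .
qed

lemma reference_points_tendsto:
  fixes g :: "real ^ 'd \<Rightarrow> real"
  assumes h: "reference_points h" and g: "continuous_on UNIV g" "bounded (range g)"
  shows "((\<lambda>(m, n). (\<Sum>a<m + n. g (h (m + n) a)) / real (m + n)) \<longlongrightarrow> (\<integral>x. g x \<partial>unif_cube)) min_at_top"
proof -
  have "((\<lambda>i. \<integral>x. g x \<partial>(case i of (m, n) \<Rightarrow> empirical (m + n) (h (m + n)))) \<longlongrightarrow> (\<integral>x. g x \<partial>unif_cube)) min_at_top"
    using h g unfolding reference_points_def weakly_converges_def by blast
  moreover have "(\<integral>x. g x \<partial>(case i of (m, n) \<Rightarrow> empirical (m + n) (h (m + n)))) =
      (case i of (m, n) \<Rightarrow> (\<Sum>a<m + n. g (h (m + n) a)) / real (m + n))" for i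
    using integral_empirical[OF borel_measurable_continuous_onI[OF g(1)]] by (simp add: case_prod_unfold)
  ultimately show ?thesis by simp
qed

lemma filterlim_min_at_top: "filterlim fst at_top min_at_top" "filterlim snd at_top min_at_top"
  unfolding filterlim_at_top by (auto intro: eventually_mono[OF eventually_min_at_top])

text \<open>Weak convergence is used for \<open>g\<close> and its square, which gives the limit of
  the variance over the reference points. The bound on the Stein error involves the points only
  through \<open>G\<close>.\<close>

lemma contrast_char_limit:
  fixes g :: "real ^ 'd \<Rightarrow> real"
  assumes h: "reference_points h" and g: "continuous_on UNIV g" "bounded (range g)"
  shows "((\<lambda>(m, n). perm_avg (m + n) (\<lambda>\<sigma>. cos (contrast m n (\<lambda>a. g (h (m + n) a)) \<sigma>))) \<longlongrightarrow>
    exp (- ((\<integral>x. (g x)\<^sup>2 \<partial>unif_cube) - (\<integral>x. g x \<partial>unif_cube)\<^sup>2) / 2)) min_at_top"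
proof -
  obtain G where G: "\<forall>x\<in>range g. norm x \<le> G" using g(2) unfolding bounded_iff by blast
  then have Gb: "\<bar>g x\<bar> \<le> G" for x by auto
  then have G0: "0 \<le> G" using abs_ge_zero order_trans by blast
  have "bounded (range (\<lambda>x. (g x)\<^sup>2))"
    unfolding bounded_iff using Gb by (intro exI[of _ "G\<^sup>2"]) (auto simp: abs_le_square_iff[symmetric] G0)
  then have sq: "((\<lambda>(m, n). (\<Sum>a<m + n. (g (h (m + n) a))\<^sup>2) / real (m + n)) \<longlongrightarrow> (\<integral>x. (g x)\<^sup>2 \<partial>unif_cube)) min_at_top"
    by (intro reference_points_tendsto[OF h]) (auto intro!: continuous_intros g)
  define v where "v = (\<lambda>(m, n). (\<Sum>a<m + n. (g (h (m + n) a))\<^sup>2) / real (m + n) -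
      ((\<Sum>a<m + n. g (h (m + n) a)) / real (m + n))\<^sup>2)"
  have "(v \<longlongrightarrow> (\<integral>x. (g x)\<^sup>2 \<partial>unif_cube) - (\<integral>x. g x \<partial>unif_cube)\<^sup>2) min_at_top"
    using tendsto_diff[OF sq tendsto_power[OF reference_points_tendsto[OF h g], of 2]]
    by (simp add: v_def case_prod_unfold)
  then have "((\<lambda>i. exp (- v i / 2)) \<longlongrightarrow>
      exp (- ((\<integral>x. (g x)\<^sup>2 \<partial>unif_cube) - (\<integral>x. g x \<partial>unif_cube)\<^sup>2) / 2)) min_at_top"
    by (intro tendsto_intros) simp_all
  moreover
  define E where "E = (\<lambda>(m, n). perm_avg (m + n) (\<lambda>\<sigma>. cos (contrast m n (\<lambda>a. g (h (m + n) a)) \<sigma>)))"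
  define C where "C = 1 / 2 + G + 4 * G ^ 3 + G ^ 4"
  have "((\<lambda>i. E i - exp (- v i / 2)) \<longlongrightarrow> 0) min_at_top"
  proof (rule Lim_null_comparison)
    have "((\<lambda>i. sqrt (1 / real (fst i) + 1 / real (snd i)) * C) \<longlongrightarrow> sqrt (0 + 0) * C) min_at_top"
      by (intro tendsto_intros filterlim_compose[OF lim_1_over_n filterlim_min_at_top(1)]
          filterlim_compose[OF lim_1_over_n filterlim_min_at_top(2)])
    then show "((\<lambda>i. sqrt (1 / real (fst i) + 1 / real (snd i)) * C) \<longlongrightarrow> 0) min_at_top" by simp
    have "\<forall>\<^sub>F i in min_at_top. 1 \<le> fst i \<and> 1 \<le> snd i"
      using eventually_min_at_top[of 1] by (simp add: case_prod_unfold)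
    then show "\<forall>\<^sub>F i in min_at_top. norm (E i - exp (- v i / 2)) \<le> sqrt (1 / real (fst i) + 1 / real (snd i)) * C"
    proof eventually_elim
      case (elim i)
      then show ?case
        using contrast_char_fun[of "fst i" "snd i" "\<lambda>a. g (h (fst i + snd i) a)" G] Gb G0
        by (simp add: E_def v_def C_def case_prod_unfold)
    qed
  qed
  ultimately have "((\<lambda>i. E i - exp (- v i / 2) + exp (- v i / 2)) \<longlongrightarrow>
      0 + exp (- ((\<integral>x. (g x)\<^sup>2 \<partial>unif_cube) - (\<integral>x. g x \<partial>unif_cube)\<^sup>2) / 2)) min_at_top"
    by (intro tendsto_add)
  then show ?thesis by (simp add: E_def)
qed

section \<open>Feature covariances under the uniform law and Gaussian linearisation\<close>

lemma prob_space_unif_cube: "prob_space (unif_cube :: (real ^ 'd) measure)"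
  unfolding unif_cube_def
proof (rule prob_space_uniform_measure)
  have 1: "(0::real ^ 'd) \<bullet> b \<le> 1 \<bullet> b" if "b \<in> Basis" for b
    using that by (auto simp: Basis_vec_def inner_axis)
  have "(1::real ^ 'd) \<bullet> b = 1" if "b \<in> Basis" for b
    using that by (auto simp: Basis_vec_def inner_axis)
  then have "emeasure lborel (cbox 0 (1::real ^ 'd)) = 1"
    using 1 by (simp add: emeasure_lborel_cbox_eq)
  then show "emeasure lborel (cbox 0 (1::real ^ 'd)) \<noteq> 0" "emeasure lborel (cbox 0 (1::real ^ 'd)) \<noteq> \<infinity>"
    by simp_all
qed

lemma AE_unif_cube: "AE x in unif_cube. x \<in> cbox 0 (1::real ^ 'd)"
  unfolding unif_cube_def by (rule AE_uniform_measureI) auto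

lemma sets_unif_cube: "sets unif_cube = sets borel"
  by (simp add: unif_cube_def)

definition cube_cov :: "(real ^ 'd \<Rightarrow> real) \<Rightarrow> (real ^ 'd \<Rightarrow> real) \<Rightarrow> real" where
  "cube_cov f g = (\<integral>x. f x * g x \<partial>unif_cube) - (\<integral>x. f x \<partial>unif_cube) * (\<integral>x. g x \<partial>unif_cube)"

context distance_features
begin

lemma features_bound: obtains G where "\<And>x. \<bar>f l x\<bar> \<le> G"
proof -
  obtain G where "\<forall>x\<in>range (f l). norm x \<le> G" using bdd[of l] unfolding bounded_iff by blast
  then have "\<bar>f l x\<bar> \<le> G" for x by auto
  then show ?thesis by (rule that)
qed

lemma features_integrable: "integrable unif_cube (f l)"
proof -
  obtain G where "\<And>x. \<bar>f l x\<bar> \<le> G" using features_bound by blast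
  then show ?thesis
    by (rule bounded_continuous_integrable[OF prob_space_unif_cube sets_unif_cube cont])
qed

lemma features_prod_integrable: "integrable unif_cube (\<lambda>x. f l x * f k x)"
proof -
  obtain G where G: "\<And>x. \<bar>f l x\<bar> \<le> G" using features_bound by blast
  obtain H where H: "\<And>x. \<bar>f k x\<bar> \<le> H" using features_bound by blast
  show ?thesis
  proof (rule bounded_continuous_integrable[OF prob_space_unif_cube sets_unif_cube])
    show "continuous_on UNIV (\<lambda>x. f l x * f k x)" by (intro continuous_intros cont)
    show "\<bar>f l x * f k x\<bar> \<le> G * H" for x
      unfolding abs_mult by (intro mult_mono G H order_trans[OF abs_ge_zero G]) auto
  qed
qed

lemma cube_var_sum:
  "(\<integral>x. (\<Sum>l<L. c l * f l x)\<^sup>2 \<partial>unif_cube) - (\<integral>x. (\<Sum>l<L. c l * f l x) \<partial>unif_cube)\<^sup>2 =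
    (\<Sum>l<L. \<Sum>k<L. c l * c k * cube_cov (f l) (f k))"
proof -
  have "(\<integral>x. (\<Sum>l<L. c l * f l x)\<^sup>2 \<partial>unif_cube) = (\<integral>x. (\<Sum>l<L. \<Sum>k<L. c l * c k * (f l x * f k x)) \<partial>unif_cube)"
    by (simp add: power2_eq_square sum_product mult_ac)
  also have "\<dots> = (\<Sum>l<L. \<Sum>k<L. c l * c k * (\<integral>x. f l x * f k x \<partial>unif_cube))"
    by (simp add: features_prod_integrable)
  finally have 1: "(\<integral>x. (\<Sum>l<L. c l * f l x)\<^sup>2 \<partial>unif_cube) = (\<Sum>l<L. \<Sum>k<L. c l * c k * (\<integral>x. f l x * f k x \<partial>unif_cube))" .
  have "(\<integral>x. (\<Sum>l<L. c l * f l x) \<partial>unif_cube) = (\<Sum>l<L. c l * (\<integral>x. f l x \<partial>unif_cube))"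
    by (simp add: features_integrable)
  then have 2: "(\<integral>x. (\<Sum>l<L. c l * f l x) \<partial>unif_cube)\<^sup>2 =
      (\<Sum>l<L. \<Sum>k<L. c l * c k * ((\<integral>x. f l x \<partial>unif_cube) * (\<integral>x. f k x \<partial>unif_cube)))"
    by (simp add: power2_eq_square sum_product mult_ac)
  show ?thesis unfolding 1 2 cube_cov_def by (simp add: right_diff_distrib sum_subtractf)
qed

lemma features_sum_cont_bdd:
  "continuous_on UNIV (\<lambda>x. \<Sum>l<L. c l * f l x)" "bounded (range (\<lambda>x. \<Sum>l<L. c l * f l x))"
proof -
  show "continuous_on UNIV (\<lambda>x. \<Sum>l<L. c l * f l x)" by (intro continuous_intros cont)
  have "\<forall>l. \<exists>G. \<forall>x. \<bar>f l x\<bar> \<le> G"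
  proof
    fix l
    obtain G where "\<And>x. \<bar>f l x\<bar> \<le> G" using features_bound[of l] by blast
    then show "\<exists>G. \<forall>x. \<bar>f l x\<bar> \<le> G" by blast
  qed
  then have "\<exists>G. \<forall>l x. \<bar>f l x\<bar> \<le> G l" by (rule choice)
  then obtain G where G: "\<And>l x. \<bar>f l x\<bar> \<le> G l" by blast
  have "\<bar>\<Sum>l<L. c l * f l x\<bar> \<le> (\<Sum>l<L. \<bar>c l\<bar> * G l)" for x
    by (intro order_trans[OF sum_abs] sum_mono) (simp add: abs_mult mult_left_mono G)
  then show "bounded (range (\<lambda>x. \<Sum>l<L. c l * f l x))" unfolding bounded_iff by auto
qed

lemma psd_matrix_cube_cov: "psd_matrix L (\<lambda>l k. cube_cov (f l) (f k))"
  unfolding psd_matrix_def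
proof (intro conjI allI)
  show "cube_cov (f l) (f k) = cube_cov (f k) (f l)" for l k by (simp add: cube_cov_def mult_ac)
next
  fix u
  interpret prob_space unif_cube by (rule prob_space_unif_cube)
  let ?g = "\<lambda>x. \<Sum>l<L. u l * f l x"
  have "integrable unif_cube (\<lambda>x. (?g x)\<^sup>2)"
    by (simp add: power2_eq_square sum_product mult_ac)
      (auto intro!: integrable_mult_right features_prod_integrable simp: mult.left_commute)
  moreover have "integrable unif_cube ?g" by (auto intro!: integrable_mult_right features_integrable)
  ultimately have "expectation (\<lambda>x. (?g x)\<^sup>2) - (expectation ?g)\<^sup>2 = variance ?g"
    by (intro variance_eq[symmetric])
  also have "\<dots> \<ge> 0" by (rule variance_positive)
  finally have "0 \<le> (\<Sum>l<L. \<Sum>k<L. u l * u k * cube_cov (f l) (f k))" unfolding cube_var_sum .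
  then show "0 \<le> dotp L u (mat_app L (\<lambda>l k. cube_cov (f l) (f k)) u)"
    by (simp add: dotp_def mat_app_def sum_distrib_left mult_ac)
qed

text \<open>The Gaussian integral over \<open>P\<close> linearises the quadratic statistic, so the one-dimensional
  limit theorem suffices.\<close>

lemma contrast_laplace_limit:
  assumes h: "reference_points h" and Z: "iid_std_normal P Z" and t: "0 \<le> t"
  shows "((\<lambda>(m, n). perm_avg (m + n) (\<lambda>\<sigma>. exp (- t * (\<Sum>l<L. (contrast m n (\<lambda>a. f l (h (m + n) a)) \<sigma>)\<^sup>2)))) \<longlongrightarrow>
    (\<integral>\<omega>. exp (- t * (\<Sum>l<L. \<Sum>k<L. Z l \<omega> * Z k \<omega> * cube_cov (f l) (f k))) \<partial>P)) min_at_top"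
proof (rule tendsto_min_at_topI)
  let ?Q = "\<lambda>\<omega>. \<Sum>l<L. \<Sum>k<L. Z l \<omega> * Z k \<omega> * cube_cov (f l) (f k)"
  fix a assume a: "filterlim a min_at_top sequentially"
  interpret P: prob_space P using Z by (simp add: iid_std_normal_def)
  note [measurable] = iid_std_normal_measurable[OF Z]
  \<comment> \<open>With this scale the Gaussian mean of the cosine is exactly
    \<open>exp (- t * (\<Sum>l<L. (W i l \<sigma>)\<^sup>2))\<close>.\<close>
  define r where "r = sqrt (2 * t)"
  have r2: "r\<^sup>2 = 2 * t" using t by (simp add: r_def)
  define W where "W = (\<lambda>(m, n) l. contrast m n (\<lambda>a. f l (h (m + n) a)))"
  define N where "N = (\<lambda>(m, n). m + n :: nat)"
  \<comment> \<open>For fixed \<open>\<omega>\<close> the argument of the cosine is a single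
    contrast, that of the feature combination with coefficients
    \<open>r * Z l \<omega>\<close>.\<close>
  define U where "U i \<omega> = perm_avg (N i) (\<lambda>\<sigma>. cos (\<Sum>l<L. (r * Z l \<omega>) * W i l \<sigma>))" for i \<omega>
  have U_meas [measurable]: "U i \<in> borel_measurable P" for i
    unfolding U_def perm_avg_def by measurable
  have U_le: "\<bar>U i \<omega>\<bar> \<le> 1" for i \<omega>
    unfolding U_def using order_trans[OF perm_avg_abs perm_avg_mono[of "N i" _ "\<lambda>_. 1"]] by simp
  have U_int: "(\<integral>\<omega>. U i \<omega> \<partial>P) = perm_avg (N i) (\<lambda>\<sigma>. exp (- t * (\<Sum>l<L. (W i l \<sigma>)\<^sup>2)))" for i
  proof -
    have "integrable P (\<lambda>\<omega>. cos (\<Sum>l<L. (r * Z l \<omega>) * W i l \<sigma>))" for \<sigma>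
      by (rule P.integrable_const_bound[of _ 1]) auto
    then have 1: "(\<integral>\<omega>. U i \<omega> \<partial>P) = perm_avg (N i) (\<lambda>\<sigma>. \<integral>\<omega>. cos (\<Sum>l<L. (r * Z l \<omega>) * W i l \<sigma>) \<partial>P)"
      unfolding U_def perm_avg_def by simp
    have 2: "(\<integral>\<omega>. cos (\<Sum>l<L. (r * Z l \<omega>) * W i l \<sigma>) \<partial>P) = exp (- t * (\<Sum>l<L. (W i l \<sigma>)\<^sup>2))" for \<sigma>
    proof -
      have "(\<integral>\<omega>. cos (\<Sum>l<L. (r * Z l \<omega>) * W i l \<sigma>) \<partial>P) = (\<integral>\<omega>. cos (\<Sum>l<L. (r * W i l \<sigma>) * Z l \<omega>) \<partial>P)"
        by (simp add: mult_ac)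
      also have "\<dots> = exp (- (\<Sum>l<L. (r * W i l \<sigma>)\<^sup>2) / 2)" by (rule iid_std_normal_char[OF Z])
      also have "(\<Sum>l<L. (r * W i l \<sigma>)\<^sup>2) = 2 * t * (\<Sum>l<L. (W i l \<sigma>)\<^sup>2)"
        by (simp add: power_mult_distrib r2 sum_distrib_left)
      finally show ?thesis by simp
    qed
    show ?thesis unfolding 1 2 ..
  qed
  have U_lim: "(\<lambda>k. U (a k) \<omega>) \<longlonglongrightarrow> exp (- t * ?Q \<omega>)" for \<omega>
  proof -
    let ?c = "\<lambda>l. r * Z l \<omega>"
    have "((\<lambda>(m, n). perm_avg (m + n) (\<lambda>\<sigma>. cos (contrast m n (\<lambda>a. \<Sum>l<L. ?c l * f l (h (m + n) a)) \<sigma>))) \<longlongrightarrow>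
      exp (- (\<Sum>l<L. \<Sum>k<L. ?c l * ?c k * cube_cov (f l) (f k)) / 2)) min_at_top"
      using contrast_char_limit[OF h features_sum_cont_bdd[of ?c L]] unfolding cube_var_sum .
    moreover have "(\<Sum>l<L. \<Sum>k<L. ?c l * ?c k * cube_cov (f l) (f k)) =
        2 * t * ?Q \<omega>"
    proof -
      have "?c l * ?c k * cube_cov (f l) (f k) = 2 * t * (Z l \<omega> * Z k \<omega> * cube_cov (f l) (f k))" for l k
        unfolding r2[symmetric] power2_eq_square by (simp only: mult_ac)
      then show ?thesis by (simp only: sum_distrib_left)
    qed
    moreover have "(\<lambda>(m, n). perm_avg (m + n) (\<lambda>\<sigma>. cos (contrast m n (\<lambda>a. \<Sum>l<L. ?c l * f l (h (m + n) a)) \<sigma>))) =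
        (\<lambda>i. U i \<omega>)"
      by (simp add: U_def W_def N_def contrast_sum case_prod_unfold fun_eq_iff)
    ultimately have "((\<lambda>i. U i \<omega>) \<longlongrightarrow> exp (- t * ?Q \<omega>)) min_at_top"
      by simp
    then show ?thesis using a by (rule filterlim_compose)
  qed
  have "(\<lambda>k. \<integral>\<omega>. U (a k) \<omega> \<partial>P) \<longlonglongrightarrow>
      (\<integral>\<omega>. exp (- t * ?Q \<omega>) \<partial>P)"
  proof (rule integral_dominated_convergence[where w = "\<lambda>_. 1"])
    show "AE \<omega> in P. (\<lambda>k. U (a k) \<omega>) \<longlonglongrightarrow>
        exp (- t * ?Q \<omega>)"
      by (intro AE_I2 U_lim)
    show "AE \<omega> in P. norm (U (a k) \<omega>) \<le> 1" for k by (intro AE_I2) (simp add: U_le)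
  qed measurable
  then show "(\<lambda>k. case a k of (m, n) \<Rightarrow> perm_avg (m + n)
      (\<lambda>\<sigma>. exp (- t * (\<Sum>l<L. (contrast m n (\<lambda>a. f l (h (m + n) a)) \<sigma>)\<^sup>2)))) \<longlonglongrightarrow>
      (\<integral>\<omega>. exp (- t * ?Q \<omega>) \<partial>P)"
    unfolding U_int by (simp add: W_def N_def case_prod_unfold)
qed

end

text \<open>The transposition identity takes the place of rotation invariance of the Gaussian
  vector. With the matrix \<open>B\<close> of the proof, the product of its transpose with
  \<open>B\<close> is \<open>2 * t * A\<close>, while the product in the other order is diagonal
  with entries \<open>2 * t * \<tau> j\<close>.\<close>

lemma quadratic_form_diagonalise:
  assumes Z: "iid_std_normal P Z" and t: "0 \<le> t"
    and \<tau>0: "\<And>j. 0 \<le> \<tau> j"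
    and dec: "\<And>l k. l < L \<Longrightarrow> k < L \<Longrightarrow> A l k = (\<Sum>j<L. \<tau> j * v j l * v j k)"
    and orth: "\<And>i j. i < L \<Longrightarrow> j < L \<Longrightarrow> i \<noteq> j \<Longrightarrow> dotp L (v i) (v j) = 0"
    and unit: "\<And>j. j < L \<Longrightarrow> dotp L (v j) (v j) = (if \<tau> j = 0 then 0 else 1)"
  shows "(\<integral>\<omega>. exp (- t * (\<Sum>l<L. \<Sum>k<L. Z l \<omega> * Z k \<omega> * A l k)) \<partial>P) =
    (\<integral>\<omega>. exp (- t * (\<Sum>j<L. \<tau> j * (Z j \<omega>)\<^sup>2)) \<partial>P)"
proof -
  define B where "B j l = sqrt (2 * t * \<tau> j) * v j l" for j l
  have s2: "sqrt (2 * t * \<tau> j) * sqrt (2 * t * \<tau> j) = 2 * t * \<tau> j" for j using t \<tau>0 by simp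
  have 1: "- t * (\<Sum>l<L. \<Sum>k<L. z l * z k * A l k) = - (\<Sum>j<L. (\<Sum>l<L. B j l * z l)\<^sup>2) / 2" for z :: "nat \<Rightarrow> real"
  proof -
    have "(\<Sum>j<L. (\<Sum>l<L. B j l * z l)\<^sup>2) = (\<Sum>j<L. \<Sum>l<L. \<Sum>k<L. (B j l * z l) * (B j k * z k))"
      by (simp add: power2_eq_square sum_product)
    also have "\<dots> = (\<Sum>l<L. \<Sum>k<L. \<Sum>j<L. (B j l * z l) * (B j k * z k))"
      by (subst sum.swap, rule sum.cong[OF refl], rule sum.swap)
    also have "\<dots> = (\<Sum>l<L. \<Sum>k<L. 2 * t * (z l * z k * A l k))"
    proof (intro sum.cong refl)
      fix l k assume "l \<in> {..<L}" "k \<in> {..<L}"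
      then have "2 * t * (z l * z k * A l k) = (\<Sum>j<L. 2 * t * \<tau> j * (v j l * z l * (v j k * z k)))"
        by (simp add: dec sum_distrib_left mult_ac)
      also have "\<dots> = (\<Sum>j<L. (B j l * z l) * (B j k * z k))"
      proof (intro sum.cong refl)
        fix j
        have "(B j l * z l) * (B j k * z k) =
            (sqrt (2 * t * \<tau> j) * sqrt (2 * t * \<tau> j)) * (v j l * z l * (v j k * z k))"
          unfolding B_def by (simp only: mult_ac)
        then show "2 * t * \<tau> j * (v j l * z l * (v j k * z k)) = (B j l * z l) * (B j k * z k)"
          by (simp only: s2)
      qed
      finally show "(\<Sum>j<L. (B j l * z l) * (B j k * z k)) = 2 * t * (z l * z k * A l k)" by simp
    qed
    finally show ?thesis by (simp add: sum_distrib_left[symmetric])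
  qed
  have 2: "- (\<Sum>l<L. (\<Sum>j<L. B j l * z j)\<^sup>2) / 2 = - t * (\<Sum>j<L. \<tau> j * (z j)\<^sup>2)" for z :: "nat \<Rightarrow> real"
  proof -
    let ?s = "\<lambda>j. sqrt (2 * t * \<tau> j) * z j"
    have "(\<Sum>l<L. (\<Sum>j<L. B j l * z j)\<^sup>2) = (\<Sum>l<L. \<Sum>i<L. \<Sum>j<L. ?s i * ?s j * (v i l * v j l))"
      by (simp add: power2_eq_square sum_product B_def mult_ac)
    also have "\<dots> = (\<Sum>i<L. \<Sum>j<L. \<Sum>l<L. ?s i * ?s j * (v i l * v j l))"
      by (subst sum.swap, rule sum.cong[OF refl], rule sum.swap)
    also have "\<dots> = (\<Sum>i<L. \<Sum>j<L. ?s i * ?s j * dotp L (v i) (v j))"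
      by (simp add: dotp_def sum_distrib_left)
    also have "\<dots> = (\<Sum>i<L. \<Sum>j<L. if j = i then 2 * t * (\<tau> i * (z i)\<^sup>2) else 0)"
    proof (intro sum.cong refl)
      fix i j assume ij: "i \<in> {..<L}" "j \<in> {..<L}"
      show "?s i * ?s j * dotp L (v i) (v j) = (if j = i then 2 * t * (\<tau> i * (z i)\<^sup>2) else 0)"
      proof (cases "i = j")
        case True
        have "?s j * ?s j = 2 * t * (\<tau> j * (z j)\<^sup>2)"
        proof -
          have "?s j * ?s j = (sqrt (2 * t * \<tau> j) * sqrt (2 * t * \<tau> j)) * (z j * z j)" by (simp only: mult_ac)
          also have "\<dots> = 2 * t * \<tau> j * (z j * z j)" by (simp only: s2)
          finally show ?thesis by (simp only: power2_eq_square mult.assoc)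
        qed
        then show ?thesis using unit[of j] ij True by (simp add: unit)
      qed (use orth ij in auto)
    qed
    also have "\<dots> = 2 * t * (\<Sum>i<L. \<tau> i * (z i)\<^sup>2)" by (simp add: sum_distrib_left)
    finally show ?thesis by simp
  qed
  show ?thesis
    unfolding 1 2[symmetric] by (rule iid_std_normal_quadratic_transpose[OF Z])
qed

section \<open>The permutation statistic\<close>

definition perm_stat :: "(nat \<Rightarrow> real ^ 'd) \<Rightarrow> nat \<Rightarrow> nat \<Rightarrow> (nat \<Rightarrow> nat) \<Rightarrow> real" where
  "perm_stat p m n \<sigma> = real m * real n / real (m + n) *
    (2 / (real m * real n) * (\<Sum>i<m. \<Sum>j<n. norm (p (\<sigma> i) - p (\<sigma> (m + j))))
      - 1 / (real m)\<^sup>2 * (\<Sum>i<m. \<Sum>j<m. norm (p (\<sigma> i) - p (\<sigma> j)))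
      - 1 / (real n)\<^sup>2 * (\<Sum>i<n. \<Sum>j<n. norm (p (\<sigma> (m + i)) - p (\<sigma> (m + j)))))"

lemma RE_sq_eq_perm_stat:
  "real m * real n / real (m + n) * RE_sq p m n x y = perm_stat p m n (opt_perm (m + n) p (pooled m x y))"
  by (simp add: RE_sq_def emp_rank_def perm_stat_def Let_def)

text \<open>The statistic is linear in the kernel, which allows it to be compared with feature
  expansions. The signs are opposite to those of the energy statistic because the distance enters
  the positive definite kernel with a minus sign.\<close>

definition two_sample_form :: "('c \<Rightarrow> 'c \<Rightarrow> real) \<Rightarrow> nat \<Rightarrow> nat \<Rightarrow> (nat \<Rightarrow> 'c) \<Rightarrow> (nat \<Rightarrow> 'c) \<Rightarrow> real" where
  "two_sample_form \<kappa> m n x y = real m * real n / real (m + n) *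
    (1 / (real m)\<^sup>2 * (\<Sum>i<m. \<Sum>j<m. \<kappa> (x i) (x j)) + 1 / (real n)\<^sup>2 * (\<Sum>i<n. \<Sum>j<n. \<kappa> (y i) (y j))
      - 2 / (real m * real n) * (\<Sum>i<m. \<Sum>j<n. \<kappa> (x i) (y j)))"

lemma two_sample_form_diff:
  "two_sample_form (\<lambda>a b. \<kappa> a b - \<kappa>' a b) m n x y = two_sample_form \<kappa> m n x y - two_sample_form \<kappa>' m n x y"
  unfolding two_sample_form_def sum_subtractf by (simp only: right_diff_distrib distrib_left)

lemma two_sample_form_sum:
  fixes L :: nat
  shows
  "two_sample_form (\<lambda>a b. \<Sum>l<L. \<kappa> l a b) m n x y = (\<Sum>l<L. two_sample_form (\<kappa> l) m n x y)"
proof (induction L)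
  case 0
  then show ?case by (simp add: two_sample_form_def)
next
  case (Suc L)
  have "two_sample_form (\<lambda>a b. \<Sum>l<Suc L. \<kappa> l a b) m n x y - two_sample_form (\<lambda>a b. \<Sum>l<L. \<kappa> l a b) m n x y =
      two_sample_form (\<kappa> L) m n x y"
    by (subst two_sample_form_diff[symmetric]) simp
  then show ?case using Suc by simp
qed

text \<open>The three averages carry the weights 1, 1 and 2. As the prefactor grows, this bound is
  applied for fixed sample sizes only.\<close>

lemma two_sample_form_le:
  assumes mn: "0 < m" "0 < n"
    and b: "\<And>i j. i < m \<Longrightarrow> j < m \<Longrightarrow> \<bar>\<kappa> (x i) (x j)\<bar> \<le> B" "\<And>i j. i < n \<Longrightarrow> j < n \<Longrightarrow> \<bar>\<kappa> (y i) (y j)\<bar> \<le> B"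
      "\<And>i j. i < m \<Longrightarrow> j < n \<Longrightarrow> \<bar>\<kappa> (x i) (y j)\<bar> \<le> B"
  shows "\<bar>two_sample_form \<kappa> m n x y\<bar> \<le> real m * real n / real (m + n) * (4 * B)"
proof -
  have dbl: "\<bar>\<Sum>i<a. \<Sum>j<b. F i j\<bar> \<le> real a * real b * B" if "\<And>i j. i < a \<Longrightarrow> j < b \<Longrightarrow> \<bar>F i j\<bar> \<le> B"
    for a b :: nat and F :: "nat \<Rightarrow> nat \<Rightarrow> real"
  proof -
    have "\<bar>\<Sum>i<a. \<Sum>j<b. F i j\<bar> \<le> (\<Sum>i<a. \<Sum>j<b. B)"
      using that by (intro order_trans[OF sum_abs] sum_mono) auto
    then show ?thesis by (simp add: mult_ac)
  qed
  let ?x = "1 / (real m)\<^sup>2 * (\<Sum>i<m. \<Sum>j<m. \<kappa> (x i) (x j))"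
    and ?y = "1 / (real n)\<^sup>2 * (\<Sum>i<n. \<Sum>j<n. \<kappa> (y i) (y j))"
    and ?xy = "2 / (real m * real n) * (\<Sum>i<m. \<Sum>j<n. \<kappa> (x i) (y j))"
  have "\<bar>?x\<bar> \<le> 1 / (real m)\<^sup>2 * (real m * real m * B)"
    unfolding abs_mult using dbl[of m m, OF b(1)] by (intro mult_mono) auto
  then have X: "\<bar>?x\<bar> \<le> B" using mn by (simp add: power2_eq_square)
  have "\<bar>?y\<bar> \<le> 1 / (real n)\<^sup>2 * (real n * real n * B)"
    unfolding abs_mult using dbl[of n n, OF b(2)] by (intro mult_mono) auto
  then have Y: "\<bar>?y\<bar> \<le> B" using mn by (simp add: power2_eq_square)
  have "\<bar>?xy\<bar> \<le> 2 / (real m * real n) * (real m * real n * B)"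
    unfolding abs_mult[of "2 / (real m * real n)"] using dbl[of m n, OF b(3)] by (intro mult_mono) auto
  then have XY: "\<bar>?xy\<bar> \<le> 2 * B" using mn by simp
  have "\<bar>?x + ?y - ?xy\<bar> \<le> 4 * B" using X Y XY by linarith
  then show ?thesis
    unfolding two_sample_form_def abs_mult[of "real m * real n / real (m + n)"] by (intro mult_mono) auto
qed

lemma two_sample_form_rank_one:
  assumes mn: "0 < m" "0 < n"
  shows "two_sample_form (\<lambda>a b. g (p a) * g (p b)) m n \<sigma> (\<lambda>j. \<sigma> (m + j)) = (contrast m n (\<lambda>a. g (p a)) \<sigma>)\<^sup>2"
proof -
  define X where "X = (\<Sum>i<m. g (p (\<sigma> i)))"
  define Y where "Y = (\<Sum>j<n. g (p (\<sigma> (m + j))))"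
  have pos: "1 / real m + 1 / real n > 0" using mn by (intro add_pos_pos) auto
  have "(contrast m n (\<lambda>a. g (p a)) \<sigma>)\<^sup>2 = (X / real m - Y / real n)\<^sup>2 / (1 / real m + 1 / real n)"
    using pos by (simp add: contrast_def X_def Y_def power_divide)
  also have "\<dots> = real m * real n / real (m + n) *
      (1 / (real m)\<^sup>2 * (X * X) + 1 / (real n)\<^sup>2 * (Y * Y) - 2 / (real m * real n) * (X * Y))"
  proof -
    have "1 / real m + 1 / real n = real (m + n) / (real m * real n)" using mn by (simp add: field_simps)
    then have "D / (1 / real m + 1 / real n) = real m * real n / real (m + n) * D" for D by simp
    moreover have "(X / real m - Y / real n)\<^sup>2 =
        1 / (real m)\<^sup>2 * (X * X) + 1 / (real n)\<^sup>2 * (Y * Y) - 2 / (real m * real n) * (X * Y)"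
      by (simp add: power2_diff power_divide) (simp add: power2_eq_square)
    ultimately show ?thesis by (simp only:)
  qed
  also have "\<dots> = two_sample_form (\<lambda>a b. g (p a) * g (p b)) m n \<sigma> (\<lambda>j. \<sigma> (m + j))"
    unfolding two_sample_form_def X_def Y_def sum_product ..
  finally show ?thesis by simp
qed

text \<open>The summands \<open>norm x\<close> and \<open>norm y\<close> of the kernel cancel: in
  each argument the two samples have equal total weights of opposite sign.\<close>

lemma perm_stat_eq_form:
  assumes mn: "0 < m" "0 < n"
  shows "perm_stat p m n \<sigma> =
    two_sample_form (\<lambda>a b. norm (p a) + norm (p b) - norm (p a - p b)) m n \<sigma> (\<lambda>j. \<sigma> (m + j))"
proof -
  define X where "X = (\<Sum>i<m. norm (p (\<sigma> i)))"
  define Y where "Y = (\<Sum>j<n. norm (p (\<sigma> (m + j))))"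
  define XX where "XX = (\<Sum>i<m. \<Sum>j<m. norm (p (\<sigma> i) - p (\<sigma> j)))"
  define YY where "YY = (\<Sum>i<n. \<Sum>j<n. norm (p (\<sigma> (m + i)) - p (\<sigma> (m + j))))"
  define XY where "XY = (\<Sum>i<m. \<Sum>j<n. norm (p (\<sigma> i) - p (\<sigma> (m + j))))"
  have 1: "(\<Sum>i<m. \<Sum>j<m. norm (p (\<sigma> i)) + norm (p (\<sigma> j)) - norm (p (\<sigma> i) - p (\<sigma> j))) = 2 * real m * X - XX"
    by (simp add: sum.distrib sum_subtractf X_def XX_def sum_distrib_left mult.assoc)
  have 2: "(\<Sum>i<n. \<Sum>j<n. norm (p (\<sigma> (m + i))) + norm (p (\<sigma> (m + j))) - norm (p (\<sigma> (m + i)) - p (\<sigma> (m + j)))) =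
      2 * real n * Y - YY"
    by (simp add: sum.distrib sum_subtractf Y_def YY_def sum_distrib_left mult.assoc)
  have 3: "(\<Sum>i<m. \<Sum>j<n. norm (p (\<sigma> i)) + norm (p (\<sigma> (m + j))) - norm (p (\<sigma> i) - p (\<sigma> (m + j)))) =
      real n * X + real m * Y - XY"
    by (simp add: sum.distrib sum_subtractf X_def Y_def XY_def sum_distrib_left)
  have "1 / (real m)\<^sup>2 * (2 * real m * X - XX) + 1 / (real n)\<^sup>2 * (2 * real n * Y - YY)
      - 2 / (real m * real n) * (real n * X + real m * Y - XY) =
    2 / (real m * real n) * XY - 1 / (real m)\<^sup>2 * XX - 1 / (real n)\<^sup>2 * YY"
    using mn by (simp add: field_simps power2_eq_square)
  then show ?thesis
    unfolding perm_stat_def two_sample_form_def 1 2 3 XX_def[symmetric] YY_def[symmetric] XY_def[symmetric] by simp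
qed

definition partial_stat ::
  "(nat \<Rightarrow> 'c \<Rightarrow> real) \<Rightarrow> (nat \<Rightarrow> 'c) \<Rightarrow> nat \<Rightarrow> nat \<Rightarrow> nat \<Rightarrow> (nat \<Rightarrow> nat) \<Rightarrow> real" where
  "partial_stat f p m n L \<sigma> = (\<Sum>l<L. (contrast m n (\<lambda>a. f l (p a)) \<sigma>)\<^sup>2)"

context distance_features
begin

context
  fixes p :: "nat \<Rightarrow> real ^ 'd" and m n :: nat
  assumes mn: "0 < m" "0 < n" and p: "\<And>a. a < m + n \<Longrightarrow> p a \<in> cbox 0 1"
begin

lemma partial_stat_tendsto:
  assumes \<sigma>: "\<sigma> permutes {..<m + n}"
  shows "(\<lambda>L. partial_stat f p m n L \<sigma>) \<longlonglongrightarrow> perm_stat p m n \<sigma>"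
proof -
  have \<sigma>p: "p (\<sigma> i) \<in> cbox 0 1" if "i < m + n" for i
    using p permutes_in_image[OF \<sigma>, of i] that by auto
  have "\<bar>perm_stat p m n \<sigma> - partial_stat f p m n L \<sigma>\<bar> \<le> real m * real n / real (m + n) * (4 * \<eta> L)" for L
  proof -
    have "partial_stat f p m n L \<sigma> = two_sample_form (\<lambda>a b. \<Sum>l<L. f l (p a) * f l (p b)) m n \<sigma> (\<lambda>j. \<sigma> (m + j))"
      unfolding partial_stat_def two_sample_form_sum two_sample_form_rank_one[OF mn] ..
    then have "perm_stat p m n \<sigma> - partial_stat f p m n L \<sigma> =
      two_sample_form (\<lambda>a b. norm (p a) + norm (p b) - norm (p a - p b) - (\<Sum>l<L. f l (p a) * f l (p b)))
        m n \<sigma> (\<lambda>j. \<sigma> (m + j))"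
      unfolding two_sample_form_diff perm_stat_eq_form[OF mn] by simp
    then show ?thesis
      using two_sample_form_le[OF mn, of
        "\<lambda>a b. norm (p a) + norm (p b) - norm (p a - p b) - (\<Sum>l<L. f l (p a) * f l (p b))" \<sigma> "\<eta> L" "\<lambda>j. \<sigma> (m + j)"]
      by (simp add: kernel \<sigma>p)
  qed
  then have bound: "norm (partial_stat f p m n L \<sigma> - perm_stat p m n \<sigma>) \<le> real m * real n / real (m + n) * (4 * \<eta> L)" for L
    by (simp add: abs_minus_commute)
  have "(\<lambda>L. real m * real n / real (m + n) * (4 * \<eta> L)) \<longlonglongrightarrow> real m * real n / real (m + n) * (4 * 0)"
    by (intro tendsto_intros error_tendsto)
  then have null: "(\<lambda>L. real m * real n / real (m + n) * (4 * \<eta> L)) \<longlonglongrightarrow> 0" by simp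
  have "(\<lambda>L. partial_stat f p m n L \<sigma> - perm_stat p m n \<sigma>) \<longlonglongrightarrow> 0"
    by (rule Lim_null_comparison[OF _ null]) (intro always_eventually allI bound)
  then show ?thesis by (simp add: LIM_zero_iff)
qed

lemma partial_stat_nonneg: "0 \<le> partial_stat f p m n L \<sigma>"
  by (simp add: partial_stat_def sum_nonneg)

lemma partial_stat_le:
  assumes \<sigma>: "\<sigma> permutes {..<m + n}"
  shows "partial_stat f p m n L \<sigma> \<le> perm_stat p m n \<sigma>"
proof (rule incseq_le[OF _ partial_stat_tendsto[OF \<sigma>]])
  show "incseq (\<lambda>L. partial_stat f p m n L \<sigma>)"
    unfolding partial_stat_def by (intro incseq_SucI) simp
qed

lemma perm_stat_nonneg: "\<sigma> permutes {..<m + n} \<Longrightarrow> 0 \<le> perm_stat p m n \<sigma>"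
  using partial_stat_le partial_stat_nonneg order_trans by blast

text \<open>The second moment bound for the contrasts in \<open>{L..<M}\<close> does not involve the
  sample sizes, and it survives the limit in \<open>M\<close>. This is the uniform truncation
  error.\<close>

lemma perm_avg_perm_stat_diff: "perm_avg (m + n) (\<lambda>\<sigma>. perm_stat p m n \<sigma> - partial_stat f p m n L \<sigma>) \<le> 2 * \<eta> L"
proof (rule LIMSEQ_le_const2)
  show "(\<lambda>M. perm_avg (m + n) (\<lambda>\<sigma>. partial_stat f p m n M \<sigma> - partial_stat f p m n L \<sigma>)) \<longlonglongrightarrow>
      perm_avg (m + n) (\<lambda>\<sigma>. perm_stat p m n \<sigma> - partial_stat f p m n L \<sigma>)"
    unfolding perm_avg_def by (intro tendsto_intros partial_stat_tendsto) auto
  have "perm_avg (m + n) (\<lambda>\<sigma>. partial_stat f p m n M \<sigma> - partial_stat f p m n L \<sigma>) \<le> 2 * \<eta> L" if "M \<ge> L" for M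
  proof -
    have "partial_stat f p m n M \<sigma> - partial_stat f p m n L \<sigma> = (\<Sum>l=L..<M. (contrast m n (\<lambda>a. f l (p a)) \<sigma>)\<^sup>2)" for \<sigma>
      using sum.atLeastLessThan_concat[of 0 L M "\<lambda>l. (contrast m n (\<lambda>a. f l (p a)) \<sigma>)\<^sup>2"] that
      by (simp add: partial_stat_def lessThan_atLeast0)
    then show ?thesis
      using contrast_sum_second_moment_le[OF mn, where I = "{L..<M}" and g = "\<lambda>l a. f l (p a)" and B = "\<eta> L"]
        tail[OF that] p by simp
  qed
  then show "\<exists>N. \<forall>M\<ge>N. perm_avg (m + n) (\<lambda>\<sigma>. partial_stat f p m n M \<sigma> - partial_stat f p m n L \<sigma>) \<le> 2 * \<eta> L" by blast
qed

end

end

section \<open>Limit weights and their Gaussian series\<close>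

lemma exp_minus_lipschitz:
  fixes a b :: real
  assumes "0 \<le> a" "0 \<le> b"
  shows "\<bar>exp (- a) - exp (- b)\<bar> \<le> \<bar>a - b\<bar>"
proof -
  have *: "exp (- a) - exp (- b) \<le> b - a" if "0 \<le> a" "a \<le> b" for a b :: real
  proof -
    have "exp (- b) = exp (- a) * exp (- (b - a))" by (simp flip: exp_add)
    then have "exp (- a) - exp (- b) = exp (- a) * (1 - exp (- (b - a)))" by (simp add: right_diff_distrib)
    also have "\<dots> \<le> 1 * (1 - exp (- (b - a)))" using that by (intro mult_right_mono) auto
    also have "\<dots> = 1 - exp (- (b - a))" by (rule mult_1)
    also have "\<dots> \<le> b - a"
    proof -
      have "1 - exp (- d) \<le> d" for d :: real using exp_ge_add_one_self[of "- d"] by linarith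
      then show ?thesis .
    qed
    finally show ?thesis .
  qed
  show ?thesis
    using *[of a b] *[of b a] assms by (cases "a \<le> b") (auto simp: abs_if)
qed

text \<open>All lists lie in a product of copies of \<open>{0..\<eta> 0}\<close>, which is compact,
  so a subsequence converges in each coordinate. The common tail bound upgrades this to summed
  absolute differences.\<close>

lemma eigenvalue_subsequence:
  fixes T :: "nat \<Rightarrow> nat \<Rightarrow> real"
  assumes nonneg: "\<And>L j. 0 \<le> T L j" and zero: "\<And>L j. L \<le> j \<Longrightarrow> T L j = 0"
    and tail: "\<And>L' L. L' \<le> L \<Longrightarrow> (\<Sum>j=L'..<L. T L j) \<le> \<eta> L'" and \<eta>0: "\<eta> \<longlonglongrightarrow> 0"
  obtains \<tau> r where "strict_mono (r :: nat \<Rightarrow> nat)" "\<And>j. 0 \<le> \<tau> j" "summable \<tau>"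
    "\<And>e. e > 0 \<Longrightarrow> \<forall>\<^sub>F k in sequentially. \<forall>J. (\<Sum>j<J. \<bar>T (r k) j - \<tau> j\<bar>) \<le> e"
proof -
  have \<eta>nn: "0 \<le> \<eta> L" for L using tail[of L L] by simp
  have tail': "(\<Sum>j=L'..<J. T L j) \<le> \<eta> L'" for L' L J
  proof (cases "L' \<le> L")
    case True
    have "(\<Sum>j=L'..<J. T L j) \<le> (\<Sum>j=L'..<max L J. T L j)"
      using nonneg by (intro sum_mono2) auto
    also have "\<dots> = (\<Sum>j=L'..<L. T L j)"
      using zero by (intro sum.mono_neutral_right) auto
    finally show ?thesis using tail[OF True] by simp
  next
    case False
    then have "(\<Sum>j=L'..<J. T L j) = 0" using zero by (intro sum.neutral) auto
    then show ?thesis using \<eta>nn by simp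
  qed
  have le: "T L j \<le> \<eta> 0" for L j
  proof -
    have "T L j \<le> (\<Sum>j=0..<Suc j. T L j)" using nonneg by (intro member_le_sum) auto
    then show ?thesis using tail'[of L 0 "Suc j"] by simp
  qed
  define K where "K = PiE UNIV (\<lambda>_::nat. {0..\<eta> 0})"
  have "compactin (product_topology (\<lambda>_. euclidean) UNIV) K"
    unfolding K_def by (subst compactin_PiE) auto
  then have "compact K" by (simp add: euclidean_product_topology)
  moreover have "\<forall>L. T L \<in> K" using nonneg le by (auto simp: K_def)
  ultimately obtain \<tau> r where \<tau>: "\<tau> \<in> K" and r: "strict_mono r" and lim: "(T \<circ> r) \<longlonglongrightarrow> \<tau>"
    unfolding compact_def by meson
  have limj: "(\<lambda>k. T (r k) j) \<longlonglongrightarrow> \<tau> j" for j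
  proof -
    have "continuous_on UNIV (\<lambda>x :: nat \<Rightarrow> real. x j)" by (rule continuous_on_product_coordinates)
    from continuous_on_tendsto_compose[OF this lim] show ?thesis by (simp add: o_def)
  qed
  have \<tau>0: "0 \<le> \<tau> j" for j using \<tau> by (auto simp: K_def PiE_iff)
  have \<tau>tail: "(\<Sum>j=L'..<J. \<tau> j) \<le> \<eta> L'" for L' J
    by (rule LIMSEQ_le_const2[of "\<lambda>k. \<Sum>j=L'..<J. T (r k) j"]) (auto intro!: tendsto_sum limj tail')
  have sum\<tau>: "summable \<tau>"
    using \<tau>tail[of 0] \<tau>0 by (intro summableI_nonneg_bounded[of _ "\<eta> 0"]) (auto simp: lessThan_atLeast0)
  have close: "\<forall>\<^sub>F k in sequentially. \<forall>J. (\<Sum>j<J. \<bar>T (r k) j - \<tau> j\<bar>) \<le> e" if e: "e > 0" for e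
  proof -
    have "\<forall>\<^sub>F L in sequentially. \<eta> L < e / 4" using \<eta>0 e by (intro order_tendstoD(2)) auto
    \<comment> \<open>Beyond \<open>L'\<close> both tails are below \<open>e / 4\<close>; the head
      is a finite sum and is made smaller than \<open>e / 2\<close>.\<close>
    then obtain L' where L': "\<eta> L' < e / 4" using eventually_happens by fastforce
    have "(\<lambda>k. \<Sum>j<L'. \<bar>T (r k) j - \<tau> j\<bar>) \<longlonglongrightarrow> (\<Sum>j<L'. \<bar>\<tau> j - \<tau> j\<bar>)"
      by (intro tendsto_intros limj)
    then have "\<forall>\<^sub>F k in sequentially. (\<Sum>j<L'. \<bar>T (r k) j - \<tau> j\<bar>) < e / 2"
      using e by (intro order_tendstoD(2)) auto
    then show ?thesis
    proof eventually_elim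
      case (elim k)
      show ?case
      proof
        fix J
        let ?d = "\<lambda>j. \<bar>T (r k) j - \<tau> j\<bar>"
        have "(\<Sum>j<J. ?d j) \<le> (\<Sum>j<max L' J. ?d j)" by (intro sum_mono2) auto
        also have "\<dots> = (\<Sum>j<L'. ?d j) + (\<Sum>j=L'..<max L' J. ?d j)"
          using sum.atLeastLessThan_concat[of 0 L' "max L' J" ?d] by (simp add: lessThan_atLeast0)
        also have "(\<Sum>j=L'..<max L' J. ?d j) \<le> (\<Sum>j=L'..<max L' J. T (r k) j + \<tau> j)"
          using nonneg \<tau>0 by (intro sum_mono) (smt (verit))
        also have "\<dots> \<le> \<eta> L' + \<eta> L'" unfolding sum.distrib by (intro add_mono tail' \<tau>tail)
        finally show "(\<Sum>j<J. ?d j) \<le> e" using elim L' by simp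
      qed
    qed
  qed
  show ?thesis by (rule that[OF r \<tau>0 sum\<tau> close])
qed

text \<open>The mean of the series is the sum of the weights, because the squares have mean 1; a
  nonnegative series with finite mean is finite almost everywhere.\<close>

lemma weighted_chi_square_summable:
  assumes Z: "iid_std_normal P Z" and \<tau>: "\<And>j. 0 \<le> \<tau> j" "summable \<tau>"
  shows "AE \<omega> in P. summable (\<lambda>j. \<tau> j * (Z j \<omega>)\<^sup>2)"
proof -
  note [measurable] = iid_std_normal_measurable[OF Z]
  have mean: "(\<integral>\<^sup>+\<omega>. ennreal (\<tau> j * (Z j \<omega>)\<^sup>2) \<partial>P) = ennreal (\<tau> j)" for j
    using iid_std_normal_square[OF Z, of j] \<tau>(1)[of j] by (subst nn_integral_eq_integral) auto
  have "(\<integral>\<^sup>+\<omega>. (\<Sum>j. ennreal (\<tau> j * (Z j \<omega>)\<^sup>2)) \<partial>P) = (\<Sum>j. ennreal (\<tau> j))"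
    by (subst nn_integral_suminf) (auto simp: mean)
  also have "\<dots> = ennreal (\<Sum>j. \<tau> j)" using \<tau> by (rule suminf_ennreal2)
  finally have "(\<integral>\<^sup>+\<omega>. (\<Sum>j. ennreal (\<tau> j * (Z j \<omega>)\<^sup>2)) \<partial>P) \<noteq> \<infinity>" by simp
  then have "AE \<omega> in P. (\<Sum>j. ennreal (\<tau> j * (Z j \<omega>)\<^sup>2)) \<noteq> \<infinity>"
    by (intro nn_integral_noteq_infinite) auto
  then show ?thesis
    by eventually_elim (auto intro!: summable_suminf_not_top simp: \<tau>)
qed

text \<open>On the half line \<open>exp (- x)\<close> is 1-Lipschitz, and the squares have mean 1.
  So the error is bounded by \<open>t\<close> times the summed absolute difference of the
  weights.\<close>

lemma weighted_chi_square_laplace_diff: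
  assumes Z: "iid_std_normal P Z" and \<tau>: "\<And>j. 0 \<le> \<tau> j" "summable \<tau>"
    and T: "\<And>j. 0 \<le> T j" "\<And>j. L \<le> j \<Longrightarrow> T j = 0" and t: "0 \<le> t"
    and close: "\<And>J. (\<Sum>j<J. \<bar>T j - \<tau> j\<bar>) \<le> e"
  shows "\<bar>(\<integral>\<omega>. exp (- t * (\<Sum>j<L. T j * (Z j \<omega>)\<^sup>2)) \<partial>P) - (\<integral>\<omega>. exp (- t * (\<Sum>j. \<tau> j * (Z j \<omega>)\<^sup>2)) \<partial>P)\<bar> \<le> t * e"
proof -
  let ?s = "\<lambda>c J \<omega>. \<Sum>j<J. c j * (Z j \<omega>)\<^sup>2"
  interpret P: prob_space P using Z by (simp add: iid_std_normal_def)
  note [measurable] = iid_std_normal_measurable[OF Z]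
  let ?\<phi> = "\<integral>\<omega>. exp (- t * ?s T L \<omega>) \<partial>P"
  let ?\<psi> = "\<lambda>J. \<integral>\<omega>. exp (- t * ?s \<tau> J \<omega>) \<partial>P"
  have nn: "0 \<le> t * ?s c J \<omega>" if "\<And>j. 0 \<le> c j" for c J \<omega>
    using t that by (intro mult_nonneg_nonneg sum_nonneg) auto
  have le1: "\<bar>exp (- t * ?s c J \<omega>)\<bar> \<le> 1" if "\<And>j. 0 \<le> c j" for c J \<omega>
    using nn[of c \<omega> J, OF that] by simp
  have int: "integrable P (\<lambda>\<omega>. exp (- t * ?s c J \<omega>))" if "\<And>j. 0 \<le> c j" for c J
    using le1[of c _ J, OF that] by (intro P.integrable_const_bound[of _ 1]) auto
  have "?\<psi> \<longlonglongrightarrow> (\<integral>\<omega>. exp (- t * (\<Sum>j. \<tau> j * (Z j \<omega>)\<^sup>2)) \<partial>P)"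
  proof (rule integral_dominated_convergence[where w = "\<lambda>_. 1"])
    show "AE \<omega> in P. (\<lambda>J. exp (- t * ?s \<tau> J \<omega>)) \<longlonglongrightarrow> exp (- t * (\<Sum>j. \<tau> j * (Z j \<omega>)\<^sup>2))"
      using weighted_chi_square_summable[OF Z \<tau>]
      by eventually_elim (intro tendsto_intros summable_LIMSEQ)
    show "AE \<omega> in P. norm (exp (- t * ?s \<tau> J \<omega>)) \<le> 1" for J
      using le1[of \<tau> _ J, OF \<tau>(1)] by (intro AE_I2) simp
  qed auto
  then have "(\<lambda>J. \<bar>?\<phi> - ?\<psi> J\<bar>) \<longlonglongrightarrow> \<bar>?\<phi> - (\<integral>\<omega>. exp (- t * (\<Sum>j. \<tau> j * (Z j \<omega>)\<^sup>2)) \<partial>P)\<bar>"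
    by (intro tendsto_intros)
  moreover have "\<bar>?\<phi> - ?\<psi> J\<bar> \<le> t * e" if J: "J \<ge> L" for J
  proof -
    have T_eq: "?s T L \<omega> = ?s T J \<omega>" for \<omega>
      using T(2) J by (intro sum.mono_neutral_left) auto
    have "?\<phi> - ?\<psi> J = (\<integral>\<omega>. exp (- t * ?s T J \<omega>) - exp (- t * ?s \<tau> J \<omega>) \<partial>P)"
      unfolding T_eq by (rule Bochner_Integration.integral_diff[symmetric]) (rule int[of T, OF T(1)] int[of \<tau>, OF \<tau>(1)])+
    also have "\<bar>\<dots>\<bar> \<le> (\<integral>\<omega>. \<bar>exp (- t * ?s T J \<omega>) - exp (- t * ?s \<tau> J \<omega>)\<bar> \<partial>P)"
      by (rule integral_abs_bound)
    also have "\<dots> \<le> (\<integral>\<omega>. t * (\<Sum>j<J. \<bar>T j - \<tau> j\<bar> * (Z j \<omega>)\<^sup>2) \<partial>P)"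
    proof (rule integral_mono)
      fix \<omega>
      have "\<bar>exp (- t * ?s T J \<omega>) - exp (- t * ?s \<tau> J \<omega>)\<bar> \<le>
          \<bar>t * ?s T J \<omega> - t * ?s \<tau> J \<omega>\<bar>"
        using exp_minus_lipschitz[OF nn[of T \<omega> J, OF T(1)] nn[of \<tau> \<omega> J, OF \<tau>(1)]] by simp
      also have "\<dots> = t * \<bar>\<Sum>j<J. (T j - \<tau> j) * (Z j \<omega>)\<^sup>2\<bar>"
        using t by (simp add: abs_mult sum_subtractf left_diff_distrib flip: right_diff_distrib)
      also have "\<dots> \<le> t * (\<Sum>j<J. \<bar>T j - \<tau> j\<bar> * (Z j \<omega>)\<^sup>2)"
        using t by (intro mult_left_mono order_trans[OF sum_abs]) (simp_all add: abs_mult)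
      finally show "\<bar>exp (- t * ?s T J \<omega>) - exp (- t * ?s \<tau> J \<omega>)\<bar> \<le>
          t * (\<Sum>j<J. \<bar>T j - \<tau> j\<bar> * (Z j \<omega>)\<^sup>2)" .
    qed (use int[of T, OF T(1)] int[of \<tau>, OF \<tau>(1)] iid_std_normal_square(1)[OF Z] in auto)
    also have "\<dots> = t * (\<Sum>j<J. \<bar>T j - \<tau> j\<bar>)"
      using iid_std_normal_square[OF Z] by simp
    also have "\<dots> \<le> t * e" using t close by (intro mult_left_mono)
    finally show ?thesis .
  qed
  ultimately show ?thesis by (intro LIMSEQ_le_const2) auto
qed

section \<open>The limit theorem\<close>

context distance_features
begin

text \<open>Ky Fan bounds the eigenvalue tail by a tail of the diagonal, that is by variances, hence
  by second moments, whose sum is at most \<open>\<eta> L'\<close> on the cube. The list is chosen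
  ahead of \<open>P\<close>, \<open>Z\<close> and \<open>t\<close>.\<close>

lemma cube_cov_eigenvalues:
  "\<exists>T. (\<forall>j. 0 \<le> T j) \<and> (\<forall>j\<ge>L. T j = 0) \<and> (\<forall>L'\<le>L. (\<Sum>j=L'..<L. T j) \<le> \<eta> L') \<and>
    (\<forall>(P :: 'b measure) Z t. iid_std_normal P Z \<longrightarrow> 0 \<le> t \<longrightarrow>
      (\<integral>\<omega>. exp (- t * (\<Sum>l<L. \<Sum>k<L. Z l \<omega> * Z k \<omega> * cube_cov (f l) (f k))) \<partial>P) =
      (\<integral>\<omega>. exp (- t * (\<Sum>j<L. T j * (Z j \<omega>)\<^sup>2)) \<partial>P))"
proof -
  let ?A = "\<lambda>l k. cube_cov (f l) (f k)"
  interpret U: prob_space "unif_cube :: (real ^ 'd) measure" by (rule prob_space_unif_cube)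
  obtain T v where T0: "\<And>j. 0 \<le> T j" and mono: "\<And>i j. i \<le> j \<Longrightarrow> T j \<le> T i"
    and zero: "\<And>j. L \<le> j \<Longrightarrow> T j = 0"
    and dec: "\<And>l k. l < L \<Longrightarrow> k < L \<Longrightarrow> ?A l k = (\<Sum>j<L. T j * v j l * v j k)"
    and orth: "\<And>i j. i < L \<Longrightarrow> j < L \<Longrightarrow> i \<noteq> j \<Longrightarrow> dotp L (v i) (v j) = 0"
    and unit: "\<And>j. j < L \<Longrightarrow> dotp L (v j) (v j) = (if T j = 0 then 0 else 1)"
    by (rule psd_matrix_spectral[OF psd_matrix_cube_cov[of L]]) (rule that)
  have "(\<Sum>j=L'..<L. T j) \<le> \<eta> L'" if L': "L' \<le> L" for L'
  proof -
    have int: "integrable unif_cube (\<lambda>x. (f l x)\<^sup>2)" for l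
      using features_prod_integrable[of l l] by (simp add: power2_eq_square)
    have "(\<Sum>j=L'..<L. T j) \<le> (\<Sum>l=L'..<L. ?A l l)"
      by (rule psd_matrix_eigenvalue_tail[where \<tau> = T and A = ?A and v = v, OF T0 mono dec orth unit L'])
    also have "\<dots> \<le> (\<Sum>l=L'..<L. \<integral>x. (f l x)\<^sup>2 \<partial>unif_cube)"
      by (intro sum_mono) (simp add: cube_cov_def power2_eq_square)
    also have "\<dots> = (\<integral>x. (\<Sum>l=L'..<L. (f l x)\<^sup>2) \<partial>unif_cube)" by (simp add: int)
    also have "\<dots> \<le> (\<integral>x. \<eta> L' \<partial>(unif_cube :: (real ^ 'd) measure))"
    proof (rule integral_mono_AE)
      show "AE x in unif_cube. (\<Sum>l=L'..<L. (f l x)\<^sup>2) \<le> \<eta> L'"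
        using AE_unif_cube by eventually_elim (rule tail[OF L'])
    qed (auto intro: int)
    also have "\<dots> = \<eta> L'" by (simp add: U.prob_space)
    finally show ?thesis .
  qed
  moreover have "(\<integral>\<omega>. exp (- t * (\<Sum>l<L. \<Sum>k<L. Z l \<omega> * Z k \<omega> * ?A l k)) \<partial>P) =
      (\<integral>\<omega>. exp (- t * (\<Sum>j<L. T j * (Z j \<omega>)\<^sup>2)) \<partial>P)"
    if "iid_std_normal P Z" "0 \<le> t" for P :: "'b measure" and Z t
    by (rule quadratic_form_diagonalise[where \<tau> = T and A = ?A and v = v, OF that T0 dec orth unit])
  ultimately show ?thesis using T0 zero by (intro exI[of _ T]) simp
qed

lemma perm_stat_laplace_limit:
  fixes T :: "nat \<Rightarrow> nat \<Rightarrow> real"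
  assumes T0: "\<And>L j. 0 \<le> T L j" and zero: "\<And>L j. L \<le> j \<Longrightarrow> T L j = 0"
    and r: "strict_mono (r :: nat \<Rightarrow> nat)" and \<tau>: "\<And>j. 0 \<le> \<tau> j" "summable \<tau>"
    and close: "\<And>e. e > 0 \<Longrightarrow> \<forall>\<^sub>F k in sequentially. \<forall>J. (\<Sum>j<J. \<bar>T (r k) j - \<tau> j\<bar>) \<le> e"
    and h: "reference_points (h :: nat \<Rightarrow> nat \<Rightarrow> real ^ 'd)" and Z: "iid_std_normal P Z" and t: "0 \<le> t"
    and diag: "\<And>L. (\<integral>\<omega>. exp (- t * (\<Sum>l<L. \<Sum>k<L. Z l \<omega> * Z k \<omega> * cube_cov (f l) (f k))) \<partial>P) =
      (\<integral>\<omega>. exp (- t * (\<Sum>j<L. T L j * (Z j \<omega>)\<^sup>2)) \<partial>P)"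
  shows "((\<lambda>(m, n). perm_avg (m + n) (\<lambda>\<sigma>. exp (- t * perm_stat (h (m + n)) m n \<sigma>))) \<longlongrightarrow>
    (\<integral>\<omega>. exp (- t * (\<Sum>j. \<tau> j * (Z j \<omega>)\<^sup>2)) \<partial>P)) min_at_top"
proof (rule tendstoI)
  fix e :: real assume e: "e > 0"
  have hC: "h N a \<in> cbox 0 1" if "a < N" for N a
    using h that by (auto simp: reference_points_def)
  \<comment> \<open>A common bound for \<open>2 * \<eta> L\<close> and for the distance of the
    eigenvalue list to the weights; \<open>t + 1\<close> covers \<open>t = 0\<close>.\<close>
  define d where "d = e / (3 * (t + 1))"
  have d: "d > 0" "t * d \<le> e / 3"
    using e t by (auto simp: d_def field_simps)
  have "\<forall>\<^sub>F L in sequentially. \<eta> L < d / 2" using error_tendsto d(1) by (intro order_tendstoD(2)) auto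
  then have "\<forall>\<^sub>F k in sequentially. \<eta> (r k) < d / 2"
    by (rule eventually_compose_filterlim[OF _ filterlim_subseq[OF r]])
  then have "\<forall>\<^sub>F k in sequentially. \<eta> (r k) < d / 2 \<and> (\<forall>J. (\<Sum>j<J. \<bar>T (r k) j - \<tau> j\<bar>) \<le> d)"
    using close[OF d(1)] by eventually_elim simp
  then obtain k where k: "\<eta> (r k) < d / 2" "\<And>J. (\<Sum>j<J. \<bar>T (r k) j - \<tau> j\<bar>) \<le> d"
    using eventually_happens by fastforce
  define L where "L = r k"
  let ?lim = "\<integral>\<omega>. exp (- t * (\<Sum>j. \<tau> j * (Z j \<omega>)\<^sup>2)) \<partial>P"
  let ?lim' = "\<integral>\<omega>. exp (- t * (\<Sum>j<L. T L j * (Z j \<omega>)\<^sup>2)) \<partial>P"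
  let ?S = "\<lambda>m n \<sigma>. \<Sum>l<L. (contrast m n (\<lambda>a. f l (h (m + n) a)) \<sigma>)\<^sup>2"
  have 1: "\<bar>?lim' - ?lim\<bar> \<le> e / 3"
    using weighted_chi_square_laplace_diff[where \<tau> = \<tau> and T = "T L" and L = L and t = t and e = d, OF Z \<tau>] T0 zero t k(2) d(2) by (simp add: L_def)
  have "\<forall>\<^sub>F (m, n) in min_at_top. dist (perm_avg (m + n) (\<lambda>\<sigma>. exp (- t * ?S m n \<sigma>))) ?lim' < e / 3"
    using tendstoD[OF contrast_laplace_limit[OF h Z t, of L], of "e / 3"] e
    unfolding diag by (simp add: case_prod_unfold)
  then show "\<forall>\<^sub>F i in min_at_top. dist (case i of (m, n) \<Rightarrow>
      perm_avg (m + n) (\<lambda>\<sigma>. exp (- t * perm_stat (h (m + n)) m n \<sigma>))) ?lim < e"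
    using eventually_min_at_top[of 1]
  proof eventually_elim
    case (elim i)
    obtain m n where i: "i = (m, n)" by (cases i)
    have mn: "0 < m" "0 < n" using elim(2) by (auto simp: i)
    let ?E = "perm_avg (m + n)" and ?T = "perm_stat (h (m + n)) m n"
    note stat = mn hC[of _ "m + n"]
    have S_eq: "?S m n \<sigma> = partial_stat f (h (m + n)) m n L \<sigma>" for \<sigma>
      by (simp add: partial_stat_def)
    have "\<bar>?E (\<lambda>\<sigma>. exp (- t * ?T \<sigma>)) - ?E (\<lambda>\<sigma>. exp (- t * ?S m n \<sigma>))\<bar> \<le>
        ?E (\<lambda>\<sigma>. \<bar>exp (- t * ?T \<sigma>) - exp (- t * ?S m n \<sigma>)\<bar>)"
      unfolding perm_avg_diff[symmetric] by (rule perm_avg_abs)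
    also have "\<dots> \<le> ?E (\<lambda>\<sigma>. t * (?T \<sigma> - ?S m n \<sigma>))"
    proof (rule perm_avg_mono)
      fix \<sigma> assume \<sigma>: "\<sigma> permutes {..<m + n}"
      have a: "0 \<le> ?S m n \<sigma>" by (intro sum_nonneg) simp
      have b: "?S m n \<sigma> \<le> ?T \<sigma>" unfolding S_eq by (rule partial_stat_le[OF stat \<sigma>])
      have "\<bar>exp (- (t * ?T \<sigma>)) - exp (- (t * ?S m n \<sigma>))\<bar> \<le> \<bar>t * ?T \<sigma> - t * ?S m n \<sigma>\<bar>"
        using a b t by (intro exp_minus_lipschitz mult_nonneg_nonneg) linarith+
      also have "\<dots> = t * (?T \<sigma> - ?S m n \<sigma>)"
        using b t by (simp add: abs_mult flip: right_diff_distrib)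
      finally show "\<bar>exp (- t * ?T \<sigma>) - exp (- t * ?S m n \<sigma>)\<bar> \<le> t * (?T \<sigma> - ?S m n \<sigma>)" by simp
    qed
    also have "\<dots> = t * ?E (\<lambda>\<sigma>. ?T \<sigma> - ?S m n \<sigma>)" by (rule perm_avg_cmult)
    also have "\<dots> \<le> t * (2 * \<eta> L)"
      unfolding S_eq using t by (intro mult_left_mono perm_avg_perm_stat_diff[OF stat])
    also have "\<dots> \<le> t * d" using k(1) t by (intro mult_left_mono) (auto simp: L_def)
    also note d(2)
    finally have "\<bar>?E (\<lambda>\<sigma>. exp (- t * ?T \<sigma>)) - ?E (\<lambda>\<sigma>. exp (- t * ?S m n \<sigma>))\<bar> \<le> e / 3" .
    moreover have "\<bar>?E (\<lambda>\<sigma>. exp (- t * ?S m n \<sigma>)) - ?lim'\<bar> < e / 3"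
      using elim(1) by (simp add: i dist_real_def)
    ultimately have "\<bar>?E (\<lambda>\<sigma>. exp (- t * ?T \<sigma>)) - ?lim\<bar> < e" using 1 by linarith
    then show ?case by (simp add: i dist_real_def)
  qed
qed

end

text \<open>Pooling is an injective reindexing of the joint family over the sum type, so
  independence is inherited.\<close>

lemma two_samples_pooled:
  fixes X Y :: "nat \<Rightarrow> 'a \<Rightarrow> real ^ 'd"
  assumes "two_samples M X Y \<mu> \<mu>"
  shows "prob_space.indep_vars M (\<lambda>_. borel) (\<lambda>i \<omega>. pooled m (\<lambda>i. X i \<omega>) (\<lambda>j. Y j \<omega>) i) UNIV"
    and "distr M borel (\<lambda>\<omega>. pooled m (\<lambda>i. X i \<omega>) (\<lambda>j. Y j \<omega>) i) = \<mu>"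
proof -
  interpret prob_space M using assms by (simp add: two_samples_def)
  define e where "e i = (if i < m then Inl i else Inr (i - m))" for i
  have eq: "(\<lambda>\<omega>. pooled m (\<lambda>i. X i \<omega>) (\<lambda>j. Y j \<omega>) i) = case_sum X Y (e i)" for i
    by (simp add: pooled_def e_def fun_eq_iff)
  have "inj e" by (auto simp: inj_def e_def split: if_splits)
  moreover have "indep_vars (\<lambda>_. borel) (case_sum X Y) (range e)"
    using assms indep_vars_subset[of "\<lambda>_. borel" "case_sum X Y" UNIV "range e"] by (simp add: two_samples_def)
  ultimately show "indep_vars (\<lambda>_. borel) (\<lambda>i \<omega>. pooled m (\<lambda>i. X i \<omega>) (\<lambda>j. Y j \<omega>) i) UNIV"
    unfolding eq using indep_vars_reindex by blast
  show "distr M borel (\<lambda>\<omega>. pooled m (\<lambda>i. X i \<omega>) (\<lambda>j. Y j \<omega>) i) = \<mu>"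
    unfolding eq using assms by (simp add: two_samples_def e_def)
qed

theorem theorem4p3:
  fixes \<mu>X \<mu>Y :: "(real ^ 'd) measure"
  assumes "\<mu>X \<in> P_ac" and "\<mu>Y \<in> P_ac"
    and H0: "\<mu>X = \<mu>Y"
  shows "\<exists>\<tau> :: nat \<Rightarrow> real. (\<forall>j. 0 \<le> \<tau> j) \<and>
    (\<forall>(h :: nat \<Rightarrow> nat \<Rightarrow> real ^ 'd) (M :: 'a measure) X Y (P :: 'b measure) Z.
      reference_points h \<longrightarrow> two_samples M X Y \<mu>X \<mu>Y \<longrightarrow> iid_std_normal P Z \<longrightarrow>
        (AE \<omega> in P. summable (\<lambda>j. \<tau> j * (Z j \<omega>)\<^sup>2)) \<and>
        weakly_converges
          (\<lambda>(m, n). distr M borel (\<lambda>\<omega>. real m * real n / real (m + n) *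
             RE_sq (h (m + n)) m n (\<lambda>i. X i \<omega>) (\<lambda>j. Y j \<omega>)))
          (distr P borel (\<lambda>\<omega>. \<Sum>j. \<tau> j * (Z j \<omega>)\<^sup>2))
          min_at_top)"
proof -
  obtain f :: "nat \<Rightarrow> real ^ 'd \<Rightarrow> real" and \<eta> where "distance_features f \<eta>"
    using distance_features_exist by blast
  then interpret distance_features f \<eta> .
  define Q where "Q L T \<longleftrightarrow> (\<forall>j. 0 \<le> T j) \<and> (\<forall>j\<ge>L. T j = 0) \<and> (\<forall>L'\<le>L. (\<Sum>j=L'..<L. T j) \<le> \<eta> L') \<and>
    (\<forall>(P :: 'b measure) Z t. iid_std_normal P Z \<longrightarrow> 0 \<le> t \<longrightarrow>
      (\<integral>\<omega>. exp (- t * (\<Sum>l<L. \<Sum>k<L. Z l \<omega> * Z k \<omega> * cube_cov (f l) (f k))) \<partial>P) =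
      (\<integral>\<omega>. exp (- t * (\<Sum>j<L. T j * (Z j \<omega>)\<^sup>2)) \<partial>P))" for L and T :: "nat \<Rightarrow> real"
  have "\<forall>L. \<exists>T. Q L T" unfolding Q_def by (intro allI cube_cov_eigenvalues)
  then obtain T where T: "\<And>L. Q L (T L)" by metis
  have T0: "\<And>L j. 0 \<le> T L j" and zero: "\<And>L j. L \<le> j \<Longrightarrow> T L j = 0"
    and Ttail: "\<And>L' L. L' \<le> L \<Longrightarrow> (\<Sum>j=L'..<L. T L j) \<le> \<eta> L'"
    and diag: "\<And>(P :: 'b measure) Z t L. iid_std_normal P Z \<Longrightarrow> 0 \<le> t \<Longrightarrow>
      (\<integral>\<omega>. exp (- t * (\<Sum>l<L. \<Sum>k<L. Z l \<omega> * Z k \<omega> * cube_cov (f l) (f k))) \<partial>P) =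
      (\<integral>\<omega>. exp (- t * (\<Sum>j<L. T L j * (Z j \<omega>)\<^sup>2)) \<partial>P)"
    using T unfolding Q_def by simp_all
  \<comment> \<open>The weights are fixed here, before reference points, samples and Gaussian
    variables are introduced; this order yields the independence claim.\<close>
  obtain \<tau> r where r: "strict_mono (r :: nat \<Rightarrow> nat)" and \<tau>: "\<And>j. 0 \<le> \<tau> j" "summable \<tau>"
    and close: "\<And>e. e > 0 \<Longrightarrow> \<forall>\<^sub>F k in sequentially. \<forall>J. (\<Sum>j<J. \<bar>T (r k) j - \<tau> j\<bar>) \<le> e"
    by (rule eigenvalue_subsequence[where T = T and \<eta> = \<eta>, OF T0 zero Ttail error_tendsto]) (assumption, assumption, rule that)
  have main: "(AE \<omega> in P. summable (\<lambda>j. \<tau> j * (Z j \<omega>)\<^sup>2)) \<and>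
      weakly_converges
        (\<lambda>(m, n). distr M borel (\<lambda>\<omega>. real m * real n / real (m + n) *
           RE_sq (h (m + n)) m n (\<lambda>i. X i \<omega>) (\<lambda>j. Y j \<omega>)))
        (distr P borel (\<lambda>\<omega>. \<Sum>j. \<tau> j * (Z j \<omega>)\<^sup>2)) min_at_top"
    if h: "reference_points h" and XY: "two_samples M X Y \<mu>X \<mu>Y" and Z: "iid_std_normal P Z"
    for h :: "nat \<Rightarrow> nat \<Rightarrow> real ^ 'd" and M :: "'a measure" and X Y and P :: "'b measure" and Z
  proof -
    interpret M: prob_space M using XY by (simp add: two_samples_def)
    interpret P: prob_space P using Z by (simp add: iid_std_normal_def)
    note [measurable] = iid_std_normal_measurable[OF Z]
    have summ: "AE \<omega> in P. summable (\<lambda>j. \<tau> j * (Z j \<omega>)\<^sup>2)"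
      by (rule weighted_chi_square_summable[OF Z \<tau>])
    define W where "W m i \<omega> = pooled m (\<lambda>i. X i \<omega>) (\<lambda>j. Y j \<omega>) i" for m i \<omega>
    define S where "S m n \<omega> = perm_stat (h (m + n)) m n (opt_perm (m + n) (h (m + n)) (\<lambda>i. W m i \<omega>))" for m n \<omega>
    have S_eq: "(\<lambda>\<omega>. real m * real n / real (m + n) * RE_sq (h (m + n)) m n (\<lambda>i. X i \<omega>) (\<lambda>j. Y j \<omega>)) = S m n" for m n
      by (rule ext) (simp only: RE_sq_eq_perm_stat S_def W_def)
    have indep: "M.indep_vars (\<lambda>_. borel) (W m) UNIV" and law: "distr M borel (W m i) = \<mu>X" for m i
      using two_samples_pooled[of M X Y \<mu>X m] XY H0 by (simp_all add: W_def[abs_def])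
    have [measurable]: "W m i \<in> borel_measurable M" for m i
      using indep[of m] by (auto simp: M.indep_vars_def)
    have S_meas [measurable]: "S m n \<in> borel_measurable M" for m n
      unfolding S_def by (rule opt_perm_measurable) simp
    have avg: "(\<integral>\<omega>. g (S m n \<omega>) \<partial>M) = perm_avg (m + n) (\<lambda>\<sigma>. g (perm_stat (h (m + n)) m n \<sigma>))" for g :: "real \<Rightarrow> real" and m n
      unfolding S_def
      by (rule M.expectation_opt_perm[where W = "W m", OF indep law assms(1)]) (use h in \<open>simp add: reference_points_def\<close>)
    have "weakly_converges (\<lambda>(m, n). distr M borel (S m n)) (distr P borel (\<lambda>\<omega>. \<Sum>j. \<tau> j * (Z j \<omega>)\<^sup>2)) min_at_top"
    proof (rule laplace_weak_convergence)
      show "\<forall>\<^sub>F i in min_at_top. prob_space (case i of (m, n) \<Rightarrow> distr M borel (S m n)) \<and>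
          sets (case i of (m, n) \<Rightarrow> distr M borel (S m n)) = sets borel \<and>
          (AE x in (case i of (m, n) \<Rightarrow> distr M borel (S m n)). 0 \<le> x)"
        using eventually_min_at_top[of 1]
      proof eventually_elim
        case (elim i)
        obtain m n where i: "i = (m, n)" by (cases i)
        have mn: "0 < m" "0 < n" using elim by (auto simp: i)
        have hC: "h (m + n) a \<in> cbox 0 1" if "a < m + n" for a
          using h that by (auto simp: reference_points_def)
        have "0 \<le> S m n \<omega>" for \<omega>
          unfolding S_def by (rule perm_stat_nonneg[OF mn hC opt_perm_permutes])
        then have "AE x in distr M borel (S m n). 0 \<le> x" by (subst AE_distr_iff) auto
        then show ?case unfolding i prod.case by (simp add: M.prob_space_distr)
      qed
      show "prob_space (distr P borel (\<lambda>\<omega>. \<Sum>j. \<tau> j * (Z j \<omega>)\<^sup>2))"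
        by (rule P.prob_space_distr) measurable
      \<comment> \<open>The value of \<open>suminf\<close> is known to be nonnegative only where the
        series converges, hence almost everywhere.\<close>
      have "AE \<omega> in P. 0 \<le> (\<Sum>j. \<tau> j * (Z j \<omega>)\<^sup>2)"
        using summ by eventually_elim (intro suminf_nonneg, auto simp: \<tau>)
      then show "AE x in distr P borel (\<lambda>\<omega>. \<Sum>j. \<tau> j * (Z j \<omega>)\<^sup>2). 0 \<le> x"
        by (subst AE_distr_iff) auto
      fix k :: nat
      have "(\<integral>x. exp (- real k * x) \<partial>(case i of (m, n) \<Rightarrow> distr M borel (S m n))) =
          (case i of (m, n) \<Rightarrow> perm_avg (m + n) (\<lambda>\<sigma>. exp (- real k * perm_stat (h (m + n)) m n \<sigma>)))" for i
        by (cases i) (simp add: integral_distr avg[of "\<lambda>x. exp (- (real k * x))"])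
      moreover have "(\<integral>x. exp (- real k * x) \<partial>distr P borel (\<lambda>\<omega>. \<Sum>j. \<tau> j * (Z j \<omega>)\<^sup>2)) =
          (\<integral>\<omega>. exp (- real k * (\<Sum>j. \<tau> j * (Z j \<omega>)\<^sup>2)) \<partial>P)"
        by (rule integral_distr) measurable
      ultimately show "((\<lambda>i. \<integral>x. exp (- real k * x) \<partial>(case i of (m, n) \<Rightarrow> distr M borel (S m n))) \<longlongrightarrow>
          (\<integral>x. exp (- real k * x) \<partial>distr P borel (\<lambda>\<omega>. \<Sum>j. \<tau> j * (Z j \<omega>)\<^sup>2))) min_at_top"
        using perm_stat_laplace_limit[where T = T and r = r and \<tau> = \<tau> and t = "real k",
            OF T0 zero r \<tau> close h Z _ diag[OF Z]]
        by simp
    qed simp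
    then show ?thesis using summ unfolding S_eq by simp
  qed
  then show ?thesis using \<tau>(1) by (intro exI[of _ \<tau>]) blast
qed

end
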